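(* Let $C_1,\dots,C_n$ be independent first class constraints on $\mathcal{M}$ and let $1\le m<n$ be such that $\mathfrak{C}_1:=\{C_{m+1},\dots,C_n\}$ is a subalgebra of the constraint algebra. Let $T_1,\dots,T_n,f\in C^\infty(\mathcal{M})$ be such that $f$ and $T_1,\dots,T_m$ are weakly $\mathfrak{C}_1$-invariant and the matrix $A_{kl}:=\{C_k,T_l\}$, $1\le k,l\le n$, is invertible on $\mathcal{C}$. Then the submatrix $A'_{kl}:=\{C_k,T_l\}$, $1\le k,l\le m$, is invertible on $\mathcal{C}$, and, with $g_j:=\sum_{k=1}^mA'^{-1}_{jk}\{C_k,f\}$ for $j=1,\dots,m$ (smooth near $\mathcal{C}$): (a) each $g_j$ is again weakly $\mathfrak{C}_1$-invariant; (b) for every $x\in\mathcal{C}$ for which $\mathbf{T}_x:\mathcal{G}_x\to\mathbb{R}^n$, $y\mapsto(T_1(y),\dots,T_n(y))$, is injective, the complete observable $F_{[f,T_i]}(\tau,x)=f(\mathbf{T}_x^{-1}(\tau))$, $\tau\in\mathbf{T}_x(\mathcal{G}_x)$, satisfies $$\frac{\partial}{\partial\tau_j}F_{[f,T_i]}(\tau,x)=0\ \ (j=m+1,\dots,n),\qquad \frac{\partial}{\partial\tau_j}F_{[f,T_i]}(\tau,x)=g_j(\mathbf{T}_x^{-1}(\tau))\ \ (j=1,\dots,m);$$ (c) with $S_j(h):=\sum_{l=1}^nA^{-1}_{jl}\{C_l,h\}$ (near $\mathcal{C}$), every function $S_1^{k_1}\circ\cdots\circ S_n^{k_n}(f)$,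 $k_1,\dots,k_n\ge0$, is weakly $\mathfrak{C}_1$-invariant, and it vanishes on $\mathcal{C}$ whenever $k_j>0$ for some $j\in\{m+1,\dots,n\}$. Consequently, the formal power series $$\sum_{k_1,\dots,k_n\ge0}\frac{1}{k_1!\cdots k_n!}\,S_1^{k_1}\circ\cdots\circ S_n^{k_n}(f)\,\prod_{i=1}^n(\tau_i-T_i)^{k_i}$$ for the complete observable is, on $\mathcal{C}$, independent of $\tau_{m+1},\dots,\tau_n$ and is term by term weakly $\mathfrak{C}_1$-invariant (apart from terms vanishing on $\mathcal{C}$); on $\mathcal{C}$ it does not depend on the choice of the remaining clock variables $T_{m+1},\dots,T_n$.
   Context: $\mathcal{M}$ is a $2p$-dimensional smooth manifold with a non-degenerate Poisson bracket $\{\cdot,\cdot\}$. The constraints $C_1,\dots,C_n\in C^\infty(\mathcal{M})$, $n<p$, are independent, meaning that the constraint hypersurface $\mathcal{C}=\{C_1=\dots=C_n=0\}$ is a $(2p-n)$-dimensional submanifold, and first class: $\{C_i,C_j\}=\sum_k f_{ijk}C_k$ with $f_{ijk}\in C^\infty(\mathcal{M})$. $\mathfrak{C}_1$ being a subalgebra means that brackets of its elements are combinations (with smooth coefficients) of elements of $\mathfrak{C}_1$; the remaining constraints $\{C_1,\dots,C_m\}$ need not form a subalgebra and $\mathfrak{C}_1$ need not be an ideal. A function $h$ is weakly $\mathfrak{C}_1$-invariant if $\{C_l,h\}=0$ on $\mathcal{C}$ for $l=m+1,\dots,n$. The gauge orbit $\mathcal{G}_x$ of $x\in\mathcal{C}$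 is the set of points reached from $x$ by finite compositions of Hamiltonian flows generated by the constraints; it is an $n$-dimensional submanifold of $\mathcal{C}$ with tangent spaces spanned by the Hamiltonian vector fields $\chi_{C_1},\dots,\chi_{C_n}$, where $\chi_C(f)=\{C,f\}$. If $\mathbf{T}_x$ is injective on $\mathcal{G}_x$, $\mathbf{T}_x^{-1}(\tau)$ is the unique $y\in\mathcal{G}_x$ with $T_i(y)=\tau_i$ for all $i$. Since invertibility of $A$ and $A'$ is an open condition, $A^{-1}$ and $A'^{-1}$ are smooth on a neighbourhood of $\mathcal{C}$. *)

theory Defs
  imports
    "HOL-Analysis.Analysis"
    "Jordan_Normal_Form.Gauss_Jordan_Elimination"
begin

unbundle no vec_syntax
hide_const (open) Finite_Cartesian_Product.vec Finite_Cartesian_Product.mat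

section \<open>Smooth manifolds\<close>

fun times_differentiable_on ::
  "nat \<Rightarrow> 'b::real_normed_vector set \<Rightarrow> ('b \<Rightarrow> 'c::real_normed_vector) \<Rightarrow> bool" where
  "times_differentiable_on 0 S f \<longleftrightarrow> continuous_on S f"
| "times_differentiable_on (Suc k) S f \<longleftrightarrow>
     (\<forall>x\<in>S. f differentiable (at x)) \<and>
     (\<forall>v. times_differentiable_on k S (\<lambda>x. frechet_derivative f (at x) v))"

text \<open>Intended for open \<open>S\<close> only.\<close>

definition smooth_on :: "'b::real_normed_vector set \<Rightarrow> ('b \<Rightarrow> 'c::real_normed_vector) \<Rightarrow> bool" where
  "smooth_on S f \<longleftrightarrow> (\<forall>k. times_differentiable_on k S f)"

text \<open>The manifold is a whole type \<open>'a\<close>; a chart is a pair of an open domain and a coordinate map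
  into the Euclidean space \<open>'b\<close>, of which only the restriction to the domain matters.\<close>

type_synonym ('a, 'b) chart = "'a set \<times> ('a \<Rightarrow> 'b)"

definition is_chart :: "('a::topological_space, 'b::euclidean_space) chart \<Rightarrow> bool" where
  "is_chart c \<longleftrightarrow> (case c of (U, \<phi>) \<Rightarrow>
     open U \<and> open (\<phi> ` U) \<and> homeomorphism U (\<phi> ` U) \<phi> (inv_into U \<phi>))"

definition smooth_transition ::
  "('a::topological_space, 'b::euclidean_space) chart \<Rightarrow> ('a, 'b) chart \<Rightarrow> bool" where
  "smooth_transition c d \<longleftrightarrow> (case (c, d) of ((U, \<phi>), (V, \<psi>)) \<Rightarrow>
     smooth_on (\<phi> ` (U \<inter> V)) (\<psi> \<circ> inv_into U \<phi>))"

definition smooth_atlas :: "('a::topological_space, 'b::euclidean_space) chart set \<Rightarrow> bool" where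
  "smooth_atlas \<A> \<longleftrightarrow>
     (\<forall>c\<in>\<A>. is_chart c) \<and> (\<Union>c\<in>\<A>. fst c) = UNIV \<and> (\<forall>c\<in>\<A>. \<forall>d\<in>\<A>. smooth_transition c d)"

text \<open>Charts of the maximal atlas generated by \<open>\<A>\<close>.\<close>

definition compatible_chart ::
  "('a::topological_space, 'b::euclidean_space) chart set \<Rightarrow> ('a, 'b) chart \<Rightarrow> bool" where
  "compatible_chart \<A> c \<longleftrightarrow>
     is_chart c \<and> (\<forall>d\<in>\<A>. smooth_transition c d \<and> smooth_transition d c)"

definition smooth_fun_on ::
  "('a::topological_space, 'b::euclidean_space) chart set \<Rightarrow> 'a set \<Rightarrow> ('a \<Rightarrow> real) \<Rightarrow> bool" where
  "smooth_fun_on \<A> W h \<longleftrightarrow> (\<forall>(U, \<phi>)\<in>\<A>. smooth_on (\<phi> ` (U \<inter> W)) (h \<circ> inv_into U \<phi>))"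

definition smooth_functions ::
  "('a::topological_space, 'b::euclidean_space) chart set \<Rightarrow> ('a \<Rightarrow> real) set" where
  "smooth_functions \<A> = {h. smooth_fun_on \<A> UNIV h}"

definition differential_vanishes_at ::
  "('a::topological_space, 'b::euclidean_space) chart set \<Rightarrow> ('a \<Rightarrow> real) \<Rightarrow> 'a \<Rightarrow> bool" where
  "differential_vanishes_at \<A> h x \<longleftrightarrow>
     (\<forall>(U, \<phi>)\<in>\<A>. x \<in> U \<longrightarrow> ((h \<circ> inv_into U \<phi>) has_derivative (\<lambda>v. 0)) (at (\<phi> x)))"

text \<open>Embedded submanifolds, by slice charts.\<close>

definition submanifold ::
  "('a::topological_space, 'b::euclidean_space) chart set \<Rightarrow> nat \<Rightarrow> 'a set \<Rightarrow> bool" where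
  "submanifold \<A> d N \<longleftrightarrow>
     (\<forall>x\<in>N. \<exists>U \<phi> L. compatible_chart \<A> (U, \<phi>) \<and> x \<in> U \<and>
        subspace L \<and> dim L = d \<and> \<phi> ` (U \<inter> N) = \<phi> ` U \<inter> L)"

section \<open>Poisson brackets and Hamiltonian flows\<close>

text \<open>Only the values of \<open>pb\<close> on smooth functions are constrained.\<close>

definition poisson_bracket ::
  "('a::topological_space, 'b::euclidean_space) chart set \<Rightarrow>
   (('a \<Rightarrow> real) \<Rightarrow> ('a \<Rightarrow> real) \<Rightarrow> 'a \<Rightarrow> real) \<Rightarrow> bool" where
  "poisson_bracket \<A> pb \<longleftrightarrow>
     (\<forall>f\<in>smooth_functions \<A>. \<forall>g\<in>smooth_functions \<A>. pb f g \<in> smooth_functions \<A>) \<and>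
     (\<forall>f\<in>smooth_functions \<A>. \<forall>g\<in>smooth_functions \<A>. \<forall>x. pb f g x = - pb g f x) \<and>
     (\<forall>f\<in>smooth_functions \<A>. \<forall>g\<in>smooth_functions \<A>. \<forall>h\<in>smooth_functions \<A>. \<forall>a b x.
        pb f (\<lambda>y. a * g y + b * h y) x = a * pb f g x + b * pb f h x) \<and>
     (\<forall>f\<in>smooth_functions \<A>. \<forall>g\<in>smooth_functions \<A>. \<forall>h\<in>smooth_functions \<A>. \<forall>x.
        pb f (\<lambda>y. g y * h y) x = pb f g x * h x + g x * pb f h x) \<and>
     (\<forall>f\<in>smooth_functions \<A>. \<forall>g\<in>smooth_functions \<A>. \<forall>h\<in>smooth_functions \<A>. \<forall>x.
        pb f (pb g h) x + pb g (pb h f) x + pb h (pb f g) x = 0)"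

definition nondegenerate ::
  "('a::topological_space, 'b::euclidean_space) chart set \<Rightarrow>
   (('a \<Rightarrow> real) \<Rightarrow> ('a \<Rightarrow> real) \<Rightarrow> 'a \<Rightarrow> real) \<Rightarrow> bool" where
  "nondegenerate \<A> pb \<longleftrightarrow>
     (\<forall>f\<in>smooth_functions \<A>. \<forall>x.
        (\<forall>g\<in>smooth_functions \<A>. pb f g x = 0) \<longrightarrow> differential_vanishes_at \<A> f x)"

text \<open>The Hamiltonian vector field \<open>\<chi>\<^sub>C\<close> acts on functions \<open>h\<close> that are smooth only near \<open>x\<close>, by
  evaluating the bracket on any globally smooth function with the same germ at \<open>x\<close>; brackets are
  local, so the choice is immaterial, and for globally smooth \<open>h\<close> this is \<open>pb C h x\<close>.\<close>

definition ham_vf ::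
  "('a::topological_space, 'b::euclidean_space) chart set \<Rightarrow>
   (('a \<Rightarrow> real) \<Rightarrow> ('a \<Rightarrow> real) \<Rightarrow> 'a \<Rightarrow> real) \<Rightarrow> ('a \<Rightarrow> real) \<Rightarrow> ('a \<Rightarrow> real) \<Rightarrow> 'a \<Rightarrow> real" where
  "ham_vf \<A> pb C h x =
     pb C (SOME k. k \<in> smooth_functions \<A> \<and> (\<forall>\<^sub>F y in nhds x. k y = h y)) x"

definition integral_curve ::
  "('a::topological_space, 'b::euclidean_space) chart set \<Rightarrow>
   (('a \<Rightarrow> real) \<Rightarrow> ('a \<Rightarrow> real) \<Rightarrow> 'a \<Rightarrow> real) \<Rightarrow> ('a \<Rightarrow> real) \<Rightarrow> (real \<Rightarrow> 'a) \<Rightarrow> real set \<Rightarrow> bool" where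
  "integral_curve \<A> pb C \<gamma> I \<longleftrightarrow>
     open I \<and> is_interval I \<and> continuous_on I \<gamma> \<and>
     (\<forall>h\<in>smooth_functions \<A>. \<forall>t\<in>I.
        ((\<lambda>s. h (\<gamma> s)) has_real_derivative pb C h (\<gamma> t)) (at t))"

text \<open>\<open>y\<close> is the image of \<open>x\<close> under the (possibly only locally defined) Hamiltonian flow of \<open>C\<close> at
  some positive, negative or zero time \<open>t\<close>.\<close>

definition flow_related ::
  "('a::topological_space, 'b::euclidean_space) chart set \<Rightarrow>
   (('a \<Rightarrow> real) \<Rightarrow> ('a \<Rightarrow> real) \<Rightarrow> 'a \<Rightarrow> real) \<Rightarrow> ('a \<Rightarrow> real) \<Rightarrow> 'a \<Rightarrow> 'a \<Rightarrow> bool" where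
  "flow_related \<A> pb C x y \<longleftrightarrow>
     (\<exists>\<gamma> I t. integral_curve \<A> pb C \<gamma> I \<and> 0 \<in> I \<and> t \<in> I \<and> \<gamma> 0 = x \<and> \<gamma> t = y)"

section \<open>First class constraints\<close>

text \<open>A family \<open>(C\<^sub>1, \<dots>, C\<^sub>n)\<close> is indexed here by \<open>{..<n}\<close>, so that \<open>C\<^sub>1, \<dots>, C\<^sub>m\<close> correspond to
  indices below \<open>m\<close> and \<open>C\<^bsub>m+1\<^esub>, \<dots>, C\<^sub>n\<close> to indices in \<open>{m..<n}\<close>.\<close>

definition constraint_surface :: "nat \<Rightarrow> (nat \<Rightarrow> 'a \<Rightarrow> real) \<Rightarrow> 'a set" where
  "constraint_surface n C = {x. \<forall>i<n. C i x = 0}"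

text \<open>With \<open>I = {..<n}\<close> this says that the constraints are first class, with \<open>I = {m..<n}\<close> that the
  corresponding subset is a subalgebra of the constraint algebra.\<close>

definition bracket_closed ::
  "('a::topological_space, 'b::euclidean_space) chart set \<Rightarrow>
   (('a \<Rightarrow> real) \<Rightarrow> ('a \<Rightarrow> real) \<Rightarrow> 'a \<Rightarrow> real) \<Rightarrow> (nat \<Rightarrow> 'a \<Rightarrow> real) \<Rightarrow> nat set \<Rightarrow> bool" where
  "bracket_closed \<A> pb C I \<longleftrightarrow>
     (\<forall>i\<in>I. \<forall>j\<in>I. \<exists>F. (\<forall>k\<in>I. F k \<in> smooth_functions \<A>) \<and>
        (\<forall>x. pb (C i) (C j) x = (\<Sum>k\<in>I. F k x * C k x)))"

text \<open>Invariance under \<open>{C\<^bsub>m+1\<^esub>, \<dots>, C\<^sub>n}\<close>; it includes smoothness near the constraint surface, without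
  which the bracket has no meaning.\<close>

definition weakly_invariant ::
  "('a::topological_space, 'b::euclidean_space) chart set \<Rightarrow>
   (('a \<Rightarrow> real) \<Rightarrow> ('a \<Rightarrow> real) \<Rightarrow> 'a \<Rightarrow> real) \<Rightarrow> nat \<Rightarrow> (nat \<Rightarrow> 'a \<Rightarrow> real) \<Rightarrow> nat \<Rightarrow>
   ('a \<Rightarrow> real) \<Rightarrow> bool" where
  "weakly_invariant \<A> pb n C m h \<longleftrightarrow>
     (\<exists>W. open W \<and> constraint_surface n C \<subseteq> W \<and> smooth_fun_on \<A> W h) \<and>
     (\<forall>l\<in>{m..<n}. \<forall>x\<in>constraint_surface n C. ham_vf \<A> pb (C l) h x = 0)"

definition gauge_orbit ::
  "('a::topological_space, 'b::euclidean_space) chart set \<Rightarrow>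
   (('a \<Rightarrow> real) \<Rightarrow> ('a \<Rightarrow> real) \<Rightarrow> 'a \<Rightarrow> real) \<Rightarrow> nat \<Rightarrow> (nat \<Rightarrow> 'a \<Rightarrow> real) \<Rightarrow> 'a \<Rightarrow> 'a set" where
  "gauge_orbit \<A> pb n C x = {y. (\<lambda>u v. \<exists>i<n. flow_related \<A> pb (C i) u v)\<^sup>*\<^sup>* x y}"

section \<open>Clock variables and complete observables\<close>

text \<open>The matrix \<open>A\<close> for \<open>q = n\<close> and its submatrix \<open>A'\<close> for \<open>q = m\<close>.\<close>

definition clock_matrix ::
  "(('a \<Rightarrow> real) \<Rightarrow> ('a \<Rightarrow> real) \<Rightarrow> 'a \<Rightarrow> real) \<Rightarrow> (nat \<Rightarrow> 'a \<Rightarrow> real) \<Rightarrow> (nat \<Rightarrow> 'a \<Rightarrow> real) \<Rightarrow>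
   nat \<Rightarrow> 'a \<Rightarrow> real mat" where
  "clock_matrix pb C T q x = Matrix.mat q q (\<lambda>(k, l). pb (C k) (T l) x)"

abbreviation mat_inv :: "real mat \<Rightarrow> real mat" where
  "mat_inv M \<equiv> the (mat_inverse M)"

text \<open>\<open>\<T>\<^sub>x\<close> is the restriction of this map to the gauge orbit of \<open>x\<close>; \<open>\<real>\<^sup>n\<close> is \<open>carrier_vec n\<close>.\<close>

definition clock_map :: "nat \<Rightarrow> (nat \<Rightarrow> 'a \<Rightarrow> real) \<Rightarrow> 'a \<Rightarrow> real vec" where
  "clock_map n T y = Matrix.vec n (\<lambda>i. T i y)"

definition clock_inverse ::
  "('a::topological_space, 'b::euclidean_space) chart set \<Rightarrow>
   (('a \<Rightarrow> real) \<Rightarrow> ('a \<Rightarrow> real) \<Rightarrow> 'a \<Rightarrow> real) \<Rightarrow> nat \<Rightarrow> (nat \<Rightarrow> 'a \<Rightarrow> real) \<Rightarrow>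
   (nat \<Rightarrow> 'a \<Rightarrow> real) \<Rightarrow> 'a \<Rightarrow> real vec \<Rightarrow> 'a" where
  "clock_inverse \<A> pb n C T x \<tau> = the_inv_into (gauge_orbit \<A> pb n C x) (clock_map n T) \<tau>"

definition complete_observable ::
  "('a::topological_space, 'b::euclidean_space) chart set \<Rightarrow>
   (('a \<Rightarrow> real) \<Rightarrow> ('a \<Rightarrow> real) \<Rightarrow> 'a \<Rightarrow> real) \<Rightarrow> nat \<Rightarrow> (nat \<Rightarrow> 'a \<Rightarrow> real) \<Rightarrow>
   (nat \<Rightarrow> 'a \<Rightarrow> real) \<Rightarrow> ('a \<Rightarrow> real) \<Rightarrow> real vec \<Rightarrow> 'a \<Rightarrow> real" where
  "complete_observable \<A> pb n C T f \<tau> x = f (clock_inverse \<A> pb n C T x \<tau>)"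

text \<open>Partial derivative of a function defined on \<open>D \<subseteq> \<real>\<^sup>n\<close> only: the line through \<open>\<tau>\<close> in
  direction \<open>j\<close> has to stay in \<open>D\<close> near \<open>\<tau>\<close>.\<close>

definition has_partial_derivative ::
  "nat \<Rightarrow> real vec set \<Rightarrow> (real vec \<Rightarrow> real) \<Rightarrow> nat \<Rightarrow> real vec \<Rightarrow> real \<Rightarrow> bool" where
  "has_partial_derivative n D F j \<tau> d \<longleftrightarrow>
     (\<forall>\<^sub>F s in nhds 0. \<tau> + s \<cdot>\<^sub>v unit_vec n j \<in> D) \<and>
     ((\<lambda>s. F (\<tau> + s \<cdot>\<^sub>v unit_vec n j)) has_real_derivative d) (at 0)"

definition reduced_derivative ::
  "(('a \<Rightarrow> real) \<Rightarrow> ('a \<Rightarrow> real) \<Rightarrow> 'a \<Rightarrow> real) \<Rightarrow> nat \<Rightarrow> (nat \<Rightarrow> 'a \<Rightarrow> real) \<Rightarrow>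
   (nat \<Rightarrow> 'a \<Rightarrow> real) \<Rightarrow> ('a \<Rightarrow> real) \<Rightarrow> nat \<Rightarrow> 'a \<Rightarrow> real" where
  "reduced_derivative pb m C T f j x =
     (\<Sum>k<m. mat_inv (clock_matrix pb C T m x) $$ (j, k) * pb (C k) f x)"

definition S_op ::
  "('a::topological_space, 'b::euclidean_space) chart set \<Rightarrow>
   (('a \<Rightarrow> real) \<Rightarrow> ('a \<Rightarrow> real) \<Rightarrow> 'a \<Rightarrow> real) \<Rightarrow> nat \<Rightarrow> (nat \<Rightarrow> 'a \<Rightarrow> real) \<Rightarrow>
   (nat \<Rightarrow> 'a \<Rightarrow> real) \<Rightarrow> nat \<Rightarrow> ('a \<Rightarrow> real) \<Rightarrow> 'a \<Rightarrow> real" where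
  "S_op \<A> pb n C T j h x =
     (\<Sum>l<n. mat_inv (clock_matrix pb C T n x) $$ (j, l) * ham_vf \<A> pb (C l) h x)"

text \<open>\<open>S\<^sub>1\<^bsup>k\<^sub>1\<^esup> \<circ> \<dots> \<circ> S\<^sub>n\<^bsup>k\<^sub>n\<^esup>\<close> applied to \<open>f\<close>, the operator with the largest index acting first.\<close>

definition S_iter ::
  "('a::topological_space, 'b::euclidean_space) chart set \<Rightarrow>
   (('a \<Rightarrow> real) \<Rightarrow> ('a \<Rightarrow> real) \<Rightarrow> 'a \<Rightarrow> real) \<Rightarrow> nat \<Rightarrow> (nat \<Rightarrow> 'a \<Rightarrow> real) \<Rightarrow>
   (nat \<Rightarrow> 'a \<Rightarrow> real) \<Rightarrow> (nat \<Rightarrow> nat) \<Rightarrow> ('a \<Rightarrow> real) \<Rightarrow> 'a \<Rightarrow> real" where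
  "S_iter \<A> pb n C T k f = foldr (\<lambda>j. S_op \<A> pb n C T j ^^ k j) [0..<n] f"

text \<open>The formal power series is the family of its terms, indexed by the multi-indices \<open>k\<close>.\<close>

definition series_term ::
  "('a::topological_space, 'b::euclidean_space) chart set \<Rightarrow>
   (('a \<Rightarrow> real) \<Rightarrow> ('a \<Rightarrow> real) \<Rightarrow> 'a \<Rightarrow> real) \<Rightarrow> nat \<Rightarrow> (nat \<Rightarrow> 'a \<Rightarrow> real) \<Rightarrow>
   (nat \<Rightarrow> 'a \<Rightarrow> real) \<Rightarrow> ('a \<Rightarrow> real) \<Rightarrow> real vec \<Rightarrow> (nat \<Rightarrow> nat) \<Rightarrow> 'a \<Rightarrow> real" where
  "series_term \<A> pb n C T f \<tau> k x =
     1 / (\<Prod>i<n. fact (k i)) * S_iter \<A> pb n C T k f x * (\<Prod>i<n. (\<tau> $ i - T i x) ^ k i)"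

end

(* On the constraint surface a function vanishing there has vanishing brackets with all constraints:
   invertibility of A makes the differentials dC_1, ..., dC_n independent, so the first class vector
   fields, which annihilate all C_k, lie in the tangent space of the surface by a dimension count.
   Weak invariance of T_1, ..., T_m makes A block triangular there, which gives the invertibility
   of A', identifies g_j with S_j(f), and kills S_j(h) for j > m and h weakly invariant.  Bracketing
   sum_j A_kj S_j(h) = {C_k, h} with C_l, l > m, and using Jacobi's identity leaves a homogeneous
   linear system for {C_l, S_j(h)}, so S_j preserves weak invariance.  On the surface S_j(h) depends only
   on A' and on the values of h there, hence not on T_{m+1}, ..., T_n.

   For the partial derivatives, compose the flows of C_1, ..., C_n with times t_1, ..., t_n started at
   y = T_x^{-1}(tau).  This map into the orbit is continuous and, after composition with (T_1, ..., T_n),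
   has the invertible derivative A(y) (transposed) at t = 0.  By Brouwer's theorem it covers a
   neighbourhood of tau, and any choice of small preimages is differentiable at tau; this yields
   S_j(f)(y) as the j-th partial derivative without any smooth dependence of flows on initial values. *)

theory Submission
  imports Defs "Jordan_Normal_Form.Determinant"
begin

text \<open>The hypotheses give less than the geometry suggests, and this shapes the proof. Slice
  charts describe \<open>\<C>\<close> only as a set, so a function vanishing on it cannot be
  expanded in the \<open>C k\<close> directly; tangency of the constraint vector fields replaces
  that expansion. The bracket operates on globally smooth functions, whereas S_j(h) is smooth only
  near \<open>\<C>\<close>: bump functions extend germs, the Leibniz rule makes the bracket local,
  and Hadamard's lemma turns it into a tangent vector, to which a dimension count can be applied. An
  orbit is a set of points reachable by flows, without a manifold structure, so neither continuity
  of the inverse clock map nor openness of its domain is at hand. Both halves of a partial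
  derivative, that the line stays in the domain and that the difference quotient converges, have to
  come from the composed flows. As n is a variable and not a type, maps on n clock values are padded
  to maps of the model space into itself.\<close>

no_notation scalar_prod (infix "\<bullet>" 70)

section \<open>Closure properties of smooth maps, with bumps and Hadamard's lemma\<close>

section \<open>Calculus of smooth maps\<close>

lemma has_derivative_cong_open:
  assumes "open S" "x \<in> S" "\<And>y. y \<in> S \<Longrightarrow> f y = g y"
  shows "(f has_derivative D) (at x) \<longleftrightarrow> (g has_derivative D) (at x)"
  using has_derivative_transform_within_open[of f D x UNIV S g]
    has_derivative_transform_within_open[of g D x UNIV S f] assms by auto

lemma frechet_derivative_cong_open:
  assumes "open S" "x \<in> S" "\<And>y. y \<in> S \<Longrightarrow> f y = g y"
  shows "frechet_derivative f (at x) = frechet_derivative g (at x)"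
  unfolding frechet_derivative_def using has_derivative_cong_open[OF assms] by simp

lemma times_differentiable_on_cong:
  assumes "open S" "\<And>y. y \<in> S \<Longrightarrow> f y = g y"
  shows "times_differentiable_on k S f \<longleftrightarrow> times_differentiable_on k S g"
  using assms(2)
proof (induction k arbitrary: f g)
  case 0
  then show ?case by (auto cong: continuous_on_cong)
next
  case (Suc k)
  have 1: "f differentiable at x \<longleftrightarrow> g differentiable at x" if "x \<in> S" for x
    unfolding differentiable_def using has_derivative_cong_open[OF assms(1) that Suc.prems] by auto
  have 2: "times_differentiable_on k S (\<lambda>x. frechet_derivative f (at x) v) \<longleftrightarrow>
      times_differentiable_on k S (\<lambda>x. frechet_derivative g (at x) v)" for v
    by (rule Suc.IH) (simp add: frechet_derivative_cong_open[OF assms(1) _ Suc.prems])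
  show ?case by (simp add: 1 2)
qed

lemma times_differentiable_on_SucD:
  assumes "times_differentiable_on (Suc k) S f"
  shows "times_differentiable_on k S f"
  using assms
proof (induction k arbitrary: f)
  case 0
  then show ?case
    by (auto intro!: continuous_at_imp_continuous_on differentiable_imp_continuous_within)
qed auto

lemma times_differentiable_on_has_derivative:
  assumes "times_differentiable_on (Suc k) S f" "x \<in> S"
  shows "(f has_derivative frechet_derivative f (at x)) (at x)"
  using assms by (auto simp: frechet_derivative_works)

lemma times_differentiable_on_frechet_derivative:
  "times_differentiable_on (Suc k) S f \<Longrightarrow>
    times_differentiable_on k S (\<lambda>x. frechet_derivative f (at x) v)"
  by simp

text \<open>\<open>frechet_derivative\<close> is a choice term; uniqueness of the derivative on an
  open set lets inductions on the order run with any explicit formula \<open>f'\<close>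
  instead.\<close>

lemma times_differentiable_on_SucI:
  assumes "open S" "\<And>x. x \<in> S \<Longrightarrow> (f has_derivative f' x) (at x)"
    and "\<And>v. times_differentiable_on k S (\<lambda>x. f' x v)"
  shows "times_differentiable_on (Suc k) S f"
proof -
  have "frechet_derivative f (at x) = f' x" if "x \<in> S" for x
    using frechet_derivative_at[OF assms(2)[OF that]] by simp
  then have "times_differentiable_on k S (\<lambda>x. frechet_derivative f (at x) v)" for v
    using assms(3)[of v] by (subst times_differentiable_on_cong[OF assms(1), of _ "\<lambda>x. f' x v"]) simp_all
  then show ?thesis using assms(2) by (auto simp: differentiable_def)
qed

lemma times_differentiable_on_subset:
  "times_differentiable_on k T f \<Longrightarrow> S \<subseteq> T \<Longrightarrow> times_differentiable_on k S f"
  by (induction k arbitrary: f) (auto intro: continuous_on_subset)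

lemma times_differentiable_on_UN:
  assumes "\<And>i. i \<in> I \<Longrightarrow> open (S i)" "\<And>i. i \<in> I \<Longrightarrow> times_differentiable_on k (S i) f"
  shows "times_differentiable_on k (\<Union>i\<in>I. S i) f"
  using assms(2)
proof (induction k arbitrary: f)
  case 0
  then show ?case by (auto intro!: continuous_on_open_UN assms(1))
qed auto

lemma times_differentiable_on_const: "times_differentiable_on k S (\<lambda>x. c)"
  by (induction k arbitrary: c) auto

lemma times_differentiable_on_bounded_linear:
  assumes "bounded_linear L"
  shows "times_differentiable_on k S L"
proof (cases k)
  case 0
  then show ?thesis using assms by (simp add: linear_continuous_on)
next
  case (Suc j)
  have *: "(L has_derivative L) (at x)" for x by (rule bounded_linear_imp_has_derivative[OF assms])
  have "frechet_derivative L (at x) = L" for x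
    using frechet_derivative_at[OF *] by simp
  then show ?thesis using * by (auto simp: Suc differentiable_def times_differentiable_on_const)
qed

lemma times_differentiable_on_linear_compose:
  assumes "open S" "bounded_linear L" "times_differentiable_on k S f"
  shows "times_differentiable_on k S (\<lambda>x. L (f x))"
  using assms(3)
proof (induction k arbitrary: f)
  case 0
  then show ?case using bounded_linear.continuous_on[OF assms(2)] by auto
next
  case (Suc k)
  show ?case
  proof (rule times_differentiable_on_SucI[where f'="\<lambda>x v. L (frechet_derivative f (at x) v)",
        OF assms(1)])
    show "((\<lambda>x. L (f x)) has_derivative (\<lambda>v. L (frechet_derivative f (at x) v))) (at x)"
      if "x \<in> S" for x
      by (rule bounded_linear.has_derivative[OF assms(2)
            times_differentiable_on_has_derivative[OF Suc.prems that]])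
    show "times_differentiable_on k S (\<lambda>x. L (frechet_derivative f (at x) v))" for v
      by (rule Suc.IH[OF times_differentiable_on_frechet_derivative[OF Suc.prems]])
  qed
qed

lemma times_differentiable_on_add:
  assumes "open S" "times_differentiable_on k S f" "times_differentiable_on k S g"
  shows "times_differentiable_on k S (\<lambda>x. f x + g x)"
  using assms(2,3)
proof (induction k arbitrary: f g)
  case 0
  then show ?case by (simp add: continuous_on_add)
next
  case (Suc k)
  show ?case
  proof (rule times_differentiable_on_SucI[OF assms(1)])
    show "((\<lambda>x. f x + g x) has_derivative
        (\<lambda>v. frechet_derivative f (at x) v + frechet_derivative g (at x) v)) (at x)"
      if "x \<in> S" for x
      by (rule has_derivative_add[OF Suc.prems[THEN times_differentiable_on_has_derivative, OF that]])
    show "times_differentiable_on k S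
        (\<lambda>x. frechet_derivative f (at x) v + frechet_derivative g (at x) v)" for v
      by (rule Suc.IH[OF Suc.prems[THEN times_differentiable_on_frechet_derivative]])
  qed
qed

lemma times_differentiable_on_sum:
  assumes "open S" "\<And>i. i \<in> I \<Longrightarrow> times_differentiable_on k S (f i)"
  shows "times_differentiable_on k S (\<lambda>x. \<Sum>i\<in>I. f i x)"
  using assms(2)
  by (induction I rule: infinite_finite_induct)
    (auto intro!: times_differentiable_on_add assms(1) times_differentiable_on_const)

lemma times_differentiable_on_bilinear:
  assumes "open S" "bounded_bilinear prd"
    and "times_differentiable_on k S f" "times_differentiable_on k S g"
  shows "times_differentiable_on k S (\<lambda>x. prd (f x) (g x))"
  using assms(3,4)
proof (induction k arbitrary: f g)
  case 0
  then show ?case by (auto intro!: bounded_bilinear.continuous_on[OF assms(2)])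
next
  case (Suc k)
  show ?case
  proof (rule times_differentiable_on_SucI[OF assms(1)])
    show "((\<lambda>x. prd (f x) (g x)) has_derivative (\<lambda>v. prd (f x) (frechet_derivative g (at x) v)
        + prd (frechet_derivative f (at x) v) (g x))) (at x)" if "x \<in> S" for x
      by (rule bounded_bilinear.FDERIV[OF assms(2)
            Suc.prems[THEN times_differentiable_on_has_derivative, OF that]])
    show "times_differentiable_on k S (\<lambda>x. prd (f x) (frechet_derivative g (at x) v)
        + prd (frechet_derivative f (at x) v) (g x))" for v
      by (intro times_differentiable_on_add[OF assms(1)] Suc.IH
          Suc.prems[THEN times_differentiable_on_SucD]
          Suc.prems[THEN times_differentiable_on_frechet_derivative])
  qed
qed

text \<open>In the derivative of the composite both the base point and the direction in which
  \<open>g\<close> is differentiated vary with x. Expanding the direction in \<open>Basis\<close>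
  leaves derivatives of \<open>g\<close> in fixed directions, to which the induction hypothesis
  applies.\<close>

lemma times_differentiable_on_compose:
  fixes f :: "'x::euclidean_space \<Rightarrow> 'y::euclidean_space" and g :: "'y \<Rightarrow> 'z::real_normed_vector"
  assumes "open S" "open T" "f ` S \<subseteq> T"
    and "times_differentiable_on k S f" "times_differentiable_on k T g"
  shows "times_differentiable_on k S (\<lambda>x. g (f x))"
  using assms(4,5)
proof (induction k arbitrary: g)
  case 0
  then show ?case using continuous_on_compose2[of T g S f] assms(3) by auto
next
  case (Suc k)
  let ?f' = "\<lambda>x. frechet_derivative f (at x)" and ?g' = "\<lambda>y. frechet_derivative g (at y)"
  have f': "(f has_derivative ?f' x) (at x)" if "x \<in> S" for x
    using times_differentiable_on_has_derivative[OF Suc.prems(1)] that by auto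
  have g': "(g has_derivative ?g' (f x)) (at (f x))" if "x \<in> S" for x
    using times_differentiable_on_has_derivative[OF Suc.prems(2)] that assms(3) by auto
  show ?case
  proof (rule times_differentiable_on_SucI[where
        f'="\<lambda>x v. \<Sum>b\<in>Basis. (?f' x v \<bullet> b) *\<^sub>R ?g' (f x) b", OF assms(1)])
    fix x assume "x \<in> S"
    interpret L: bounded_linear "?g' (f x)"
      using g'[OF \<open>x \<in> S\<close>] has_derivative_bounded_linear by blast
    have rep: "?g' (f x) w = (\<Sum>b\<in>Basis. (w \<bullet> b) *\<^sub>R ?g' (f x) b)" for w
    proof -
      have "?g' (f x) w = ?g' (f x) (\<Sum>b\<in>Basis. (w \<bullet> b) *\<^sub>R b)"
        by (simp add: euclidean_representation)
      also have "\<dots> = (\<Sum>b\<in>Basis. (w \<bullet> b) *\<^sub>R ?g' (f x) b)"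
        by (simp add: L.sum L.scaleR)
      finally show ?thesis .
    qed
    have comp: "?g' (f x) \<circ> ?f' x = (\<lambda>v. \<Sum>b\<in>Basis. (?f' x v \<bullet> b) *\<^sub>R ?g' (f x) b)"
      by (rule ext) (simp only: o_apply, rule rep)
    show "((\<lambda>x. g (f x)) has_derivative (\<lambda>v. \<Sum>b\<in>Basis. (?f' x v \<bullet> b) *\<^sub>R ?g' (f x) b)) (at x)"
      using diff_chain_at[OF f'[OF \<open>x \<in> S\<close>] g'[OF \<open>x \<in> S\<close>]]
      unfolding comp by (simp only: o_def)
  next
    fix v
    show "times_differentiable_on k S (\<lambda>x. \<Sum>b\<in>Basis. (?f' x v \<bullet> b) *\<^sub>R ?g' (f x) b)"
    proof (rule times_differentiable_on_sum[OF assms(1)],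
        rule times_differentiable_on_bilinear[OF assms(1) bounded_bilinear_scaleR])
      fix b :: 'y assume "b \<in> Basis"
      show "times_differentiable_on k S (\<lambda>x. ?f' x v \<bullet> b)"
        by (rule times_differentiable_on_linear_compose[OF assms(1) bounded_linear_inner_left
              times_differentiable_on_frechet_derivative[OF Suc.prems(1)]])
      show "times_differentiable_on k S (\<lambda>x. ?g' (f x) b)"
        by (rule Suc.IH[OF times_differentiable_on_SucD[OF Suc.prems(1)]
              times_differentiable_on_frechet_derivative[OF Suc.prems(2)]])
    qed
  qed
qed

text \<open>The derivative of 1/f contains 1/f again, but only to one order less, so induction on
  \<open>k\<close> with \<open>f\<close> fixed closes.\<close>

lemma times_differentiable_on_inverse:
  fixes f :: "'x::real_normed_vector \<Rightarrow> real"
  assumes "open S" "\<And>x. x \<in> S \<Longrightarrow> f x \<noteq> 0" "times_differentiable_on k S f"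
  shows "times_differentiable_on k S (\<lambda>x. inverse (f x))"
  using assms(3)
proof (induction k)
  case 0
  then show ?case using assms(2) by (simp add: continuous_on_inverse)
next
  case (Suc k)
  show ?case
  proof (rule times_differentiable_on_SucI[OF assms(1)])
    fix x assume "x \<in> S"
    show "((\<lambda>x. inverse (f x)) has_derivative
       (\<lambda>v. - (inverse (f x) * frechet_derivative f (at x) v * inverse (f x)))) (at x)"
      by (rule Deriv.has_derivative_inverse[OF assms(2)[OF \<open>x \<in> S\<close>]
            times_differentiable_on_has_derivative[OF Suc.prems \<open>x \<in> S\<close>]])
  next
    fix v
    have i: "times_differentiable_on k S (\<lambda>x. inverse (f x))"
      by (rule Suc.IH[OF times_differentiable_on_SucD[OF Suc.prems]])
    show "times_differentiable_on k S
        (\<lambda>x. - (inverse (f x) * frechet_derivative f (at x) v * inverse (f x)))"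
      by (rule times_differentiable_on_linear_compose[OF assms(1)
            bounded_linear_minus[OF bounded_linear_ident]])
        (intro i times_differentiable_on_bilinear[OF assms(1) bounded_bilinear_mult]
          times_differentiable_on_frechet_derivative[OF Suc.prems])
  qed
qed

lemma smooth_on_cong:
  assumes "open S" "\<And>y. y \<in> S \<Longrightarrow> f y = g y"
  shows "smooth_on S f \<longleftrightarrow> smooth_on S g"
  unfolding smooth_on_def using times_differentiable_on_cong[OF assms] by auto

lemma smooth_on_subset: "smooth_on T f \<Longrightarrow> S \<subseteq> T \<Longrightarrow> smooth_on S f"
  unfolding smooth_on_def using times_differentiable_on_subset by blast

lemma smooth_on_UN:
  assumes "\<And>i. i \<in> I \<Longrightarrow> open (S i)" "\<And>i. i \<in> I \<Longrightarrow> smooth_on (S i) f"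
  shows "smooth_on (\<Union>i\<in>I. S i) f"
  unfolding smooth_on_def
proof
  show "times_differentiable_on k (\<Union>i\<in>I. S i) f" for k
    by (rule times_differentiable_on_UN) (use assms in \<open>simp_all add: smooth_on_def\<close>)
qed

lemma smooth_on_local:
  assumes "\<And>x. x \<in> S \<Longrightarrow> \<exists>V. open V \<and> x \<in> V \<and> smooth_on V f"
  shows "smooth_on S f"
proof -
  have "smooth_on (\<Union>V\<in>{V. open V \<and> smooth_on V f}. V) f"
    by (rule smooth_on_UN) simp_all
  then show ?thesis by (rule smooth_on_subset) (use assms in blast)
qed

lemma smooth_on_imp_continuous_on: "smooth_on S f \<Longrightarrow> continuous_on S f"
  unfolding smooth_on_def by (drule spec[of _ 0]) simp

lemma smooth_on_has_derivative:
  "smooth_on S f \<Longrightarrow> x \<in> S \<Longrightarrow> (f has_derivative frechet_derivative f (at x)) (at x)"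
  unfolding smooth_on_def
  by (rule times_differentiable_on_has_derivative[where k=0]) (drule spec[of _ "Suc 0"], assumption)

lemma smooth_on_frechet_derivative:
  "smooth_on S f \<Longrightarrow> smooth_on S (\<lambda>x. frechet_derivative f (at x) v)"
  unfolding smooth_on_def
  by (intro allI times_differentiable_on_frechet_derivative) (drule spec, assumption)

lemma smooth_on_const: "smooth_on S (\<lambda>x. c)"
  unfolding smooth_on_def by (simp add: times_differentiable_on_const)

lemma smooth_on_bounded_linear: "bounded_linear L \<Longrightarrow> smooth_on S L"
  unfolding smooth_on_def by (simp add: times_differentiable_on_bounded_linear)

lemma smooth_on_add:
  "open S \<Longrightarrow> smooth_on S f \<Longrightarrow> smooth_on S g \<Longrightarrow> smooth_on S (\<lambda>x. f x + g x)"
  unfolding smooth_on_def by (simp add: times_differentiable_on_add)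

lemma smooth_on_bilinear:
  "open S \<Longrightarrow> bounded_bilinear prd \<Longrightarrow> smooth_on S f \<Longrightarrow> smooth_on S g \<Longrightarrow>
    smooth_on S (\<lambda>x. prd (f x) (g x))"
  unfolding smooth_on_def by (simp add: times_differentiable_on_bilinear)

lemma smooth_on_mult:
  fixes f g :: "'x::real_normed_vector \<Rightarrow> real"
  shows "open S \<Longrightarrow> smooth_on S f \<Longrightarrow> smooth_on S g \<Longrightarrow> smooth_on S (\<lambda>x. f x * g x)"
  by (rule smooth_on_bilinear[OF _ bounded_bilinear_mult])

lemma smooth_on_compose:
  fixes f :: "'x::euclidean_space \<Rightarrow> 'y::euclidean_space"
  shows "open S \<Longrightarrow> open T \<Longrightarrow> f ` S \<subseteq> T \<Longrightarrow> smooth_on S f \<Longrightarrow> smooth_on T g \<Longrightarrow>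
    smooth_on S (\<lambda>x. g (f x))"
  unfolding smooth_on_def by (rule allI, rule times_differentiable_on_compose[of S T f]) (assumption | erule spec)+

lemma smooth_on_inverse:
  fixes f :: "'x::real_normed_vector \<Rightarrow> real"
  shows "open S \<Longrightarrow> (\<And>x. x \<in> S \<Longrightarrow> f x \<noteq> 0) \<Longrightarrow> smooth_on S f \<Longrightarrow> smooth_on S (\<lambda>x. inverse (f x))"
  unfolding smooth_on_def by (simp add: times_differentiable_on_inverse)

subsection \<open>Bump functions\<close>

text \<open>The power of 1/t is there to close the family under differentiation: the derivative of
  member j combines members j+2 and j+1. Only j = 0, the usual flat function exp(-1/t), enters the
  bump.\<close>

definition flat_exp :: "nat \<Rightarrow> real \<Rightarrow> real" where
  "flat_exp j t = (if t > 0 then inverse t ^ j * exp (- inverse t) else 0)"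

text \<open>Substituting u = 1/t turns the claim into u^j / exp u \<rightarrow> 0 at
  infinity.\<close>

lemma flat_exp_tendsto_0: "(flat_exp j \<longlongrightarrow> 0) (at_right 0)"
proof -
  have "((\<lambda>x::real. x ^ j / exp x) \<longlongrightarrow> 0) at_top"
    by (rule tendsto_power_div_exp_0)
  then have "((\<lambda>t::real. inverse t ^ j / exp (inverse t)) \<longlongrightarrow> 0) (at_right 0)"
    by (rule filterlim_compose) (rule filterlim_inverse_at_top_right)
  moreover have "\<forall>\<^sub>F t in at_right 0. inverse t ^ j / exp (inverse t) = flat_exp j t"
    unfolding eventually_at_right_field
    by (intro exI[of _ 1]) (auto simp: flat_exp_def exp_minus field_simps)
  ultimately show ?thesis by (rule Lim_transform_eventually)
qed

lemma DERIV_flat_exp: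
  "(flat_exp j has_real_derivative flat_exp (j + 2) t - real j * flat_exp (j + 1) t) (at t)"
proof -
  consider "t > 0" | "t < 0" | "t = 0" by linarith
  then show ?thesis
  proof cases
    case 1
    have "((\<lambda>t. inverse t ^ j * exp (- inverse t)) has_real_derivative
        (flat_exp (j + 2) t - real j * flat_exp (j + 1) t)) (at t)"
    proof -
      have p: "((\<lambda>u. u ^ j * exp (- u)) has_real_derivative
          real j * u ^ (j - Suc 0) * exp (- u) - u ^ j * exp (- u)) (at u)" for u :: real
        by (rule derivative_eq_intros refl)+ simp
      have i: "(inverse has_real_derivative - (inverse t ^ 2)) (at t)"
        using DERIV_inverse[of t UNIV] 1 by (simp add: numeral_2_eq_2)
      have "(real j * inverse t ^ (j - Suc 0) * exp (- inverse t) - inverse t ^ j * exp (- inverse t))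
            * - (inverse t ^ 2) = flat_exp (j + 2) t - real j * flat_exp (j + 1) t"
      proof (cases j)
        case (Suc i)
        then show ?thesis using 1 by (simp only: flat_exp_def) (simp add: algebra_simps power2_eq_square)
      qed (use 1 in \<open>simp add: flat_exp_def power2_eq_square\<close>)
      with DERIV_chain2[OF p i] show ?thesis by simp
    qed
    then show ?thesis
      by (rule has_field_derivative_transform_within_open[where S="{0<..}"])
        (use 1 in \<open>auto simp: flat_exp_def\<close>)
  next
    case 2
    have "((\<lambda>t. 0) has_real_derivative (flat_exp (j + 2) t - real j * flat_exp (j + 1) t)) (at t)"
      using 2 by (simp add: flat_exp_def)
    then show ?thesis
      by (rule has_field_derivative_transform_within_open[where S="{..<0}"])
        (use 2 in \<open>auto simp: flat_exp_def\<close>)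
  next
    case 3
    \<comment> \<open>For h > 0 the difference quotient at 0 is \<open>flat_exp (j + 1) h\<close>,
      for h < 0 it is 0.\<close>
    have "((\<lambda>h. flat_exp j h / h) \<longlongrightarrow> 0) (at_right 0)"
      by (rule Lim_transform_eventually[OF flat_exp_tendsto_0[of "j + 1"]])
        (auto simp: eventually_at_right_field flat_exp_def field_simps intro!: exI[of _ 1])
    moreover have "((\<lambda>h. flat_exp j h / h) \<longlongrightarrow> 0) (at_left 0)"
      by (rule Lim_transform_eventually[OF tendsto_const])
        (auto simp: eventually_at_left_field flat_exp_def intro!: exI[of _ "-1"])
    ultimately have "((\<lambda>h. flat_exp j h / h) \<longlongrightarrow> 0) (at 0)"
      by (simp add: filterlim_at_split)
    then show ?thesis by (simp add: 3 DERIV_def flat_exp_def)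
  qed
qed

lemma smooth_on_flat_exp: "smooth_on S (flat_exp j)"
proof -
  have all: "times_differentiable_on k UNIV (flat_exp j)" for k
  proof (induction k arbitrary: j)
    case 0
    have "isCont (flat_exp j) x" for x
      by (rule DERIV_isCont[OF DERIV_flat_exp])
    then show ?case by (simp add: continuous_at_imp_continuous_on)
  next
    case (Suc k)
    show ?case
    proof (rule times_differentiable_on_SucI[where
          f'="\<lambda>t v. (flat_exp (j + 2) t + (- real j) * flat_exp (j + 1) t) * v"])
      show "(flat_exp j has_derivative
          times (flat_exp (j + 2) t + - real j * flat_exp (j + 1) t)) (at t)" for t
        using DERIV_flat_exp[of j t] by (simp add: has_field_derivative_def)
      show "times_differentiable_on k UNIV
          (\<lambda>t. (flat_exp (j + 2) t + - real j * flat_exp (j + 1) t) * v)" for v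
        by (intro times_differentiable_on_bilinear[OF _ bounded_bilinear_mult]
            times_differentiable_on_add times_differentiable_on_const Suc open_UNIV)
    qed simp
  qed
  show ?thesis
    unfolding smooth_on_def by (rule allI) (rule times_differentiable_on_subset[OF all subset_UNIV])
qed

text \<open>The quotient e(2-s) / (e(2-s) + e(s-1)) of flat functions with s = 2 |z-a|^2 / r^2 is 1
  for s \<le> 1 and 0 for s \<ge> 2. Its denominator never vanishes because the arguments 2-s and
  s-1 add up to 1.\<close>

lemma smooth_bump:
  fixes a :: "'x::euclidean_space"
  assumes "r > 0"
  obtains \<rho> :: "'x \<Rightarrow> real" where "smooth_on UNIV \<rho>" "\<forall>z. dist z a < r / 2 \<longrightarrow> \<rho> z = 1"
    "\<forall>z. dist z a \<ge> r \<longrightarrow> \<rho> z = 0"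
proof -
  define s where "s z = (2 / r\<^sup>2) * ((z - a) \<bullet> (z - a))" for z
  have id: "smooth_on UNIV (\<lambda>z::'x. z)" by (rule smooth_on_bounded_linear) simp
  have diff: "smooth_on UNIV (\<lambda>z. z - a)"
    using smooth_on_add[OF open_UNIV id smooth_on_const[of _ "- a"]] by simp
  have s: "smooth_on UNIV s"
    unfolding s_def by (intro smooth_on_mult smooth_on_const open_UNIV
        smooth_on_bilinear[OF _ bounded_bilinear_inner] diff)
  define \<rho> where "\<rho> z = flat_exp 0 (2 + (- 1) * s z) *
      inverse (flat_exp 0 (2 + (- 1) * s z) + flat_exp 0 (s z + (- 1)))" for z
  have e: "smooth_on UNIV (\<lambda>z. flat_exp 0 (2 + (- 1) * s z))"
    by (intro smooth_on_compose[OF open_UNIV open_UNIV subset_UNIV _ smooth_on_flat_exp]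
        smooth_on_add smooth_on_mult smooth_on_const s open_UNIV)
  have e': "smooth_on UNIV (\<lambda>z. flat_exp 0 (s z + (- 1)))"
    by (intro smooth_on_compose[OF open_UNIV open_UNIV subset_UNIV _ smooth_on_flat_exp]
        smooth_on_add smooth_on_mult smooth_on_const s open_UNIV)
  have pos: "flat_exp 0 (2 + (- 1) * t) + flat_exp 0 (t + (- 1)) \<noteq> 0" for t
  proof (cases "t < 2")
    case True
    then show ?thesis by (simp add: flat_exp_def add_nonneg_eq_0_iff)
  next
    case False
    then show ?thesis by (simp add: flat_exp_def add_nonneg_eq_0_iff)
  qed
  have "smooth_on UNIV \<rho>"
    unfolding \<rho>_def by (intro smooth_on_mult e smooth_on_inverse smooth_on_add e' open_UNIV pos)
  moreover have "\<rho> z = 1" if "dist z a < r / 2" for z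
  proof -
    have "norm (z - a) < r / 2" using that by (simp add: dist_norm)
    then have "(norm (z - a))\<^sup>2 \<le> (r / 2)\<^sup>2" by (intro power_mono) auto
    then have "(norm (z - a))\<^sup>2 \<le> r\<^sup>2 / 4" by (simp add: power_divide)
    then have "2 * (norm (z - a))\<^sup>2 \<le> r\<^sup>2"
      using zero_le_power2[of "norm (z - a)"] by linarith
    then have "s z \<le> 1"
      using assms by (simp add: s_def power2_norm_eq_inner[symmetric] field_simps)
    then show ?thesis by (simp add: \<rho>_def flat_exp_def)
  qed
  moreover have "\<rho> z = 0" if "dist z a \<ge> r" for z
  proof -
    have "r \<le> norm (z - a)" using that by (simp add: dist_norm)
    then have "r\<^sup>2 \<le> (norm (z - a))\<^sup>2" using assms by (intro power_mono) auto
    then have "s z \<ge> 2"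
      using assms by (simp add: s_def power2_norm_eq_inner[symmetric] field_simps)
    then show ?thesis by (simp add: \<rho>_def flat_exp_def)
  qed
  ultimately show ?thesis by (intro that) auto
qed

subsection \<open>Hadamard's lemma\<close>

text \<open>In finite dimensions continuity of every directional derivative gives continuity in
  operator norm, the form needed for differentiation under the integral and for Lipschitz
  bounds.\<close>

lemma continuous_on_frechet_blinfun:
  fixes f :: "'x::euclidean_space \<Rightarrow> 'c::real_normed_vector"
  assumes "times_differentiable_on (Suc k) S f"
  shows "continuous_on S (\<lambda>z. Blinfun (frechet_derivative f (at z)))"
proof (rule continuous_on_blinfun_componentwise)
  fix i :: 'x
  have "continuous_on S (\<lambda>z. frechet_derivative f (at z) i)"
    using assms
  proof (induction k arbitrary: f)
    case (Suc k)
    show ?case by (rule Suc.IH[OF times_differentiable_on_SucD[OF Suc.prems]])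
  qed auto
  moreover have "blinfun_apply (Blinfun (frechet_derivative f (at z))) i
      = frechet_derivative f (at z) i" if "z \<in> S" for z
    using times_differentiable_on_has_derivative[OF assms that]
    by (simp add: bounded_linear_Blinfun_apply has_derivative_bounded_linear)
  ultimately show "continuous_on S (\<lambda>z. blinfun_apply (Blinfun (frechet_derivative f (at z))) i)"
    by (simp cong: continuous_on_cong)
qed

text \<open>Differentiating under the integral produces a further factor t from the inner map y
  \<mapsto> a + t(y-a). The weight \<open>t ^ j\<close> is carried so that the induction on the
  order absorbs it.\<close>

lemma times_differentiable_on_ray_integral:
  fixes f :: "'x::euclidean_space \<Rightarrow> real"
  assumes "times_differentiable_on k (ball a r) f"
  shows "times_differentiable_on k (ball a r)
    (\<lambda>y. integral {0..1} (\<lambda>t. t ^ j * f (a + t *\<^sub>R (y - a))))"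
proof -
  have inball: "a + t *\<^sub>R (y - a) \<in> ball a r" if "y \<in> ball a r" "t \<in> {0..1}" for y t
  proof -
    have "norm (t *\<^sub>R (y - a)) \<le> 1 * norm (y - a)" using that by (simp add: mult_left_le_one_le)
    then show ?thesis using that by (simp add: dist_norm norm_minus_commute)
  qed
  have cont: "continuous_on (ball a r \<times> cbox 0 1) (\<lambda>(y, t). g (a + t *\<^sub>R (y - a)))"
    if "continuous_on (ball a r) g" for g :: "'x \<Rightarrow> 'w::real_normed_vector"
  proof -
    have "continuous_on (ball a r \<times> cbox 0 1) (\<lambda>p. g (a + snd p *\<^sub>R (fst p - a)))"
      by (rule continuous_on_compose2[OF that]) (use inball in \<open>auto intro!: continuous_intros\<close>)
    then show ?thesis by (simp add: split_beta)
  qed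
  show ?thesis
    using assms
  proof (induction k arbitrary: j f)
    case 0
    have "continuous_on (ball a r \<times> cbox 0 1) (\<lambda>(y, t). t ^ j * f (a + t *\<^sub>R (y - a)))"
      using cont[of f] 0 by (auto simp: split_beta intro!: continuous_intros)
    then show ?case
      using integral_continuous_on_param[of "ball a r" 0 1 "\<lambda>y t. t ^ j * f (a + t *\<^sub>R (y - a))"]
      by simp
  next
    case (Suc k)
    define Df where "Df z = Blinfun (frechet_derivative f (at z))" for z
    have Df: "blinfun_apply (Df z) = frechet_derivative f (at z)"
      "(f has_derivative frechet_derivative f (at z)) (at z)" if "z \<in> ball a r" for z
      using times_differentiable_on_has_derivative[OF Suc.prems that]
      by (simp_all add: Df_def bounded_linear_Blinfun_apply has_derivative_bounded_linear)
    have contDf: "continuous_on (ball a r) Df"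
      unfolding Df_def by (rule continuous_on_frechet_blinfun[OF Suc.prems])
    have contf: "continuous_on (ball a r) f"
      using Df(2) has_derivative_continuous continuous_at_imp_continuous_on by blast
    have contjf: "continuous_on (ball a r \<times> cbox 0 1) (\<lambda>(y, t). t ^ j * f (a + t *\<^sub>R (y - a)))"
      using cont[OF contf] by (auto simp: split_beta intro!: continuous_intros)
    let ?fx = "\<lambda>y t. t ^ Suc j *\<^sub>R Df (a + t *\<^sub>R (y - a))"
    have contfx: "continuous_on (ball a r \<times> cbox 0 1) (\<lambda>(y, t). ?fx y t)"
      using cont[OF contDf] by (auto simp: split_beta intro!: continuous_intros)
    have int: "(\<lambda>t. g t (a + t *\<^sub>R (y - a))) integrable_on cbox 0 1"
      if "y \<in> ball a r" "continuous_on (ball a r \<times> cbox 0 1) (\<lambda>(y, t). g t (a + t *\<^sub>R (y - a)))"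
      for y and g :: "real \<Rightarrow> 'x \<Rightarrow> 'w::banach"
    proof (rule integrable_continuous)
      show "continuous_on (cbox 0 1) (\<lambda>t. g t (a + t *\<^sub>R (y - a)))"
      proof -
        have "continuous_on (cbox 0 (1::real)) (\<lambda>t. (y, t))"
          by (intro continuous_on_Pair continuous_on_const continuous_on_id)
        from continuous_on_compose2[OF that(2) this] that(1) show ?thesis
          by (simp add: image_subset_iff)
      qed
    qed
    have der: "((\<lambda>y. integral (cbox 0 1) (\<lambda>t. t ^ j * f (a + t *\<^sub>R (y - a)))) has_derivative
        blinfun_apply (integral (cbox 0 1) (?fx y))) (at y within ball a r)" if "y \<in> ball a r" for y
    proof (rule leibniz_rule[OF _ _ contfx that convex_ball])
      fix x t assume xt: "x \<in> ball a r" "t \<in> cbox 0 (1::real)"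
      have z: "a + t *\<^sub>R (x - a) \<in> ball a r" using inball xt by simp
      interpret bounded_linear "frechet_derivative f (at (a + t *\<^sub>R (x - a)))"
        using Df(2)[OF z] has_derivative_bounded_linear by blast
      have "((\<lambda>x. f (a + t *\<^sub>R (x - a))) has_derivative
         (\<lambda>v. frechet_derivative f (at (a + t *\<^sub>R (x - a))) (t *\<^sub>R v))) (at x within ball a r)"
        by (rule has_derivative_compose[where f="\<lambda>x. a + t *\<^sub>R (x - a)" and g=f, OF _ Df(2)[OF z]]) (auto intro!: derivative_eq_intros)
      from has_derivative_mult_right[OF this, of "t ^ j"]
      have "((\<lambda>x. t ^ j * f (a + t *\<^sub>R (x - a))) has_derivative
         (\<lambda>v. t ^ j * frechet_derivative f (at (a + t *\<^sub>R (x - a))) (t *\<^sub>R v))) (at x within ball a r)"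
        .
      then show "((\<lambda>x. t ^ j * f (a + t *\<^sub>R (x - a))) has_derivative
         blinfun_apply (?fx x t)) (at x within ball a r)"
        by (rule has_derivative_eq_rhs)
          (rule ext, simp only: blinfun.scaleR_left Df(1)[OF z] scaleR, simp)
    next
      fix x assume "x \<in> ball a r"
      then show "(\<lambda>t. t ^ j * f (a + t *\<^sub>R (x - a))) integrable_on cbox 0 1"
        using int[of x "\<lambda>t z. t ^ j * f z"] contjf by simp
    qed
    show ?case
    proof (rule times_differentiable_on_SucI[OF open_ball])
      fix y assume "y \<in> ball a r"
      then show "((\<lambda>y. integral {0..1} (\<lambda>t. t ^ j * f (a + t *\<^sub>R (y - a)))) has_derivative
        blinfun_apply (integral (cbox 0 1) (?fx y))) (at y)"
        using der[of y] at_within_open[of y "ball a r"] by simp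
    next
      fix v
      have eq: "blinfun_apply (integral (cbox 0 1) (?fx y)) v
        = integral {0..1} (\<lambda>t. t ^ Suc j * frechet_derivative f (at (a + t *\<^sub>R (y - a))) v)"
        if y: "y \<in> ball a r" for y
      proof -
        have "?fx y integrable_on cbox 0 1"
          using int[of y "\<lambda>t z. t ^ Suc j *\<^sub>R Df z"] contfx y by simp
        then have "blinfun_apply (integral (cbox 0 1) (?fx y)) v
            = integral (cbox 0 1) (\<lambda>t. blinfun_apply (?fx y t) v)"
          by (rule blinfun_apply_integral)
        also have "\<dots> = integral (cbox 0 1)
            (\<lambda>t. t ^ Suc j * frechet_derivative f (at (a + t *\<^sub>R (y - a))) v)"
          by (rule integral_cong) (use Df(1) inball y in \<open>simp add: blinfun.scaleR_left\<close>)
        finally show ?thesis by simp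
      qed
      have "times_differentiable_on k (ball a r) (\<lambda>y. integral {0..1}
          (\<lambda>t. t ^ Suc j * frechet_derivative f (at (a + t *\<^sub>R (y - a))) v))"
        by (rule Suc.IH[OF times_differentiable_on_frechet_derivative[OF Suc.prems]])
      then show "times_differentiable_on k (ball a r)
          (\<lambda>y. blinfun_apply (integral (cbox 0 1) (?fx y)) v)"
        using times_differentiable_on_cong[where k=k and S="ball a r"
              and f="\<lambda>y. blinfun_apply (integral (cbox 0 1) (?fx y)) v"
              and g="\<lambda>y. integral {0..1}
                (\<lambda>t. t ^ Suc j * frechet_derivative f (at (a + t *\<^sub>R (y - a))) v)",
              OF open_ball eq] by blast
    qed
  qed
qed

text \<open>The coefficients are the means of the partial derivatives over the segment from a to y;
  the fundamental theorem of calculus along that segment gives the expansion.\<close>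

lemma hadamard:
  fixes h :: "'x::euclidean_space \<Rightarrow> real"
  assumes "r > 0" "smooth_on (ball a r) h"
  obtains g where "\<And>b. smooth_on (ball a r) (g b)" "\<And>b. g b a = frechet_derivative h (at a) b"
    "\<And>y. y \<in> ball a r \<Longrightarrow> h y = h a + (\<Sum>b\<in>Basis. ((y - a) \<bullet> b) * g b y)"
proof
  \<comment> \<open>The factor \<open>t ^ 0\<close> matches the weight in
    \<open>times_differentiable_on_ray_integral\<close>.\<close>
  define g where "g b y = integral {0..1} (\<lambda>t. t ^ 0 * frechet_derivative h (at (a + t *\<^sub>R (y - a))) b)"
    for b y
  show "smooth_on (ball a r) (g b)" for b
    unfolding g_def smooth_on_def
    using times_differentiable_on_ray_integral smooth_on_frechet_derivative[OF assms(2)]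
    unfolding smooth_on_def by blast
  show "g b a = frechet_derivative h (at a) b" for b
    by (simp add: g_def)
  fix y assume y: "y \<in> ball a r"
  have inball: "a + t *\<^sub>R (y - a) \<in> ball a r" if "t \<in> {0..1}" for t
  proof -
    have "norm (t *\<^sub>R (y - a)) \<le> 1 * norm (y - a)" using that by (simp add: mult_left_le_one_le)
    then show ?thesis using y by (simp add: dist_norm norm_minus_commute)
  qed
  let ?D = "\<lambda>t. frechet_derivative h (at (a + t *\<^sub>R (y - a)))"
  have hd: "(h has_derivative ?D t) (at (a + t *\<^sub>R (y - a)))" if "t \<in> {0..1}" for t
    using smooth_on_has_derivative[OF assms(2) inball[OF that]] .
  have "((\<lambda>t. h (a + t *\<^sub>R (y - a))) has_vector_derivative ?D t (y - a)) (at t within {0..1})"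
    if "t \<in> {0..1}" for t
  proof -
    interpret bounded_linear "?D t"
      using hd[OF that] has_derivative_bounded_linear by blast
    have "((\<lambda>t. h (a + t *\<^sub>R (y - a))) has_derivative (\<lambda>s. ?D t (s *\<^sub>R (y - a)))) (at t within {0..1})"
      by (rule has_derivative_compose[where f="\<lambda>t. a + t *\<^sub>R (y - a)" and g=h, OF _ hd[OF that]]) (auto intro!: derivative_eq_intros)
    then show ?thesis by (simp add: has_vector_derivative_def scaleR)
  qed
  then have "((\<lambda>t. ?D t (y - a)) has_integral h (a + 1 *\<^sub>R (y - a)) - h (a + 0 *\<^sub>R (y - a))) {0..1}"
    by (intro fundamental_theorem_of_calculus) auto
  then have "h y - h a = integral {0..1} (\<lambda>t. ?D t (y - a))"
    by (simp add: integral_unique)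
  also have "\<dots> = integral {0..1} (\<lambda>t. \<Sum>b\<in>Basis. ((y - a) \<bullet> b) * ?D t b)"
  proof (rule integral_cong)
    fix t :: real assume "t \<in> {0..1}"
    interpret bounded_linear "?D t"
      using hd[OF \<open>t \<in> {0..1}\<close>] has_derivative_bounded_linear by blast
    have "?D t (y - a) = ?D t (\<Sum>b\<in>Basis. ((y - a) \<bullet> b) *\<^sub>R b)"
      by (simp only: euclidean_representation)
    also have "\<dots> = (\<Sum>b\<in>Basis. ((y - a) \<bullet> b) * ?D t b)" by (simp only: sum scaleR real_scaleR_def)
    finally show "?D t (y - a) = (\<Sum>b\<in>Basis. ((y - a) \<bullet> b) * ?D t b)" .
  qed
  also have "\<dots> = (\<Sum>b\<in>Basis. ((y - a) \<bullet> b) * g b y)"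
  proof -
    have "(\<lambda>t. ?D t b) integrable_on {0..1}" for b
    proof (rule integrable_continuous_interval)
      have "continuous_on (ball a r) (\<lambda>z. frechet_derivative h (at z) b)"
        using smooth_on_frechet_derivative[OF assms(2)] smooth_on_imp_continuous_on by blast
      then show "continuous_on {0..1} (\<lambda>t. ?D t b)"
        by (rule continuous_on_compose2) (use inball in \<open>auto intro!: continuous_intros\<close>)
    qed
    then show ?thesis
      by (subst integral_sum) (auto simp: g_def intro!: integrable_on_mult_right)
  qed
  finally show "h y = h a + (\<Sum>b\<in>Basis. ((y - a) \<bullet> b) * g b y)" by simp
qed

section \<open>Charts, extension of germs, and derivations as tangent vectors\<close>

section \<open>Smooth functions on a manifold\<close>

lemma is_chartD:
  assumes "is_chart (U, \<phi>)"
  shows "open U" "open (\<phi> ` U)" "continuous_on U \<phi>" "continuous_on (\<phi> ` U) (inv_into U \<phi>)"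
    and "\<And>x. x \<in> U \<Longrightarrow> inv_into U \<phi> (\<phi> x) = x" "\<And>z. z \<in> \<phi> ` U \<Longrightarrow> \<phi> (inv_into U \<phi> z) = z"
    and "\<And>z. z \<in> \<phi> ` U \<Longrightarrow> inv_into U \<phi> z \<in> U"
  using assms by (auto simp: is_chart_def homeomorphism_def f_inv_into_f inv_into_into)

lemma chart_open_image:
  assumes "is_chart (U, \<phi>)" "open W"
  shows "open (\<phi> ` (U \<inter> W))"
proof -
  note ch = is_chartD[OF assms(1)]
  have "\<phi> ` (U \<inter> W) = \<phi> ` U \<inter> inv_into U \<phi> -` W"
  proof
    show "\<phi> ` (U \<inter> W) \<subseteq> \<phi> ` U \<inter> inv_into U \<phi> -` W"
      using ch(5) by auto
    show "\<phi> ` U \<inter> inv_into U \<phi> -` W \<subseteq> \<phi> ` (U \<inter> W)"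
    proof
      fix z assume "z \<in> \<phi> ` U \<inter> inv_into U \<phi> -` W"
      then show "z \<in> \<phi> ` (U \<inter> W)"
        using ch(6,7)[of z] by (intro image_eqI[where x="inv_into U \<phi> z"]) auto
    qed
  qed
  then show ?thesis
    using continuous_open_preimage[OF ch(4,2) assms(2)] by simp
qed

lemma chart_inv_image:
  assumes "is_chart (U, \<phi>)" "S \<subseteq> \<phi> ` U"
  shows "inv_into U \<phi> ` S = U \<inter> \<phi> -` S"
proof
  show "inv_into U \<phi> ` S \<subseteq> U \<inter> \<phi> -` S"
    using is_chartD(6,7)[OF assms(1)] assms(2) by auto
  show "U \<inter> \<phi> -` S \<subseteq> inv_into U \<phi> ` S"
    using is_chartD(5)[OF assms(1)] by (force intro: image_eqI[where x="\<phi> _"])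
qed

lemma chart_open_inv_image:
  assumes "is_chart (U, \<phi>)" "open S" "S \<subseteq> \<phi> ` U"
  shows "open (inv_into U \<phi> ` S)"
  using continuous_open_preimage[OF is_chartD(3,1)[OF assms(1)] assms(2)]
  by (simp add: chart_inv_image[OF assms(1,3)])

locale smooth_manifold =
  fixes \<A> :: "('a::t2_space, 'b::euclidean_space) chart set"
  assumes atlas: "smooth_atlas \<A>"
begin

lemma chart: "(U, \<phi>) \<in> \<A> \<Longrightarrow> is_chart (U, \<phi>)"
  using atlas by (auto simp: smooth_atlas_def)

lemma chart_at: obtains U \<phi> where "(U, \<phi>) \<in> \<A>" "x \<in> U"
proof -
  have "x \<in> (\<Union>c\<in>\<A>. fst c)" using atlas by (simp add: smooth_atlas_def)
  then show ?thesis using that by auto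
qed

lemma smooth_on_transition:
  "(U, \<phi>) \<in> \<A> \<Longrightarrow> (V, \<psi>) \<in> \<A> \<Longrightarrow> smooth_on (\<phi> ` (U \<inter> V)) (\<psi> \<circ> inv_into U \<phi>)"
  using atlas unfolding smooth_atlas_def smooth_transition_def by (auto simp: Ball_def)

lemma smooth_fun_onI:
  "(\<And>U \<phi>. (U, \<phi>) \<in> \<A> \<Longrightarrow> smooth_on (\<phi> ` (U \<inter> W)) (\<lambda>z. h (inv_into U \<phi> z))) \<Longrightarrow>
    smooth_fun_on \<A> W h"
  by (auto simp: smooth_fun_on_def o_def)

lemma smooth_fun_onD:
  "smooth_fun_on \<A> W h \<Longrightarrow> (U, \<phi>) \<in> \<A> \<Longrightarrow> smooth_on (\<phi> ` (U \<inter> W)) (\<lambda>z. h (inv_into U \<phi> z))"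
  by (auto simp: smooth_fun_on_def o_def)

lemma smooth_fun_on_subset:
  assumes "smooth_fun_on \<A> W h" "V \<subseteq> W"
  shows "smooth_fun_on \<A> V h"
  by (rule smooth_fun_onI, rule smooth_on_subset[OF smooth_fun_onD[OF assms(1)]]) (use assms(2) in auto)

lemma smooth_functions_iff: "h \<in> smooth_functions \<A> \<longleftrightarrow> smooth_fun_on \<A> UNIV h"
  by (simp add: smooth_functions_def)

lemma smooth_functionsD: "h \<in> smooth_functions \<A> \<Longrightarrow> smooth_fun_on \<A> W h"
  using smooth_fun_on_subset by (auto simp: smooth_functions_def)

lemma smooth_fun_on_local:
  assumes "\<And>x. x \<in> W \<Longrightarrow> \<exists>V. open V \<and> x \<in> V \<and> smooth_fun_on \<A> V h"
  shows "smooth_fun_on \<A> W h"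
proof (rule smooth_fun_onI, rule smooth_on_local)
  fix U \<phi> z assume c: "(U, \<phi>) \<in> \<A>" and "z \<in> \<phi> ` (U \<inter> W)"
  then obtain x where x: "x \<in> U" "x \<in> W" "z = \<phi> x" by auto
  obtain V where V: "open V" "x \<in> V" "smooth_fun_on \<A> V h" using assms x(2) by blast
  have "open (\<phi> ` (U \<inter> V))" "z \<in> \<phi> ` (U \<inter> V)"
    using chart_open_image[OF chart[OF c] V(1)] x V(2) by auto
  with smooth_fun_onD[OF V(3) c]
  show "\<exists>V. open V \<and> z \<in> V \<and> smooth_on V (\<lambda>z. h (inv_into U \<phi> z))" by blast
qed

lemma smooth_fun_on_cong:
  assumes "open W" "smooth_fun_on \<A> W k" "\<And>y. y \<in> W \<Longrightarrow> h y = k y"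
  shows "smooth_fun_on \<A> W h"
proof (rule smooth_fun_onI)
  fix U \<phi> assume c: "(U, \<phi>) \<in> \<A>"
  have "h (inv_into U \<phi> z) = k (inv_into U \<phi> z)" if "z \<in> \<phi> ` (U \<inter> W)" for z
    using that is_chartD(5)[OF chart[OF c]] assms(3) by auto
  from smooth_on_cong[OF chart_open_image[OF chart[OF c] assms(1)] this]
  show "smooth_on (\<phi> ` (U \<inter> W)) (\<lambda>z. h (inv_into U \<phi> z))"
    using smooth_fun_onD[OF assms(2) c] by simp
qed

lemma smooth_fun_on_const: "smooth_fun_on \<A> W (\<lambda>x. c)"
  by (rule smooth_fun_onI, rule smooth_on_const)

lemma smooth_fun_on_add:
  assumes "open W" "smooth_fun_on \<A> W h" "smooth_fun_on \<A> W k"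
  shows "smooth_fun_on \<A> W (\<lambda>x. h x + k x)"
  by (rule smooth_fun_onI, rule smooth_on_add)
    (auto intro!: smooth_fun_onD assms chart_open_image[OF chart])

lemma smooth_fun_on_mult:
  assumes "open W" "smooth_fun_on \<A> W h" "smooth_fun_on \<A> W k"
  shows "smooth_fun_on \<A> W (\<lambda>x. h x * k x)"
  by (rule smooth_fun_onI, rule smooth_on_mult)
    (auto intro!: smooth_fun_onD assms chart_open_image[OF chart])

lemma smooth_fun_on_diff:
  assumes "open W" "smooth_fun_on \<A> W h" "smooth_fun_on \<A> W k"
  shows "smooth_fun_on \<A> W (\<lambda>x. h x - k x)"
  using smooth_fun_on_add[OF assms(1,2)
      smooth_fun_on_mult[OF assms(1) smooth_fun_on_const[where c="-1"] assms(3)]] by simp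

lemma smooth_fun_on_inverse:
  assumes "open W" "smooth_fun_on \<A> W h" "\<And>x. x \<in> W \<Longrightarrow> h x \<noteq> 0"
  shows "smooth_fun_on \<A> W (\<lambda>x. inverse (h x))"
proof (rule smooth_fun_onI, rule smooth_on_inverse)
  fix U \<phi> assume c: "(U, \<phi>) \<in> \<A>"
  show "open (\<phi> ` (U \<inter> W))" using chart_open_image[OF chart[OF c] assms(1)] .
  show "smooth_on (\<phi> ` (U \<inter> W)) (\<lambda>z. h (inv_into U \<phi> z))" using smooth_fun_onD[OF assms(2) c] .
  show "h (inv_into U \<phi> z) \<noteq> 0" if "z \<in> \<phi> ` (U \<inter> W)" for z
    using that is_chartD(5)[OF chart[OF c]] assms(3) by auto
qed

lemma smooth_fun_on_sum:
  assumes "open W" "\<And>i. i \<in> I \<Longrightarrow> smooth_fun_on \<A> W (h i)"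
  shows "smooth_fun_on \<A> W (\<lambda>x. \<Sum>i\<in>I. h i x)"
  using assms(2)
  by (induction I rule: infinite_finite_induct)
    (simp_all add: smooth_fun_on_const smooth_fun_on_add[OF assms(1)])

lemma smooth_fun_on_prod:
  assumes "open W" "\<And>i. i \<in> I \<Longrightarrow> smooth_fun_on \<A> W (h i)"
  shows "smooth_fun_on \<A> W (\<lambda>x. \<Prod>i\<in>I. h i x)"
  using assms(2)
  by (induction I rule: infinite_finite_induct)
    (simp_all add: smooth_fun_on_const smooth_fun_on_mult[OF assms(1)])

text \<open>The permutation formula exhibits the determinant as a polynomial in the entries.\<close>

lemma smooth_fun_on_det:
  assumes "open W" "\<And>i j. i < q \<Longrightarrow> j < q \<Longrightarrow> smooth_fun_on \<A> W (\<lambda>x. F x i j)"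
  shows "smooth_fun_on \<A> W (\<lambda>x. det (Matrix.mat q q (\<lambda>(i, j). F x i j)))"
proof -
  have "smooth_fun_on \<A> W (\<lambda>x. \<Sum>\<pi>\<in>{\<pi>. \<pi> permutes {0..<q}}.
      signof \<pi> * (\<Prod>i = 0..<q. F x i (\<pi> i)))"
    by (intro smooth_fun_on_sum smooth_fun_on_mult smooth_fun_on_prod smooth_fun_on_const assms)
      (auto dest: permutes_in_image)
  moreover have "det (Matrix.mat q q (\<lambda>(i, j). F x i j)) =
      (\<Sum>\<pi>\<in>{\<pi>. \<pi> permutes {0..<q}}. signof \<pi> * (\<Prod>i = 0..<q. F x i (\<pi> i)))" for x
    by (subst det_def'[of _ q]) (auto intro!: sum.cong prod.cong dest: permutes_in_image)
  ultimately show ?thesis by simp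
qed

lemma smooth_fun_on_continuous_on:
  assumes "open W" "smooth_fun_on \<A> W h"
  shows "continuous_on W h"
proof (rule continuous_at_imp_continuous_on, intro ballI)
  fix x assume x: "x \<in> W"
  obtain U \<phi> where c: "(U, \<phi>) \<in> \<A>" "x \<in> U" by (rule chart_at)
  note ch = is_chartD[OF chart[OF c(1)]]
  have "continuous_on (\<phi> ` (U \<inter> W)) (\<lambda>z. h (inv_into U \<phi> z))"
    using smooth_on_imp_continuous_on[OF smooth_fun_onD[OF assms(2) c(1)]] .
  then have "continuous_on (U \<inter> W) (\<lambda>y. h (inv_into U \<phi> (\<phi> y)))"
    by (rule continuous_on_compose2) (auto intro: continuous_on_subset[OF ch(3)])
  then have "continuous_on (U \<inter> W) h"
    by (rule continuous_on_eq) (use ch(5) in auto)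
  then show "isCont h x"
    using continuous_on_eq_continuous_at[of "U \<inter> W" h] ch(1) assms(1) x c(2) by auto
qed

text \<open>Seen in another chart of the atlas, the function is \<open>g\<close> composed with a
  transition map.\<close>

lemma smooth_fun_on_chart_compose:
  assumes c: "(U, \<phi>) \<in> \<A>" and "open S" "S \<subseteq> \<phi> ` U" "smooth_on S g"
  shows "smooth_fun_on \<A> (inv_into U \<phi> ` S) (\<lambda>y. g (\<phi> y))"
proof (rule smooth_fun_onI)
  fix V \<psi> assume d: "(V, \<psi>) \<in> \<A>"
  let ?W = "inv_into U \<phi> ` S"
  have W: "?W = U \<inter> \<phi> -` S" by (rule chart_inv_image[OF chart[OF c] assms(3)])
  have "open ?W" by (rule chart_open_inv_image[OF chart[OF c] assms(2,3)])
  then have o: "open (\<psi> ` (V \<inter> ?W))" by (rule chart_open_image[OF chart[OF d]])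
  have "smooth_on (\<psi> ` (V \<inter> ?W)) (\<phi> \<circ> inv_into V \<psi>)"
    by (rule smooth_on_subset[OF smooth_on_transition[OF d c]]) (auto simp: W)
  moreover have "(\<phi> \<circ> inv_into V \<psi>) ` \<psi> ` (V \<inter> ?W) \<subseteq> S"
    using is_chartD(5)[OF chart[OF d]] by (auto simp: W)
  ultimately show "smooth_on (\<psi> ` (V \<inter> ?W)) (\<lambda>z. g (\<phi> (inv_into V \<psi> z)))"
    using smooth_on_compose[OF o assms(2) _ _ assms(4)] by (simp add: o_def)
qed

text \<open>A bump is pulled back through a chart and extended by zero. It vanishes off the preimage
  K of a closed ball, which is compact and hence closed, the space being Hausdorff; so the chart
  domain and the complement of K are open, cover everything, and the function is smooth on
  each.\<close>

lemma smooth_bump_at: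
  assumes "open W" "x \<in> W"
  obtains \<beta> K where "\<beta> \<in> smooth_functions \<A>" "closed K" "K \<subseteq> W" "\<And>y. y \<notin> K \<Longrightarrow> \<beta> y = 0"
    "\<forall>\<^sub>F y in nhds x. \<beta> y = 1"
proof -
  obtain U \<phi> where c: "(U, \<phi>) \<in> \<A>" "x \<in> U" by (rule chart_at)
  note ch = is_chartD[OF chart[OF c(1)]]
  have "open (\<phi> ` (U \<inter> W))" "\<phi> x \<in> \<phi> ` (U \<inter> W)"
    using chart_open_image[OF chart[OF c(1)] assms(1)] c(2) assms(2) by auto
  then obtain r where r: "r > 0" "cball (\<phi> x) r \<subseteq> \<phi> ` (U \<inter> W)"
    by (meson open_contains_cball)
  obtain \<rho> :: "'b \<Rightarrow> real" where \<rho>: "smooth_on UNIV \<rho>" "\<forall>z. dist z (\<phi> x) < r / 2 \<longrightarrow> \<rho> z = 1"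
    "\<forall>z. dist z (\<phi> x) \<ge> r \<longrightarrow> \<rho> z = 0"
    by (rule smooth_bump[OF r(1), of "\<phi> x"])
  define K where "K = inv_into U \<phi> ` cball (\<phi> x) r"
  have sub: "cball (\<phi> x) r \<subseteq> \<phi> ` U" using r(2) by auto
  have K: "K = U \<inter> \<phi> -` cball (\<phi> x) r"
    unfolding K_def by (rule chart_inv_image[OF chart[OF c(1)] sub])
  have "compact K"
    unfolding K_def by (rule compact_continuous_image[OF continuous_on_subset[OF ch(4) sub]]) simp
  then have "closed K" by (rule compact_imp_closed)
  have "K \<subseteq> W"
  proof
    fix y assume "y \<in> K"
    then have "y \<in> U" "\<phi> y \<in> \<phi> ` (U \<inter> W)" using K r(2) by auto
    then show "y \<in> W" using ch(5) by (metis IntE imageE)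
  qed
  define \<beta> where "\<beta> y = (if y \<in> U then \<rho> (\<phi> y) else 0)" for y
  have b0: "\<beta> y = 0" if "y \<notin> K" for y
    using that \<rho>(3)[rule_format, of "\<phi> y"] by (auto simp: \<beta>_def K dist_commute)
  have "smooth_fun_on \<A> UNIV \<beta>"
  proof (rule smooth_fun_on_local)
    fix y
    show "\<exists>V. open V \<and> y \<in> V \<and> smooth_fun_on \<A> V \<beta>"
    proof (cases "y \<in> U")
      case True
      have "inv_into U \<phi> ` \<phi> ` U = U"
        using chart_inv_image[OF chart[OF c(1)], of "\<phi> ` U"] by auto
      then have "smooth_fun_on \<A> U (\<lambda>y. \<rho> (\<phi> y))"
        using smooth_fun_on_chart_compose[OF c(1) ch(2) order_refl smooth_on_subset[OF \<rho>(1)]] by simp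
      then have "smooth_fun_on \<A> U \<beta>"
        by (rule smooth_fun_on_cong[OF ch(1)]) (simp add: \<beta>_def)
      then show ?thesis using True ch(1) by blast
    next
      case False
      have "smooth_fun_on \<A> (- K) \<beta>"
        by (rule smooth_fun_on_cong[OF _ smooth_fun_on_const[where c=0]])
          (use \<open>closed K\<close> b0 in auto)
      then show ?thesis using False K \<open>closed K\<close> by blast
    qed
  qed
  moreover have "\<forall>\<^sub>F y in nhds x. \<beta> y = 1"
    unfolding eventually_nhds
  proof (intro exI conjI ballI)
    have "ball (\<phi> x) (r / 2) \<subseteq> \<phi> ` U" using sub r(1) by (auto simp: subset_iff)
    then show "open (inv_into U \<phi> ` ball (\<phi> x) (r / 2))"
      by (rule chart_open_inv_image[OF chart[OF c(1)] open_ball])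
    have eq: "inv_into U \<phi> ` ball (\<phi> x) (r / 2) = U \<inter> \<phi> -` ball (\<phi> x) (r / 2)"
      by (rule chart_inv_image[OF chart[OF c(1)]]) fact
    show "x \<in> inv_into U \<phi> ` ball (\<phi> x) (r / 2)" using eq c(2) r(1) by simp
    fix y assume "y \<in> inv_into U \<phi> ` ball (\<phi> x) (r / 2)"
    then show "\<beta> y = 1" using \<rho>(2)[rule_format, of "\<phi> y"] by (auto simp: eq \<beta>_def dist_commute)
  qed
  ultimately show ?thesis
    using that[of \<beta> K] \<open>closed K\<close> \<open>K \<subseteq> W\<close> b0 by (simp add: smooth_functions_iff)
qed

text \<open>Multiplying by a bump that is 1 near x and vanishes off a closed subset of W, then
  extending by zero, keeps the germ at x.\<close>

lemma smooth_germ_extension: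
  assumes "open W" "x \<in> W" "smooth_fun_on \<A> W h"
  obtains k where "k \<in> smooth_functions \<A>" "\<forall>\<^sub>F y in nhds x. k y = h y"
proof -
  obtain \<beta> K where \<beta>: "\<beta> \<in> smooth_functions \<A>" "closed K" "K \<subseteq> W" "\<And>y. y \<notin> K \<Longrightarrow> \<beta> y = 0"
    "\<forall>\<^sub>F y in nhds x. \<beta> y = 1"
    using smooth_bump_at[OF assms(1,2)] by blast
  define k where "k y = \<beta> y * (if y \<in> W then h y else 0)" for y
  have "smooth_fun_on \<A> UNIV k"
  proof (rule smooth_fun_on_local)
    fix y
    show "\<exists>V. open V \<and> y \<in> V \<and> smooth_fun_on \<A> V k"
    proof (cases "y \<in> W")
      case True
      have "smooth_fun_on \<A> W k"
        by (rule smooth_fun_on_cong[OF assms(1)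
              smooth_fun_on_mult[OF assms(1) smooth_functionsD[OF \<beta>(1)] assms(3)]])
          (simp add: k_def)
      then show ?thesis using True assms(1) by blast
    next
      case False
      have "smooth_fun_on \<A> (- K) k"
        by (rule smooth_fun_on_cong[OF _ smooth_fun_on_const[where c=0]])
          (use \<beta>(2,4) in \<open>auto simp: k_def\<close>)
      then show ?thesis using False \<beta>(2,3) by blast
    qed
  qed
  moreover have "\<forall>\<^sub>F y in nhds x. k y = h y"
    using \<beta>(5) eventually_nhds_in_open[OF assms(1,2)]
    by eventually_elim (simp add: k_def)
  ultimately show ?thesis using that by (simp add: smooth_functions_iff)
qed

lemma smooth_functions_const: "(\<lambda>x. c) \<in> smooth_functions \<A>"
  by (simp add: smooth_functions_iff smooth_fun_on_const)

lemma smooth_functions_add: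
  "h \<in> smooth_functions \<A> \<Longrightarrow> k \<in> smooth_functions \<A> \<Longrightarrow> (\<lambda>x. h x + k x) \<in> smooth_functions \<A>"
  by (simp add: smooth_functions_iff smooth_fun_on_add)

lemma smooth_functions_mult:
  "h \<in> smooth_functions \<A> \<Longrightarrow> k \<in> smooth_functions \<A> \<Longrightarrow> (\<lambda>x. h x * k x) \<in> smooth_functions \<A>"
  by (simp add: smooth_functions_iff smooth_fun_on_mult)

lemma smooth_functions_sum:
  "(\<And>i. i \<in> I \<Longrightarrow> h i \<in> smooth_functions \<A>) \<Longrightarrow> (\<lambda>x. \<Sum>i\<in>I. h i x) \<in> smooth_functions \<A>"
  by (simp add: smooth_functions_iff smooth_fun_on_sum)

lemma smooth_functions_has_derivative:
  assumes "h \<in> smooth_functions \<A>" "(U, \<phi>) \<in> \<A>" "z \<in> \<phi> ` U"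
  shows "((\<lambda>z. h (inv_into U \<phi> z)) has_derivative
    frechet_derivative (\<lambda>z. h (inv_into U \<phi> z)) (at z)) (at z)"
  using smooth_on_has_derivative[OF smooth_fun_onD[OF smooth_functionsD[OF assms(1), of UNIV] assms(2)]]
    assms(3) by simp

subsection \<open>Derivations at a point\<close>

text \<open>The arguments are global functions, not germs: that the value depends on the germ at x
  alone is a consequence of the Leibniz rule.\<close>

definition derivation_at :: "'a \<Rightarrow> (('a \<Rightarrow> real) \<Rightarrow> real) \<Rightarrow> bool" where
  "derivation_at x D \<longleftrightarrow>
    (\<forall>f\<in>smooth_functions \<A>. \<forall>g\<in>smooth_functions \<A>. \<forall>a b.
      D (\<lambda>y. a * f y + b * g y) = a * D f + b * D g) \<and>
    (\<forall>f\<in>smooth_functions \<A>. \<forall>g\<in>smooth_functions \<A>. D (\<lambda>y. f y * g y) = D f * g x + f x * D g)"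

context
  fixes x D
  assumes D: "derivation_at x D"
begin

lemma derivation_lincomb:
  "f \<in> smooth_functions \<A> \<Longrightarrow> g \<in> smooth_functions \<A> \<Longrightarrow>
    D (\<lambda>y. a * f y + b * g y) = a * D f + b * D g"
  using D by (simp add: derivation_at_def)

lemma derivation_mult:
  "f \<in> smooth_functions \<A> \<Longrightarrow> g \<in> smooth_functions \<A> \<Longrightarrow>
    D (\<lambda>y. f y * g y) = D f * g x + f x * D g"
  using D by (simp add: derivation_at_def)

lemma derivation_const: "D (\<lambda>y. c) = 0"
proof -
  have "D (\<lambda>y. 1) = 0"
    using derivation_mult[OF smooth_functions_const[of 1] smooth_functions_const[of 1]] by simp
  then show ?thesis
    using derivation_lincomb[OF smooth_functions_const[of 1] smooth_functions_const[of 1], of c 0]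
    by simp
qed

lemma derivation_add:
  "f \<in> smooth_functions \<A> \<Longrightarrow> g \<in> smooth_functions \<A> \<Longrightarrow> D (\<lambda>y. f y + g y) = D f + D g"
  using derivation_lincomb[of f g 1 1] by simp

lemma derivation_diff:
  "f \<in> smooth_functions \<A> \<Longrightarrow> g \<in> smooth_functions \<A> \<Longrightarrow> D (\<lambda>y. f y - g y) = D f - D g"
  using derivation_lincomb[of f g 1 "-1"] by simp

lemma derivation_sum:
  assumes "\<And>i. i \<in> I \<Longrightarrow> f i \<in> smooth_functions \<A>"
  shows "D (\<lambda>y. \<Sum>i\<in>I. f i y) = (\<Sum>i\<in>I. D (f i))"
  using assms
  by (induction I rule: infinite_finite_induct)
    (simp_all add: derivation_const derivation_add smooth_functions_sum)

text \<open>For a bump \<open>\<beta>\<close> vanishing off the set where f = g, the product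
  \<beta>(f-g) is zero everywhere. The Leibniz rule evaluates its derivative at x to D(f-g), since
  \<beta>(x) = 1 and f(x) = g(x).\<close>

lemma derivation_germ:
  assumes "f \<in> smooth_functions \<A>" "g \<in> smooth_functions \<A>" "\<forall>\<^sub>F y in nhds x. f y = g y"
  shows "D f = D g"
proof -
  obtain W where W: "open W" "x \<in> W" "\<And>y. y \<in> W \<Longrightarrow> f y = g y"
    using assms(3) by (auto simp: eventually_nhds)
  obtain \<beta> K where \<beta>: "\<beta> \<in> smooth_functions \<A>" "closed K" "K \<subseteq> W"
    "\<And>y. y \<notin> K \<Longrightarrow> \<beta> y = 0" "\<forall>\<^sub>F y in nhds x. \<beta> y = 1"
    using smooth_bump_at[OF W(1,2)] by blast
  have d: "(\<lambda>y. f y - g y) \<in> smooth_functions \<A>"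
    using assms(1,2) by (simp add: smooth_functions_iff smooth_fun_on_diff)
  have "\<beta> x = 1" using \<beta>(5) by (rule eventually_nhds_x_imp_x)
  have "(\<lambda>y. \<beta> y * (f y - g y)) = (\<lambda>y. 0)" using \<beta>(3,4) W(3) by fastforce
  then have "0 = D \<beta> * (f x - g x) + \<beta> x * D (\<lambda>y. f y - g y)"
    using derivation_mult[OF \<beta>(1) d] derivation_const[of 0] by simp
  then have "D (\<lambda>y. f y - g y) = 0" using W(2,3) \<open>\<beta> x = 1\<close> by simp
  then show ?thesis using derivation_diff[OF assms(1,2)] by simp
qed

text \<open>By Hadamard's lemma a derivation sees only the differential, so it is a tangent vector.\<close>

lemma derivation_eq_differential:
  assumes c: "(U, \<phi>) \<in> \<A>" "x \<in> U" and h: "h \<in> smooth_functions \<A>"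
    and \<xi>: "\<And>b. \<xi> b \<in> smooth_functions \<A>" "\<And>b. b \<in> Basis \<Longrightarrow> \<forall>\<^sub>F y in nhds x. \<xi> b y = \<phi> y \<bullet> b"
  shows "D h = frechet_derivative (\<lambda>z. h (inv_into U \<phi> z)) (at (\<phi> x)) (\<Sum>b\<in>Basis. D (\<xi> b) *\<^sub>R b)"
proof -
  note ch = is_chartD[OF chart[OF c(1)]]
  let ?h = "\<lambda>z. h (inv_into U \<phi> z)"
  obtain r where r: "r > 0" "ball (\<phi> x) r \<subseteq> \<phi> ` U"
    using ch(2) c(2) by (meson imageI open_contains_ball)
  have "smooth_on (ball (\<phi> x) r) ?h"
    by (rule smooth_on_subset[OF smooth_fun_onD[OF smooth_functionsD[OF h, of UNIV] c(1)]])
      (use r(2) in simp)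
  then obtain g where g: "\<And>b. smooth_on (ball (\<phi> x) r) (g b)"
    "\<And>b. g b (\<phi> x) = frechet_derivative ?h (at (\<phi> x)) b"
    "\<And>z. z \<in> ball (\<phi> x) r \<Longrightarrow> ?h z = ?h (\<phi> x) + (\<Sum>b\<in>Basis. ((z - \<phi> x) \<bullet> b) * g b z)"
    using hadamard[OF r(1)] by blast
  define W where "W = inv_into U \<phi> ` ball (\<phi> x) r"
  have W: "W = U \<inter> \<phi> -` ball (\<phi> x) r"
    unfolding W_def by (rule chart_inv_image[OF chart[OF c(1)] r(2)])
  have "open W" unfolding W_def by (rule chart_open_inv_image[OF chart[OF c(1)] open_ball r(2)])
  have "x \<in> W" using W c(2) r(1) by simp
  have "\<exists>k\<in>smooth_functions \<A>. \<forall>\<^sub>F y in nhds x. k y = g b (\<phi> y)" for b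
    using smooth_germ_extension[OF \<open>open W\<close> \<open>x \<in> W\<close>
        smooth_fun_on_chart_compose[OF c(1) open_ball r(2) g(1)[of b], folded W_def]] by metis
  then obtain G where G: "\<And>b. G b \<in> smooth_functions \<A>"
    "\<And>b. \<forall>\<^sub>F y in nhds x. G b y = g b (\<phi> y)" by metis
  have Gx: "G b x = g b (\<phi> x)" for b using eventually_nhds_x_imp_x[OF G(2)] .
  have \<xi>x: "\<xi> b x = \<phi> x \<bullet> b" if "b \<in> Basis" for b using eventually_nhds_x_imp_x[OF \<xi>(2)[OF that]] .
  have \<xi>': "(\<lambda>y. \<xi> b y - \<phi> x \<bullet> b) \<in> smooth_functions \<A>" for b
    using \<xi>(1)[of b] by (simp add: smooth_functions_iff smooth_fun_on_diff smooth_fun_on_const)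
  have prd: "(\<lambda>y. (\<xi> b y - \<phi> x \<bullet> b) * G b y) \<in> smooth_functions \<A>" for b
    by (rule smooth_functions_mult[OF \<xi>' G(1)])
  have "\<forall>\<^sub>F y in nhds x. \<forall>b\<in>Basis. \<xi> b y = \<phi> y \<bullet> b \<and> G b y = g b (\<phi> y)"
    by (intro eventually_ball_finite ballI eventually_conj \<xi>(2) G(2)) auto
  with eventually_nhds_in_open[OF \<open>open W\<close> \<open>x \<in> W\<close>]
  have "\<forall>\<^sub>F y in nhds x. h y = h x + (\<Sum>b\<in>Basis. (\<xi> b y - \<phi> x \<bullet> b) * G b y)"
  proof eventually_elim
    case (elim y)
    then have "h y = h x + (\<Sum>b\<in>Basis. ((\<phi> y - \<phi> x) \<bullet> b) * g b (\<phi> y))"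
      using g(3)[of "\<phi> y"] ch(5) c(2) by (auto simp: W)
    also have "(\<Sum>b\<in>Basis. ((\<phi> y - \<phi> x) \<bullet> b) * g b (\<phi> y)) =
        (\<Sum>b\<in>Basis. (\<xi> b y - \<phi> x \<bullet> b) * G b y)"
      using elim(2) by (intro sum.cong) (auto simp: inner_diff_left)
    finally show ?case .
  qed
  then have "D h = D (\<lambda>y. h x + (\<Sum>b\<in>Basis. (\<xi> b y - \<phi> x \<bullet> b) * G b y))"
    by (intro derivation_germ h smooth_functions_add smooth_functions_const smooth_functions_sum prd)
  also have "\<dots> = (\<Sum>b\<in>Basis. D (\<lambda>y. (\<xi> b y - \<phi> x \<bullet> b) * G b y))"
    by (subst derivation_add[OF smooth_functions_const smooth_functions_sum[OF prd]])
      (simp add: derivation_sum[OF prd] derivation_const)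
  \<comment> \<open>The Leibniz term containing D of \<open>G b\<close> has a factor that vanishes
    at x; what survives is the value of \<open>G b\<close> at x, a partial derivative of h.\<close>
  also have "\<dots> = (\<Sum>b\<in>Basis. D (\<xi> b) * frechet_derivative ?h (at (\<phi> x)) b)"
  proof (rule sum.cong[OF refl])
    fix b :: 'b assume b: "b \<in> Basis"
    have "D (\<lambda>y. (\<xi> b y - \<phi> x \<bullet> b) * G b y) = D (\<lambda>y. \<xi> b y - \<phi> x \<bullet> b) * G b x"
      using derivation_mult[OF \<xi>' G(1)] \<xi>x[OF b] by simp
    also have "D (\<lambda>y. \<xi> b y - \<phi> x \<bullet> b) = D (\<xi> b)"
      using derivation_diff[OF \<xi>(1) smooth_functions_const] derivation_const by simp
    finally show "D (\<lambda>y. (\<xi> b y - \<phi> x \<bullet> b) * G b y) = D (\<xi> b) * frechet_derivative ?h (at (\<phi> x)) b"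
      using Gx g(2) by simp
  qed
  also have "\<dots> = frechet_derivative ?h (at (\<phi> x)) (\<Sum>b\<in>Basis. D (\<xi> b) *\<^sub>R b)"
  proof -
    interpret bounded_linear "frechet_derivative ?h (at (\<phi> x))"
      using smooth_functions_has_derivative[OF h c(1) imageI[OF c(2)]]
      by (rule has_derivative_bounded_linear)
    show ?thesis by (simp only: sum scaleR real_scaleR_def)
  qed
  finally show ?thesis .
qed

end

lemma coordinate_functions:
  assumes "(U, \<phi>) \<in> \<A>" "x \<in> U"
  obtains \<xi> where "\<And>b. \<xi> b \<in> smooth_functions \<A>" "\<And>b. \<forall>\<^sub>F y in nhds x. \<xi> b y = \<phi> y \<bullet> b"
proof -
  note ch = is_chartD[OF chart[OF assms(1)]]
  have "inv_into U \<phi> ` \<phi> ` U = U"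
    using chart_inv_image[OF chart[OF assms(1)], of "\<phi> ` U"] by auto
  then have s: "smooth_fun_on \<A> U (\<lambda>y. \<phi> y \<bullet> b)" for b
    using smooth_fun_on_chart_compose[OF assms(1) ch(2) order_refl
        smooth_on_bounded_linear[OF bounded_linear_inner_left[of b]]] by simp
  have "\<exists>k\<in>smooth_functions \<A>. \<forall>\<^sub>F y in nhds x. k y = \<phi> y \<bullet> b" for b
    using smooth_germ_extension[OF ch(1) assms(2) s[of b]] by metis
  then show ?thesis using that by metis
qed

lemma derivation_tangent_vector:
  assumes "derivation_at x D" "(U, \<phi>) \<in> \<A>" "x \<in> U"
  obtains X where "\<And>h. h \<in> smooth_functions \<A> \<Longrightarrow>
    D h = frechet_derivative (\<lambda>z. h (inv_into U \<phi> z)) (at (\<phi> x)) X"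
proof -
  obtain \<xi> where \<xi>: "\<And>b. \<xi> b \<in> smooth_functions \<A>" "\<And>b. \<forall>\<^sub>F y in nhds x. \<xi> b y = \<phi> y \<bullet> b"
    using coordinate_functions[OF assms(2,3)] by blast
  show ?thesis
    by (rule that, rule derivation_eq_differential[OF assms _ \<xi>(1)]) (auto intro: \<xi>(2))
qed

end

section \<open>Locality of the bracket and its action on locally defined functions\<close>

section \<open>Poisson brackets\<close>

locale poisson_manifold = smooth_manifold \<A>
  for \<A> :: "('a::t2_space, 'b::euclidean_space) chart set" +
  fixes pb :: "('a \<Rightarrow> real) \<Rightarrow> ('a \<Rightarrow> real) \<Rightarrow> 'a \<Rightarrow> real"
  assumes poisson: "poisson_bracket \<A> pb"
begin

lemma pb_smooth:
  "f \<in> smooth_functions \<A> \<Longrightarrow> g \<in> smooth_functions \<A> \<Longrightarrow> pb f g \<in> smooth_functions \<A>"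
  using poisson by (auto simp: poisson_bracket_def)

lemma pb_antisym:
  "f \<in> smooth_functions \<A> \<Longrightarrow> g \<in> smooth_functions \<A> \<Longrightarrow> pb f g x = - pb g f x"
  using poisson unfolding poisson_bracket_def by blast

lemma pb_jacobi:
  "f \<in> smooth_functions \<A> \<Longrightarrow> g \<in> smooth_functions \<A> \<Longrightarrow> h \<in> smooth_functions \<A> \<Longrightarrow>
    pb f (pb g h) x + pb g (pb h f) x + pb h (pb f g) x = 0"
  using poisson unfolding poisson_bracket_def by blast

lemma derivation_pb:
  assumes "f \<in> smooth_functions \<A>"
  shows "derivation_at x (\<lambda>h. pb f h x)"
  unfolding derivation_at_def
proof (intro conjI ballI allI)
  fix g h a b assume "g \<in> smooth_functions \<A>" "h \<in> smooth_functions \<A>"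
  with poisson assms
  show "pb f (\<lambda>y. a * g y + b * h y) x = a * pb f g x + b * pb f h x"
    and "pb f (\<lambda>y. g y * h y) x = pb f g x * h x + g x * pb f h x"
    unfolding poisson_bracket_def by blast+
qed

lemma ham_vf_germ:
  assumes "c \<in> smooth_functions \<A>" "k \<in> smooth_functions \<A>" "\<forall>\<^sub>F y in nhds x. k y = h y"
  shows "ham_vf \<A> pb c h x = pb c k x"
proof -
  let ?P = "\<lambda>k. k \<in> smooth_functions \<A> \<and> (\<forall>\<^sub>F y in nhds x. k y = h y)"
  have P: "?P (SOME k. ?P k)" using assms(2,3) by (intro someI[of ?P k]) simp
  have "\<forall>\<^sub>F y in nhds x. (SOME k. ?P k) y = k y"
    using P[THEN conjunct2] assms(3) by eventually_elim simp
  with derivation_germ[OF derivation_pb[OF assms(1)] _ assms(2)] P show ?thesis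
    by (simp add: ham_vf_def)
qed

lemma ham_vf_smooth_function:
  "c \<in> smooth_functions \<A> \<Longrightarrow> h \<in> smooth_functions \<A> \<Longrightarrow> ham_vf \<A> pb c h x = pb c h x"
  by (rule ham_vf_germ) auto

text \<open>The representative chosen in \<open>ham_vf\<close> changes from point to point, but one
  extension k represents h at all points near x, so the field applied to h coincides there with
  \<open>pb c k\<close>.\<close>

lemma smooth_fun_on_ham_vf:
  assumes "c \<in> smooth_functions \<A>" "open W" "smooth_fun_on \<A> W h"
  shows "smooth_fun_on \<A> W (ham_vf \<A> pb c h)"
proof (rule smooth_fun_on_local)
  fix x assume "x \<in> W"
  then obtain k where k: "k \<in> smooth_functions \<A>" "\<forall>\<^sub>F y in nhds x. k y = h y"
    using smooth_germ_extension[OF assms(2) _ assms(3)] by metis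
  then obtain V where V: "open V" "x \<in> V" "\<And>y. y \<in> V \<Longrightarrow> k y = h y"
    by (auto simp: eventually_nhds)
  have "ham_vf \<A> pb c h y = pb c k y" if "y \<in> V" for y
    by (rule ham_vf_germ[OF assms(1) k(1)])
      (use eventually_nhds_in_open[OF V(1) that] V(3) in \<open>auto elim: eventually_mono\<close>)
  then have "smooth_fun_on \<A> V (ham_vf \<A> pb c h)"
    by (rule smooth_fun_on_cong[OF V(1) smooth_functionsD[OF pb_smooth[OF assms(1) k(1)]]])
  then show "\<exists>V. open V \<and> x \<in> V \<and> smooth_fun_on \<A> V (ham_vf \<A> pb c h)" using V by blast
qed

end

section \<open>Existence of continuous local flows, and uniqueness for linear systems\<close>

section \<open>Local flows\<close>

text \<open>This is the integral of g from 0 to t, rescaled to the fixed interval [0,1]: both signs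
  of t are covered at once, and continuity in parameters is that of an integral over a fixed
  interval.\<close>

lemma has_vector_derivative_scaled_integral:
  fixes g :: "real \<Rightarrow> 'x::euclidean_space"
  assumes "continuous_on UNIV g"
  shows "((\<lambda>t. t *\<^sub>R integral {0..1} (\<lambda>s. g (t * s))) has_vector_derivative g t) (at t)"
proof -
  \<comment> \<open>The antiderivative is taken on a compact interval having both 0 and t in its
    interior.\<close>
  define K where "K = \<bar>t\<bar> + 1"
  obtain G where G: "\<And>u. u \<in> {-K..K} \<Longrightarrow> (G has_vector_derivative g u) (at u within {-K..K})"
    using antiderivative_continuous[OF continuous_on_subset[OF assms subset_UNIV]] by metis
  have eq: "u *\<^sub>R integral {0..1} (\<lambda>s. g (u * s)) = G u - G 0" if u: "u \<in> {-K<..<K}" for u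
  proof -
    have us: "u * s \<in> {-K..K}" if "s \<in> {0..1}" for s
    proof -
      have "\<bar>u * s\<bar> \<le> \<bar>u\<bar> * 1" using that by (simp add: abs_mult mult_left_le)
      then show ?thesis using u by auto
    qed
    have "((\<lambda>s. u *\<^sub>R g (u * s)) has_integral G (u * 1) - G (u * 0)) {0..1}"
    proof (rule fundamental_theorem_of_calculus)
      fix s :: real assume s: "s \<in> {0..1}"
      have 1: "((\<lambda>s. u * s) has_vector_derivative u) (at s within {0..1})"
        by (auto intro!: derivative_eq_intros)
      have 2: "(G has_vector_derivative g (u * s)) (at (u * s) within (\<lambda>s. u * s) ` {0..1})"
        by (rule has_vector_derivative_within_subset[OF G[OF us[OF s]]]) (use us in auto)
      show "((\<lambda>s. G (u * s)) has_vector_derivative u *\<^sub>R g (u * s)) (at s within {0..1})"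
        using vector_diff_chain_within[OF 1 2] by (simp add: o_def)
    qed simp
    then show ?thesis by (simp add: integral_unique flip: integral_cmul)
  qed
  have t: "t \<in> {-K<..<K}" by (auto simp: K_def)
  have "(G has_vector_derivative g t) (at t)"
    using G[of t] t at_within_interior[of t "{-K..K}"] by simp
  then have "((\<lambda>u. G u - G 0) has_vector_derivative g t) (at t)"
    by (auto intro!: derivative_eq_intros)
  then show ?thesis
    by (rule has_vector_derivative_transform_within_open[of _ _ _ "{-K<..<K}"]) (use t eq in auto)
qed

text \<open>The fixed point argument runs in the space of bounded continuous functions of time and
  initial value together, so joint continuity of the flow comes for free.\<close>

lemma global_flow_of_bounded_lipschitz:
  fixes Y :: "'x::euclidean_space \<Rightarrow> 'x"
  assumes "B \<ge> 0" "\<And>z. norm (Y z) \<le> B" "M \<ge> 0" "\<And>z w. norm (Y z - Y w) \<le> M * norm (z - w)"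
    and "\<delta> > 0" "\<delta> * M \<le> 1 / 2"
  obtains fl :: "real \<Rightarrow> 'x \<Rightarrow> 'x" where "continuous_on UNIV (\<lambda>(t, z). fl t z)" "\<And>z. fl 0 z = z"
    "\<And>t z. \<bar>t\<bar> \<le> \<delta> \<Longrightarrow> norm (fl t z - z) \<le> B * \<bar>t\<bar>"
    "\<And>t z. \<bar>t\<bar> < \<delta> \<Longrightarrow> ((\<lambda>s. fl s z) has_vector_derivative Y (fl t z)) (at t)"
proof -
  \<comment> \<open>Clamping the time to [-\<delta>, \<delta>] lets the integral operator act on
    functions of all (t, z) and still have bounded values.\<close>
  define c where "c t = max (- \<delta>) (min \<delta> t)" for t
  have c: "\<bar>c t\<bar> \<le> \<delta>" for t using assms(5) by (auto simp: c_def)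
  have c_id: "c t = t" if "\<bar>t\<bar> \<le> \<delta>" for t using that by (auto simp: c_def)
  have cont_c: "continuous_on S (\<lambda>x. c (f x))" if "continuous_on S f" for S :: "'w::topological_space set" and f
    unfolding c_def by (intro continuous_intros that)
  have contY: "continuous_on UNIV Y"
  proof (rule lipschitz_on_continuous_on)
    show "M-lipschitz_on UNIV Y"
      using assms(3,4) by (auto simp: lipschitz_on_def dist_norm)
  qed
  \<comment> \<open>The unknown \<open>\<psi>\<close> is the displacement of the flow from its
    initial value, which is bounded although the flow itself is not.\<close>
  define J where "J \<psi> p = integral {0..1} (\<lambda>s. Y (snd p + apply_bcontfun \<psi> (c (fst p) * s, snd p)))"
    for \<psi> :: "(real \<times> 'x) \<Rightarrow>\<^sub>C 'x" and p
  have contI: "continuous_on UNIV (\<lambda>(p, s). Y (snd p + apply_bcontfun \<psi> (c (fst p) * s, snd p)))"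
    for \<psi> :: "(real \<times> 'x) \<Rightarrow>\<^sub>C 'x"
  proof -
    have "continuous_on UNIV (\<lambda>q. Y (snd (fst q) + apply_bcontfun \<psi> (c (fst (fst q)) * snd q, snd (fst q))))"
      by (intro continuous_on_compose2[OF contY] continuous_intros cont_c
          continuous_on_compose2[OF continuous_on_apply_bcontfun[of UNIV \<psi>]]) auto
    then show ?thesis by (simp add: split_beta)
  qed
  have contJ: "continuous_on UNIV (J \<psi>)" for \<psi>
    using integral_continuous_on_param[of UNIV 0 1
        "\<lambda>p s. Y (snd p + apply_bcontfun \<psi> (c (fst p) * s, snd p))"]
      continuous_on_subset[OF contI[of \<psi>]] by (simp add: J_def[abs_def])
  have int: "(\<lambda>s. Y (z + apply_bcontfun \<psi> (u * s, z))) integrable_on {0..1}"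
    for \<psi> :: "(real \<times> 'x) \<Rightarrow>\<^sub>C 'x" and u :: real and z
    by (intro integrable_continuous_interval continuous_on_compose2[OF contY] continuous_intros
        continuous_on_compose2[OF continuous_on_apply_bcontfun[of UNIV \<psi>]]) auto
  have normJ: "norm (J \<psi> p) \<le> B" for \<psi> p
  proof -
    have "norm (J \<psi> p) \<le> integral {0..1} (\<lambda>s::real. B)"
      unfolding J_def by (rule integral_norm_bound_integral) (use int assms(2) in auto)
    then show ?thesis by simp
  qed
  define P where "P \<psi> = Bcontfun (\<lambda>p. c (fst p) *\<^sub>R J \<psi> p)" for \<psi>
  have P: "apply_bcontfun (P \<psi>) p = c (fst p) *\<^sub>R J \<psi> p" for \<psi> p
  proof -
    have "(\<lambda>p. c (fst p) *\<^sub>R J \<psi> p) \<in> bcontfun"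
    proof (rule bcontfun_normI)
      show "continuous_on UNIV (\<lambda>p. c (fst p) *\<^sub>R J \<psi> p)"
        by (intro continuous_intros cont_c contJ)
      show "norm (c (fst p) *\<^sub>R J \<psi> p) \<le> \<delta> * B" for p
        using c normJ[of \<psi> p] assms(5) by (auto intro!: mult_mono)
    qed
    then show ?thesis by (simp add: P_def Bcontfun_inverse)
  qed
  let ?K = "\<lambda>(\<psi> :: (real \<times> 'x) \<Rightarrow>\<^sub>C 'x) p s. Y (snd p + apply_bcontfun \<psi> (c (fst p) * s, snd p))"
  have "dist (P \<psi>) (P \<chi>) \<le> 1 / 2 * dist \<psi> \<chi>" for \<psi> \<chi>
  proof (rule dist_bound)
    fix p
    have "norm (J \<psi> p - J \<chi> p) = norm (integral {0..1} (\<lambda>s. ?K \<psi> p s - ?K \<chi> p s))"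
      unfolding J_def by (subst integral_diff) (auto intro: int)
    also have "\<dots> \<le> integral {0..1} (\<lambda>s::real. M * dist \<psi> \<chi>)"
    proof (rule integral_norm_bound_integral)
      fix s :: real
      have "norm (?K \<psi> p s - ?K \<chi> p s) \<le>
        M * norm (apply_bcontfun \<psi> (c (fst p) * s, snd p) - apply_bcontfun \<chi> (c (fst p) * s, snd p))"
        using assms(4)[of "snd p + apply_bcontfun \<psi> (c (fst p) * s, snd p)"
            "snd p + apply_bcontfun \<chi> (c (fst p) * s, snd p)"] by simp
      also have "\<dots> \<le> M * dist \<psi> \<chi>"
        using dist_bounded[of \<psi> "(c (fst p) * s, snd p)" \<chi>] assms(3)
        by (intro mult_left_mono) (auto simp: dist_norm)
      finally show "norm (?K \<psi> p s - ?K \<chi> p s) \<le> M * dist \<psi> \<chi>" .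
    qed (auto intro!: integrable_diff int)
    finally have "norm (J \<psi> p - J \<chi> p) \<le> M * dist \<psi> \<chi>" by simp
    then have "\<bar>c (fst p)\<bar> * norm (J \<psi> p - J \<chi> p) \<le> \<delta> * (M * dist \<psi> \<chi>)"
      using c assms(5) by (intro mult_mono) auto
    also have "\<dots> \<le> 1 / 2 * dist \<psi> \<chi>"
      using mult_right_mono[OF assms(6), of "dist \<psi> \<chi>"] by simp
    finally show "dist (apply_bcontfun (P \<psi>) p) (apply_bcontfun (P \<chi>) p) \<le> 1 / 2 * dist \<psi> \<chi>"
      by (simp add: P dist_norm flip: scaleR_diff_right)
  qed
  then have "\<exists>!\<psi>. P \<psi> = \<psi>" by (intro banach_fix_type[of "1 / 2"]) auto
  then obtain \<psi> where \<psi>: "P \<psi> = \<psi>" by blast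
  have ev: "apply_bcontfun \<psi> (t, z) = c t *\<^sub>R J \<psi> (t, z)" for t z using P[of \<psi> "(t, z)"] \<psi> by simp
  show ?thesis
  proof (rule that[of "\<lambda>t z. z + apply_bcontfun \<psi> (t, z)"])
    show "continuous_on UNIV (\<lambda>(t, z). z + apply_bcontfun \<psi> (t, z))"
      using continuous_on_apply_bcontfun[of UNIV \<psi>]
      by (auto simp: split_beta intro!: continuous_intros)
    show "z + apply_bcontfun \<psi> (0, z) = z" for z using assms(5) by (simp add: ev c_id)
    show "norm (z + apply_bcontfun \<psi> (t, z) - z) \<le> B * \<bar>t\<bar>" if "\<bar>t\<bar> \<le> \<delta>" for t z
      using mult_left_mono[OF normJ[of \<psi> "(t, z)"], of "\<bar>t\<bar>"] by (simp add: ev c_id[OF that] mult.commute)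
    fix t z assume t: "\<bar>t\<bar> < \<delta>"
    have cont: "continuous_on UNIV (\<lambda>u. Y (z + apply_bcontfun \<psi> (u, z)))"
      by (intro continuous_on_compose2[OF contY] continuous_intros
          continuous_on_compose2[OF continuous_on_apply_bcontfun[of UNIV \<psi>]]) auto
    have "((\<lambda>t. t *\<^sub>R J \<psi> (t, z)) has_vector_derivative Y (z + apply_bcontfun \<psi> (t, z))) (at t)"
    proof (rule has_vector_derivative_transform_within_open[OF has_vector_derivative_scaled_integral[OF cont],
          of "{-\<delta><..<\<delta>}"])
      fix u assume "u \<in> {-\<delta><..<\<delta>}"
      then have "c u = u" by (intro c_id) auto
      then show "u *\<^sub>R integral {0..1} (\<lambda>s. Y (z + apply_bcontfun \<psi> (u * s, z))) = u *\<^sub>R J \<psi> (u, z)"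
        by (simp add: J_def)
    qed (use t in auto)
    then have "((\<lambda>t. z + t *\<^sub>R J \<psi> (t, z)) has_vector_derivative Y (z + apply_bcontfun \<psi> (t, z))) (at t)"
      using has_vector_derivative_add[OF has_vector_derivative_const] by fastforce
    then show "((\<lambda>t. z + apply_bcontfun \<psi> (t, z)) has_vector_derivative Y (z + apply_bcontfun \<psi> (t, z))) (at t)"
      by (rule has_vector_derivative_transform_within_open[of _ _ _ "{-\<delta><..<\<delta>}"])
        (use t in \<open>auto simp: ev c_id\<close>)
  qed
qed

text \<open>Compactness bounds the operator norm of the derivative on the ball, and convexity turns
  that bound into a Lipschitz constant.\<close>

lemma smooth_on_lipschitz_cball:
  fixes X :: "'x::euclidean_space \<Rightarrow> 'y::real_normed_vector"
  assumes "cball a r \<subseteq> S" "smooth_on S X"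
  obtains M where "M \<ge> 0" "\<And>z w. z \<in> cball a r \<Longrightarrow> w \<in> cball a r \<Longrightarrow> norm (X z - X w) \<le> M * norm (z - w)"
proof -
  have td: "times_differentiable_on (Suc 0) S X"
    using assms(2) unfolding smooth_on_def by (rule spec)
  let ?D = "\<lambda>z. frechet_derivative X (at z)"
  have "compact ((\<lambda>z. Blinfun (?D z)) ` cball a r)"
    by (intro compact_continuous_image compact_cball
        continuous_on_subset[OF continuous_on_frechet_blinfun[OF td] assms(1)])
  then obtain M where M: "\<And>z. z \<in> cball a r \<Longrightarrow> norm (Blinfun (?D z)) \<le> M" "M > 0"
    using compact_imp_bounded bounded_pos by (metis (no_types, lifting) imageI)
  have "norm (X z - X w) \<le> M * norm (z - w)" if "z \<in> cball a r" "w \<in> cball a r" for z w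
  proof (rule differentiable_bound[OF convex_cball[of a r], where f'="?D"])
    fix x assume x: "x \<in> cball a r"
    have d: "(X has_derivative ?D x) (at x)"
      using smooth_on_has_derivative[OF assms(2)] x assms(1) by auto
    show "(X has_derivative ?D x) (at x within cball a r)" by (rule has_derivative_at_withinI[OF d])
    show "onorm (?D x) \<le> M"
      using M(1)[OF x] bounded_linear_Blinfun_apply[OF has_derivative_bounded_linear[OF d]]
      by (simp add: norm_blinfun.rep_eq)
  qed (use that in auto)
  with M(2) show ?thesis by (intro that[of M]) auto
qed

text \<open>Composing X with the nearest-point projection onto the ball, which does not increase
  distances, gives a bounded and globally Lipschitz field equal to X on the ball. Its flow solves
  the original equation wherever it is in the ball.\<close>

lemma local_flow:
  fixes X :: "'x::euclidean_space \<Rightarrow> 'x"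
  assumes "r > 0" "cball a r \<subseteq> S" "smooth_on S X"
  obtains \<delta> B :: real and fl :: "real \<Rightarrow> 'x \<Rightarrow> 'x"
  where "\<delta> > 0" "B > 0" "continuous_on UNIV (\<lambda>(t, z). fl t z)" "\<And>z. fl 0 z = z"
    "\<And>t z. \<bar>t\<bar> < \<delta> \<Longrightarrow> norm (fl t z - z) \<le> B * \<bar>t\<bar>"
    "\<And>t z. \<bar>t\<bar> < \<delta> \<Longrightarrow> fl t z \<in> cball a r \<Longrightarrow> ((\<lambda>s. fl s z) has_vector_derivative X (fl t z)) (at t)"
proof -
  obtain M where M: "M \<ge> 0" "\<And>z w. z \<in> cball a r \<Longrightarrow> w \<in> cball a r \<Longrightarrow> norm (X z - X w) \<le> M * norm (z - w)"
    using smooth_on_lipschitz_cball[OF assms(2,3)] by metis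
  have ne: "cball a r \<noteq> {}" using assms(1) by simp
  define Y where "Y z = X (closest_point (cball a r) z)" for z
  have cp: "closest_point (cball a r) z \<in> cball a r" for z
    by (rule closest_point_in_set[OF closed_cball ne])
  have lip: "norm (Y z - Y w) \<le> M * norm (z - w)" for z w
  proof -
    have "norm (Y z - Y w) \<le> M * norm (closest_point (cball a r) z - closest_point (cball a r) w)"
      unfolding Y_def by (rule M(2)[OF cp cp])
    also have "\<dots> \<le> M * norm (z - w)"
      using closest_point_lipschitz[OF convex_cball closed_cball ne, of z w] M(1)
      by (intro mult_left_mono) (auto simp: dist_norm)
    finally show ?thesis .
  qed
  \<comment> \<open>The value at the centre plus M r bounds X on the ball; the summand 1 makes B
    positive.\<close>
  define B where "B = norm (X a) + M * r + 1"
  have B: "B > 0" using M(1) assms(1) by (simp add: B_def add_nonneg_pos)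
  have bound: "norm (Y z) \<le> B" for z
  proof -
    let ?c = "closest_point (cball a r) z"
    have "norm (X ?c - X a) \<le> M * norm (?c - a)" by (rule M(2)) (use cp assms(1) in auto)
    also have "\<dots> \<le> M * r"
      using cp[of z] M(1) by (intro mult_left_mono) (auto simp: dist_norm norm_minus_commute)
    finally show ?thesis
      using norm_triangle_ineq2[of "X ?c" "X a"] by (simp add: Y_def B_def)
  qed
  \<comment> \<open>M + 1 in place of M covers the case M = 0.\<close>
  define \<delta> where "\<delta> = 1 / (2 * (M + 1))"
  have \<delta>: "\<delta> > 0" "\<delta> * M \<le> 1 / 2" using M(1) by (auto simp: \<delta>_def field_simps)
  obtain fl :: "real \<Rightarrow> 'x \<Rightarrow> 'x" where fl: "continuous_on UNIV (\<lambda>(t, z). fl t z)" "\<And>z. fl 0 z = z"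
    "\<And>t z. \<bar>t\<bar> \<le> \<delta> \<Longrightarrow> norm (fl t z - z) \<le> B * \<bar>t\<bar>"
    "\<And>t z. \<bar>t\<bar> < \<delta> \<Longrightarrow> ((\<lambda>s. fl s z) has_vector_derivative Y (fl t z)) (at t)"
    using global_flow_of_bounded_lipschitz[OF less_imp_le[OF B] bound M(1) lip \<delta>] by blast
  show ?thesis
  proof (rule that[OF \<delta>(1) B fl(1,2)])
    show "norm (fl t z - z) \<le> B * \<bar>t\<bar>" if "\<bar>t\<bar> < \<delta>" for t z using fl(3) that by simp
    show "((\<lambda>s. fl s z) has_vector_derivative X (fl t z)) (at t)"
      if "\<bar>t\<bar> < \<delta>" "fl t z \<in> cball a r" for t z
      using fl(4)[OF that(1), of z] closest_point_self[OF that(2)] by (simp add: Y_def)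
  qed
qed

text \<open>Gronwall's argument for the energy E, the sum of the squares of the u_k: coefficients
  bounded on a compact interval give E' \<le> c E, so E(s) exp(-c s) is nonincreasing and starts at
  0.\<close>

lemma linear_ode_zero_forward:
  fixes u :: "nat \<Rightarrow> real \<Rightarrow> real" and a :: "nat \<Rightarrow> nat \<Rightarrow> real \<Rightarrow> real"
  assumes "t \<ge> 0"
    and der: "\<And>k s. k < n \<Longrightarrow> s \<in> {0..t} \<Longrightarrow> (u k has_real_derivative (\<Sum>l<n. a k l s * u l s)) (at s)"
    and cont: "\<And>k l. k < n \<Longrightarrow> l < n \<Longrightarrow> continuous_on {0..t} (a k l)"
    and zero: "\<And>k. k < n \<Longrightarrow> u k 0 = 0" and "k < n"
  shows "u k t = 0"
proof -
  define M where "M k l = (SOME M. \<forall>s\<in>{0..t}. \<bar>a k l s\<bar> \<le> M)" for k l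
  have "\<exists>M. \<forall>s\<in>{0..t}. \<bar>a k l s\<bar> \<le> M" if "k < n" "l < n" for k l
  proof -
    have "bounded (a k l ` {0..t})"
      by (intro compact_imp_bounded compact_continuous_image cont that compact_Icc)
    then show ?thesis by (auto simp: bounded_iff)
  qed
  from someI_ex[OF this]
  have M: "\<bar>a k l s\<bar> \<le> M k l" if "k < n" "l < n" "s \<in> {0..t}" for k l s
    using that by (auto simp: M_def)
  define K where "K = (\<Sum>k<n. \<Sum>l<n. \<bar>M k l\<bar>)"
  have K: "\<bar>a k l s\<bar> \<le> K" if "k < n" "l < n" "s \<in> {0..t}" for k l s
  proof -
    have "\<bar>a k l s\<bar> \<le> \<bar>M k l\<bar>" using M[OF that] by linarith
    also have "\<dots> \<le> (\<Sum>l<n. \<bar>M k l\<bar>)" by (rule member_le_sum) (use that in auto)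
    also have "\<dots> \<le> K" unfolding K_def
      by (rule member_le_sum[where f="\<lambda>k. \<Sum>l<n. \<bar>M k l\<bar>"]) (use that in \<open>auto intro: sum_nonneg\<close>)
    finally show ?thesis .
  qed
  define E where "E s = (\<Sum>k<n. (u k s)\<^sup>2)" for s
  define E' where "E' s = (\<Sum>k<n. \<Sum>l<n. 2 * (u k s * (a k l s * u l s)))" for s
  have E: "(E has_real_derivative E' s) (at s)" if "s \<in> {0..t}" for s
  proof -
    have "(E has_real_derivative (\<Sum>k<n. 2 * u k s * (\<Sum>l<n. a k l s * u l s))) (at s)"
      unfolding E_def using der[OF _ that] by (auto intro!: derivative_eq_intros sum.cong simp: mult_ac)
    then show ?thesis by (simp add: E'_def sum_distrib_left mult.assoc)
  qed
  have E'le: "E' s \<le> 2 * K * real n * E s" if s: "s \<in> {0..t}" for s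
  proof -
    have "E' s \<le> (\<Sum>k<n. \<Sum>l<n. K * ((u k s)\<^sup>2 + (u l s)\<^sup>2))"
      unfolding E'_def
    proof (intro sum_mono)
      fix k l assume kl: "k \<in> {..<n}" "l \<in> {..<n}"
      have "2 * (u k s * (a k l s * u l s)) \<le> \<bar>a k l s\<bar> * (2 * (\<bar>u k s\<bar> * \<bar>u l s\<bar>))"
        using abs_ge_self[of "2 * (u k s * (a k l s * u l s))"] by (simp add: abs_mult algebra_simps)
      also have "\<dots> \<le> K * ((u k s)\<^sup>2 + (u l s)\<^sup>2)"
        using sum_squares_bound[of "\<bar>u k s\<bar>" "\<bar>u l s\<bar>"] K[of k l s] kl s
        by (intro mult_mono) auto
      finally show "2 * (u k s * (a k l s * u l s)) \<le> K * ((u k s)\<^sup>2 + (u l s)\<^sup>2)" .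
    qed
    also have "\<dots> = 2 * K * real n * E s"
      by (simp add: E_def distrib_left sum.distrib sum_distrib_left[symmetric] algebra_simps)
    finally show ?thesis .
  qed
  define c where "c = 2 * K * real n"
  have "E t * exp (- c * t) \<le> E 0 * exp (- c * 0)"
  proof (rule DERIV_nonpos_imp_nonincreasing[OF assms(1)])
    fix s assume "0 \<le> s" "s \<le> t"
    then have s: "s \<in> {0..t}" by simp
    have "((\<lambda>s. E s * exp (- c * s)) has_real_derivative (E' s - c * E s) * exp (- c * s)) (at s)"
      by (rule derivative_eq_intros E[OF s] refl)+ (simp add: algebra_simps)
    moreover have "(E' s - c * E s) * exp (- c * s) \<le> 0"
      using E'le[OF s] by (simp add: c_def mult_le_0_iff)
    ultimately show "\<exists>y. ((\<lambda>s. E s * exp (- c * s)) has_real_derivative y) (at s) \<and> y \<le> 0" by blast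
  qed
  also have "E 0 = 0" using zero by (simp add: E_def)
  finally have "E t \<le> 0" by (simp add: mult_le_0_iff)
  then have "E t = 0" by (intro antisym) (simp_all add: E_def sum_nonneg)
  then show ?thesis using \<open>k < n\<close> by (simp add: E_def sum_nonneg_eq_0_iff)
qed

text \<open>Negative times are reflected to positive ones, which changes the sign of the
  coefficients.\<close>

lemma linear_ode_zero:
  fixes u :: "nat \<Rightarrow> real \<Rightarrow> real" and a :: "nat \<Rightarrow> nat \<Rightarrow> real \<Rightarrow> real"
  assumes "is_interval I" "0 \<in> I" "t \<in> I"
    and der: "\<And>k s. k < n \<Longrightarrow> s \<in> I \<Longrightarrow> (u k has_real_derivative (\<Sum>l<n. a k l s * u l s)) (at s)"
    and cont: "\<And>k l. k < n \<Longrightarrow> l < n \<Longrightarrow> continuous_on I (a k l)"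
    and zero: "\<And>k. k < n \<Longrightarrow> u k 0 = 0" and "k < n"
  shows "u k t = 0"
proof (cases "t \<ge> 0")
  case True
  have sub: "{0..t} \<subseteq> I" by (auto intro: mem_is_interval_1_I[OF assms(1-3)])
  show ?thesis
  proof (rule linear_ode_zero_forward[OF True, where n=n and a=a])
    show "(u k has_real_derivative (\<Sum>l<n. a k l s * u l s)) (at s)" if "k < n" "s \<in> {0..t}" for k s
      by (rule der[OF that(1)]) (use that(2) sub in blast)
    show "continuous_on {0..t} (a k l)" if "k < n" "l < n" for k l
      by (rule continuous_on_subset[OF cont[OF that] sub])
  qed (fact zero \<open>k < n\<close>)+
next
  case False
  then have t: "- t \<ge> 0" by simp
  have sub: "- s \<in> I" if "s \<in> {0..- t}" for s
    by (rule mem_is_interval_1_I[OF assms(1,3,2)]) (use that in auto)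
  have "u k (- (- t)) = 0"
  proof (rule linear_ode_zero_forward[OF t, where u="\<lambda>k s. u k (- s)" and a="\<lambda>k l s. - a k l (- s)" and n=n])
    fix k s assume k: "k < n" and s: "s \<in> {0..- t}"
    have "((\<lambda>s. u k (- s)) has_real_derivative (\<Sum>l<n. a k l (- s) * u l (- s)) * - 1) (at s)"
      by (rule DERIV_chain2[where f="u k" and g=uminus, OF der[OF k sub[OF s]]])
        (auto intro!: derivative_eq_intros)
    then show "((\<lambda>s. u k (- s)) has_real_derivative (\<Sum>l<n. - a k l (- s) * u l (- s))) (at s)"
      by (simp add: sum_negf)
  next
    fix k l assume kl: "k < n" "l < n"
    have "uminus ` {0..- t} \<subseteq> I" using sub by blast
    then show "continuous_on {0..- t} (\<lambda>s. - a k l (- s))"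
      by (intro continuous_intros continuous_on_compose2[OF cont[OF kl]])
  qed (use zero \<open>k < n\<close> in auto)
  then show ?thesis by simp
qed

section \<open>Functions composed with a map that is invertible to first order\<close>

text \<open>The map need not be injective: by Brouwer's theorem it is locally onto, and any choice of
  small preimages is differentiable at the base point.\<close>

lemma differentiable_quotient:
  fixes \<Psi> :: "'x::euclidean_space \<Rightarrow> 'x" and H P :: "'x \<Rightarrow> real"
  assumes "\<delta> > 0" "continuous_on (ball 0 \<delta>) \<Psi>" and \<Psi>': "(\<Psi> has_derivative M) (at 0)"
    and N: "bounded_linear N" "M \<circ> N = id" "N \<circ> M = id"
    and H': "(H has_derivative H') (at 0)"
    and P: "\<And>t. t \<in> ball 0 \<delta> \<Longrightarrow> P (\<Psi> t) = H t"
  shows "\<forall>\<^sub>F w in nhds (\<Psi> 0). w \<in> \<Psi> ` ball 0 \<delta>" "(P has_derivative (\<lambda>w. H' (N w))) (at (\<Psi> 0))"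
proof -
  obtain k where k: "k > 0" "\<And>w. norm (N w) \<le> norm w * k"
    using bounded_linear.pos_bounded[OF N(1)] by blast
  have kM: "norm t \<le> k * norm (M t)" for t
    using k(2)[of "M t"] fun_cong[OF N(3), of t] by (simp add: mult.commute)
  \<comment> \<open>As k bounds the norm of N, an error of 1/(2k) times |t| costs only half of |t|
    after applying N; absorbing it yields the lower estimate \<open>low\<close>.\<close>
  obtain d0 where d0: "d0 > 0" "\<And>t. norm t < d0 \<Longrightarrow> norm (\<Psi> t - \<Psi> 0 - M t) \<le> 1 / (2 * k) * norm t"
    using \<Psi>'[unfolded has_derivative_at_alt, THEN conjunct2, rule_format, of "1 / (2 * k)"] k(1) by auto
  define d where "d = min d0 \<delta>"
  have d: "d > 0" "d \<le> d0" "d \<le> \<delta>" using d0(1) assms(1) by (auto simp: d_def)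
  have low: "norm t \<le> 2 * k * norm (\<Psi> t - \<Psi> 0)" if "norm t < d" for t
  proof -
    have "norm (M t) \<le> norm (\<Psi> t - \<Psi> 0) + 1 / (2 * k) * norm t"
      using d0(2)[of t] that d(2) norm_triangle_sub[of "M t" "\<Psi> t - \<Psi> 0"]
      by (simp add: norm_minus_commute)
    then have "k * norm (M t) \<le> k * (norm (\<Psi> t - \<Psi> 0) + 1 / (2 * k) * norm t)"
      using k(1) by (intro mult_left_mono) auto
    then have "norm t \<le> k * (norm (\<Psi> t - \<Psi> 0) + 1 / (2 * k) * norm t)"
      using kM[of t] by linarith
    then show ?thesis using k(1) by (simp add: field_simps)
  qed
  \<comment> \<open>The topological open mapping theorem: besides continuity on the ball it asks for
    an invertible derivative at the single point 0.\<close>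
  have onto: "\<Psi> 0 \<in> interior (\<Psi> ` ball 0 e)" if "0 < e" "e \<le> \<delta>" for e
    by (rule sussmann_open_mapping[OF open_ball assms(2) _ \<Psi>' N(1,2)])
      (use that assms(1) in auto)
  show "\<forall>\<^sub>F w in nhds (\<Psi> 0). w \<in> \<Psi> ` ball 0 \<delta>"
    using onto[OF assms(1) order_refl] interior_subset
    by (auto simp: eventually_nhds intro!: exI[of _ "interior (\<Psi> ` ball 0 \<delta>)"])
  define W where "W = interior (\<Psi> ` ball 0 d)"
  have W: "open W" "\<Psi> 0 \<in> W" "W \<subseteq> \<Psi> ` ball 0 d"
    using onto[OF d(1,3)] interior_subset by (auto simp: W_def)
  \<comment> \<open>Preimages are picked arbitrarily. By \<open>low\<close> the choice is continuous
    at \<Psi>(0), and continuity at that one point is enough to differentiate an inverse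
    there.\<close>
  define g where "g w = (SOME t. t \<in> ball 0 d \<and> \<Psi> t = w)" for w
  have g: "g w \<in> ball 0 d" "\<Psi> (g w) = w" if "w \<in> W" for w
  proof -
    have "\<exists>t. t \<in> ball 0 d \<and> \<Psi> t = w" using subsetD[OF W(3) that] by (metis imageE)
    from someI_ex[OF this] show "g w \<in> ball 0 d" "\<Psi> (g w) = w" by (auto simp: g_def)
  qed
  have gle: "norm (g w) \<le> 2 * k * norm (w - \<Psi> 0)" if "w \<in> W" for w
    using low[of "g w"] g[OF that] by simp
  have g0: "g (\<Psi> 0) = 0" using gle[OF W(2)] by simp
  have "continuous (at (\<Psi> 0)) g"
    unfolding isCont_def g0
  proof (rule Lim_null_comparison)
    show "\<forall>\<^sub>F w in at (\<Psi> 0). norm (g w) \<le> 2 * k * norm (w - \<Psi> 0)"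
      using eventually_at_topological W(1,2) gle by blast
    have "((\<lambda>w. 2 * k * norm (w - \<Psi> 0)) \<longlongrightarrow> 2 * k * norm (\<Psi> 0 - \<Psi> 0)) (at (\<Psi> 0))"
      by (intro tendsto_intros)
    then show "((\<lambda>w. 2 * k * norm (w - \<Psi> 0)) \<longlongrightarrow> 0) (at (\<Psi> 0))" by simp
  qed
  then have "(g has_derivative N) (at (\<Psi> 0))"
    by (intro has_derivative_inverse_basic[where f=\<Psi>, OF _ N(1,3) _ W(1,2)]) (simp_all add: g0 \<Psi>' g(2))
  moreover have "(H has_derivative H') (at (g (\<Psi> 0)))" using H' g0 by simp
  ultimately have "((\<lambda>w. H (g w)) has_derivative (\<lambda>w. H' (N w))) (at (\<Psi> 0))"
    by (rule has_derivative_compose)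
  then show "(P has_derivative (\<lambda>w. H' (N w))) (at (\<Psi> 0))"
  proof (rule has_derivative_transform_within_open[OF _ W(1,2)])
    fix w assume "w \<in> W"
    then show "H (g w) = P w" using g[of w] P[of "g w"] d(3) by auto
  qed
qed

section \<open>Determinants, cofactors and the entries of the inverse\<close>

section \<open>Inverse matrices\<close>

lemma invertible_mat_det_nonzero:
  fixes M :: "real mat"
  assumes M: "M \<in> carrier_mat q q" and "invertible_mat M"
  shows "det M \<noteq> 0"
proof -
  obtain B where B: "M * B = 1\<^sub>m q" "B * M = 1\<^sub>m (dim_row B)"
    using assms by (auto simp: invertible_mat_def inverts_mat_def)
  have "dim_col B = q" using arg_cong[OF B(1), of dim_col] by simp
  moreover have "dim_row B = q" using arg_cong[OF B(2), of dim_col] M by simp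
  ultimately have "B \<in> carrier_mat q q" by auto
  with det_mult[OF M this] B(1) show ?thesis by auto
qed

text \<open>\<open>mat_inverse\<close> returns an option; a nonzero determinant makes the matrix a
  unit and excludes \<open>None\<close>, which gives \<open>mat_inv\<close> its meaning.\<close>

lemma mat_inv_det:
  fixes M :: "real mat"
  assumes M: "M \<in> carrier_mat q q" and "det M \<noteq> 0"
  shows "mat_inv M \<in> carrier_mat q q" "M * mat_inv M = 1\<^sub>m q" "mat_inv M * M = 1\<^sub>m q"
proof -
  have "mat_inverse M \<noteq> None"
    using mat_inverse(1)[OF M, where b="()"] det_non_zero_imp_unit[OF M assms(2), where b="()"] by blast
  then obtain B where "mat_inverse M = Some B" by auto
  with mat_inverse(2)[OF M this]
  show "mat_inv M \<in> carrier_mat q q" "M * mat_inv M = 1\<^sub>m q" "mat_inv M * M = 1\<^sub>m q" by auto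
qed

lemma invertible_mat_if_det_nonzero:
  fixes M :: "real mat"
  assumes M: "M \<in> carrier_mat q q" and "det M \<noteq> 0"
  shows "invertible_mat M"
  using mat_inv_det[OF assms] M by (auto simp: invertible_mat_def inverts_mat_def)

text \<open>Cramer's rule. It expresses the entries of the inverse by determinants, from which their
  smooth dependence on the point is obtained.\<close>

lemma mat_inv_entry:
  fixes M :: "real mat"
  assumes M: "M \<in> carrier_mat q q" and "det M \<noteq> 0" "j < q" "k < q"
  shows "mat_inv M $$ (j, k) = inverse (det M) * cofactor M k j"
proof -
  note B = mat_inv_det[OF assms(1,2)]
  have "adj_mat M = mat_inv M * M * adj_mat M" using B adj_mat(1)[OF M] by simp
  also have "\<dots> = mat_inv M * (det M \<cdot>\<^sub>m 1\<^sub>m q)"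
    using assoc_mult_mat[OF B(1) M adj_mat(1)[OF M]] adj_mat(2)[OF M] by simp
  also have "\<dots> = det M \<cdot>\<^sub>m mat_inv M"
    using mult_smult_distrib[OF B(1) one_carrier_mat] B(1) by simp
  finally have "adj_mat M $$ (j, k) = det M * mat_inv M $$ (j, k)"
    using B(1) assms(3,4) by simp
  moreover have "adj_mat M $$ (j, k) = cofactor M k j"
    using M assms(3,4) by (simp add: adj_mat_def)
  ultimately show ?thesis using assms(2) by (simp add: field_simps)
qed

lemma mat_mult_entry:
  fixes X Y :: "real mat"
  assumes "X \<in> carrier_mat q q" "Y \<in> carrier_mat q q" "i < q" "j < q"
  shows "(X * Y) $$ (i, j) = (\<Sum>k<q. X $$ (i, k) * Y $$ (k, j))"
  using assms by (simp add: scalar_prod_def atLeast0LessThan)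

lemma clock_matrix_carrier: "clock_matrix pb C T q x \<in> carrier_mat q q"
  by (simp add: clock_matrix_def)

lemma mat_inv_clock_matrix:
  assumes "det (clock_matrix pb C T q x) \<noteq> 0" "i < q" "j < q"
  shows "(\<Sum>k<q. pb (C i) (T k) x * mat_inv (clock_matrix pb C T q x) $$ (k, j)) = (if i = j then 1 else 0)"
    and "(\<Sum>k<q. mat_inv (clock_matrix pb C T q x) $$ (i, k) * pb (C k) (T j) x) = (if i = j then 1 else 0)"
proof -
  note M = clock_matrix_carrier[of pb C T q x]
  note B = mat_inv_det[OF M assms(1)]
  have e: "clock_matrix pb C T q x $$ (a, b) = pb (C a) (T b) x" if "a < q" "b < q" for a b
    using that by (simp add: clock_matrix_def)
  show "(\<Sum>k<q. pb (C i) (T k) x * mat_inv (clock_matrix pb C T q x) $$ (k, j)) = (if i = j then 1 else 0)"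
    using mat_mult_entry[OF M B(1) assms(2,3)] B(2) assms(2,3) e by simp
  show "(\<Sum>k<q. mat_inv (clock_matrix pb C T q x) $$ (i, k) * pb (C k) (T j) x) = (if i = j then 1 else 0)"
    using mat_mult_entry[OF B(1) M assms(2,3)] B(3) assms(2,3) e by simp
qed

lemma sum_if_eq_less:
  fixes f :: "nat \<Rightarrow> real"
  assumes "j < q"
  shows "(\<Sum>k<q. (if k = j then 1 else 0) * f k) = f j" "(\<Sum>k<q. (if j = k then 1 else 0) * f k) = f j"
    "(\<Sum>k<q. f k * (if k = j then 1 else 0)) = f j" "(\<Sum>k<q. f k * (if j = k then 1 else 0)) = f j"
  using assms by (simp_all add: if_distrib[of "\<lambda>u. u * _"] if_distrib[of "\<lambda>u. _ * u"] cong: if_cong)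

lemma sum_mult_swap:
  fixes a :: "nat \<Rightarrow> real"
  shows "(\<Sum>i<q. a i * (\<Sum>j<r. b i j * c j)) = (\<Sum>j<r. (\<Sum>i<q. a i * b i j) * c j)"
proof -
  have "(\<Sum>i<q. a i * (\<Sum>j<r. b i j * c j)) = (\<Sum>i<q. \<Sum>j<r. a i * b i j * c j)"
    by (simp add: sum_distrib_left mult.assoc)
  also have "\<dots> = (\<Sum>j<r. \<Sum>i<q. a i * b i j * c j)" by (rule sum.swap)
  finally show ?thesis by (simp add: sum_distrib_right)
qed

section \<open>Tangency of the constraint vector fields to the constraint surface\<close>

section \<open>First class constraints\<close>

text \<open>The span of the c_k has dimension n, so its orthogonal complement K has the dimension of
  L; since L lies in K, the two coincide.\<close>

lemma mem_if_orthogonal_to_complement: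
  fixes c :: "nat \<Rightarrow> 'e::euclidean_space"
  assumes L: "subspace L" "dim L + n = DIM('e)" "\<And>k v. k < n \<Longrightarrow> v \<in> L \<Longrightarrow> c k \<bullet> v = 0"
    and indep: "\<And>a k. (\<Sum>k<n. a k *\<^sub>R c k) = 0 \<Longrightarrow> k < n \<Longrightarrow> a k = 0"
    and X: "\<And>k. k < n \<Longrightarrow> c k \<bullet> X = 0"
  shows "X \<in> L"
proof -
  \<comment> \<open>\<open>independent\<close> is a property of sets, so equal vectors at different
    indices have to be excluded before the dimension can be read off as n.\<close>
  have inj: "inj_on c {..<n}"
  proof (rule inj_onI, rule ccontr)
    fix i j assume ij: "i \<in> {..<n}" "j \<in> {..<n}" "c i = c j" "i \<noteq> j"
    let ?a = "\<lambda>k. (if k = i then 1 else 0) - (if k = j then 1 else (0::real))"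
    have "(\<Sum>k<n. ?a k *\<^sub>R c k) = c i - c j"
      using ij(1,2) by (simp add: scaleR_diff_left sum_subtractf if_distrib[of "\<lambda>u. u *\<^sub>R _"] cong: if_cong)
    then have "?a i = 0" using indep[of ?a i] ij by simp
    then show False using ij(4) by simp
  qed
  have "independent (c ` {..<n})"
  proof (rule independent_if_scalars_zero)
    fix f x assume f: "(\<Sum>x\<in>c ` {..<n}. f x *\<^sub>R x) = 0" and x: "x \<in> c ` {..<n}"
    have "(\<Sum>k<n. f (c k) *\<^sub>R c k) = 0" using f by (simp add: sum.reindex[OF inj])
    then show "f x = 0" using indep[of "\<lambda>k. f (c k)"] x by auto
  qed simp
  then have "dim (span (c ` {..<n})) = n"
    using inj by (simp add: dim_eq_card_independent card_image)
  define K where "K = {y \<in> UNIV. \<forall>x\<in>span (c ` {..<n}). real_inner_class.orthogonal x y}"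
  have "dim K + n = DIM('e)"
    using dim_subspace_orthogonal_to_vectors[of "span (c ` {..<n})" UNIV] \<open>dim (span _) = n\<close>
    by (simp add: K_def)
  have K: "v \<in> K" if "\<And>k. k < n \<Longrightarrow> c k \<bullet> v = 0" for v
  proof -
    have "real_inner_class.orthogonal v x" if "x \<in> span (c ` {..<n})" for x
      by (rule orthogonal_to_span[OF that])
        (use \<open>\<And>k. k < n \<Longrightarrow> c k \<bullet> v = 0\<close> in \<open>auto simp: real_inner_class.orthogonal_def inner_commute\<close>)
    then show ?thesis by (auto simp: K_def orthogonal_commute)
  qed
  have "subspace K"
    by (auto simp: K_def subspace_def real_inner_class.orthogonal_def inner_add_right)
  have "L = K"
    by (rule subspace_dim_equal[OF L(1) \<open>subspace K\<close>])
      (use L(2) \<open>dim K + n = DIM('e)\<close> in \<open>auto intro!: K L(3)\<close>)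
  then show ?thesis using K X by simp
qed

locale constrained_system = poisson_manifold \<A> pb
  for \<A> :: "('a::t2_space, 'b::euclidean_space) chart set" and pb +
  fixes C :: "nat \<Rightarrow> 'a \<Rightarrow> real" and n p :: nat
  assumes dimension: "DIM('b) = 2 * p" and n_less_p: "n < p"
    and C_smooth: "\<And>i. i < n \<Longrightarrow> C i \<in> smooth_functions \<A>"
    and surface: "submanifold \<A> (2 * p - n) (constraint_surface n C)"
    and first_class: "bracket_closed \<A> pb C {..<n}"
begin

abbreviation "\<C> \<equiv> constraint_surface n C"

lemma bracket_expansion:
  assumes "i < n" "j < n"
  obtains F where "\<And>k. k < n \<Longrightarrow> F k \<in> smooth_functions \<A>"
    "\<And>x. pb (C i) (C j) x = (\<Sum>k<n. F k x * C k x)"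
proof -
  obtain F where F: "(\<forall>k\<in>{..<n}. F k \<in> smooth_functions \<A>) \<and>
        (\<forall>x. pb (C i) (C j) x = (\<Sum>k\<in>{..<n}. F k x * C k x))"
    using first_class assms unfolding bracket_closed_def by blast
  show ?thesis by (rule that[of F]) (use F in blast)+
qed

lemma bracket_zero_on_surface:
  assumes "x \<in> \<C>" "i < n" "j < n"
  shows "pb (C i) (C j) x = 0"
proof -
  obtain F :: "nat \<Rightarrow> 'a \<Rightarrow> real" where "\<And>k. k < n \<Longrightarrow> F k \<in> smooth_functions \<A>"
    "\<And>x. pb (C i) (C j) x = (\<Sum>k<n. F k x * C k x)"
    using bracket_expansion[OF assms(2,3)] by blast
  then show ?thesis using assms(1) by (simp add: constraint_surface_def)
qed

lemma weakly_invariantD: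
  assumes "weakly_invariant \<A> pb n C m h"
  obtains W where "open W" "\<C> \<subseteq> W" "smooth_fun_on \<A> W h"
  using assms by (auto simp: weakly_invariant_def)

lemma weakly_invariant_germ:
  assumes "weakly_invariant \<A> pb n C m h" "x \<in> \<C>"
  obtains k where "k \<in> smooth_functions \<A>" "\<forall>\<^sub>F y in nhds x. k y = h y"
proof -
  obtain W where W: "open W" "\<C> \<subseteq> W" "smooth_fun_on \<A> W h"
    by (rule weakly_invariantD[OF assms(1)])
  show ?thesis
    by (rule smooth_germ_extension[OF W(1) subsetD[OF W(2) assms(2)] W(3)]) (rule that)
qed

end

locale clocks = constrained_system +
  fixes T :: "nat \<Rightarrow> 'a \<Rightarrow> real"
  assumes T_smooth: "\<And>i. i < n \<Longrightarrow> T i \<in> smooth_functions \<A>"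
    and A_invertible: "\<And>x. x \<in> \<C> \<Longrightarrow> invertible_mat (clock_matrix pb C T n x)"
begin

abbreviation "Ainv x j k \<equiv> mat_inv (clock_matrix pb C T n x) $$ (j, k)"

lemma det_nonzero: "x \<in> \<C> \<Longrightarrow> det (clock_matrix pb C T n x) \<noteq> 0"
  by (rule invertible_mat_det_nonzero[OF clock_matrix_carrier A_invertible])

text \<open>Multiply the system by the inverse of A from the left.\<close>

lemma clock_solve:
  assumes "x \<in> \<C>" "\<And>k. k < n \<Longrightarrow> (\<Sum>j<n. pb (C k) (T j) x * v j) = 0" "j < n"
  shows "v j = 0"
proof -
  have "(\<Sum>k<n. Ainv x j k * (\<Sum>i<n. pb (C k) (T i) x * v i)) = v j"
    by (simp add: sum_mult_swap mat_inv_clock_matrix(2)[OF det_nonzero[OF assms(1)] assms(3)]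
        sum_if_eq_less[OF assms(3)])
  moreover have "(\<Sum>k<n. Ainv x j k * (\<Sum>i<n. pb (C k) (T i) x * v i)) = 0"
    using assms(2) by simp
  ultimately show ?thesis by simp
qed

text \<open>The differentials of the constraints are independent because \<open>A\<close> is invertible. By dimension,
  the tangent vectors annihilating all constraints are then exactly those tangent to the slice of \<open>\<C>\<close>.\<close>

lemma bracket_vanishing_on_surface:
  assumes x: "x \<in> \<C>" and u: "u \<in> smooth_functions \<A>" "\<forall>\<^sub>F y in nhds x. y \<in> \<C> \<longrightarrow> u y = 0"
    and i: "i < n"
  shows "pb (C i) u x = 0"
proof -
  obtain V \<psi> where c: "(V, \<psi>) \<in> \<A>" "x \<in> V" by (rule chart_at)
  note V = is_chartD[OF chart[OF c(1)]]
  obtain U \<phi> L where d: "compatible_chart \<A> (U, \<phi>)" "x \<in> U" "subspace L" "dim L = 2 * p - n"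
    "\<phi> ` (U \<inter> \<C>) = \<phi> ` U \<inter> L"
    using surface x unfolding submanifold_def by blast
  have chU: "is_chart (U, \<phi>)" using d(1) by (simp add: compatible_chart_def)
  note U = is_chartD[OF chU]
  have "smooth_transition (U, \<phi>) (V, \<psi>)" "smooth_transition (V, \<psi>) (U, \<phi>)"
    using d(1) c(1) unfolding compatible_chart_def by auto
  then have sm: "smooth_on (\<phi> ` (U \<inter> V)) (\<lambda>z. \<psi> (inv_into U \<phi> z))"
    "smooth_on (\<psi> ` (V \<inter> U)) (\<lambda>z. \<phi> (inv_into V \<psi> z))"
    by (simp_all add: smooth_transition_def o_def)
  \<comment> \<open>The slice chart need not belong to the atlas, while differentials of functions
    are taken in the atlas chart \<open>\<psi>\<close>. P and Q are the derivatives of the two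
    transition maps at x.\<close>
  define P where "P = frechet_derivative (\<lambda>z. \<psi> (inv_into U \<phi> z)) (at (\<phi> x))"
  define Q where "Q = frechet_derivative (\<lambda>z. \<phi> (inv_into V \<psi> z)) (at (\<psi> x))"
  have P: "((\<lambda>z. \<psi> (inv_into U \<phi> z)) has_derivative P) (at (\<phi> x))"
    unfolding P_def by (rule smooth_on_has_derivative[OF sm(1)]) (use c(2) d(2) in auto)
  have Q: "((\<lambda>z. \<phi> (inv_into V \<psi> z)) has_derivative Q) (at (\<psi> x))"
    unfolding Q_def by (rule smooth_on_has_derivative[OF sm(2)]) (use c(2) d(2) in auto)
  have opn: "open (\<phi> ` (U \<inter> V))" by (rule chart_open_image[OF chU V(1)])
  have mem: "\<phi> x \<in> \<phi> ` (U \<inter> V)" using c(2) d(2) by auto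
  have Q': "((\<lambda>z. \<phi> (inv_into V \<psi> z)) has_derivative Q) (at (\<psi> (inv_into U \<phi> (\<phi> x))))"
    using Q U(5)[OF d(2)] by simp
  have "((\<lambda>z. \<phi> (inv_into V \<psi> (\<psi> (inv_into U \<phi> z)))) has_derivative (\<lambda>v. Q (P v))) (at (\<phi> x))"
    by (rule has_derivative_compose[OF P Q'])
  then have "((\<lambda>z. z) has_derivative (\<lambda>v. Q (P v))) (at (\<phi> x))"
    by (rule has_derivative_transform_within_open[OF _ opn mem]) (use U(5) V(5) in auto)
  then have QP: "Q (P v) = v" for v
    using has_derivative_unique[OF _ has_derivative_ident] by (auto dest: fun_cong)
  have linP: "linear P" using P by (rule has_derivative_linear)
  have injP: "inj P" using QP by (rule inj_on_inverseI)
  define dd where "dd h = frechet_derivative (\<lambda>z. h (inv_into V \<psi> z)) (at (\<psi> x))" for h :: "'a \<Rightarrow> real"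
  have dd: "((\<lambda>z. h (inv_into V \<psi> z)) has_derivative dd h) (at (\<psi> x))" if "h \<in> smooth_functions \<A>" for h
    unfolding dd_def by (rule smooth_functions_has_derivative[OF that c(1) imageI[OF c(2)]])
  have "\<phi> x \<in> \<phi> ` (U \<inter> \<C>)" using x d(2) by auto
  then have aL: "\<phi> x \<in> L" using d(5) by auto
  \<comment> \<open>A straight line through \<phi>(x) in a slice direction v runs inside
    \<open>\<C>\<close> for small parameters, where h vanishes, so h has derivative 0 along
    it.\<close>
  have tang: "dd h (P v) = 0"
    if h: "h \<in> smooth_functions \<A>" "\<forall>\<^sub>F y in nhds x. y \<in> \<C> \<longrightarrow> h y = 0" and v: "v \<in> L" for h v
  proof -
    obtain W where W: "open W" "x \<in> W" "\<And>y. y \<in> W \<Longrightarrow> y \<in> \<C> \<Longrightarrow> h y = 0"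
      using h(2) by (auto simp: eventually_nhds)
    have oO: "open (\<phi> ` (U \<inter> (V \<inter> W)))" using chart_open_image[OF chU open_Int[OF V(1) W(1)]] .
    have D1: "((\<lambda>s. \<phi> x + s *\<^sub>R v) has_derivative (\<lambda>s. s *\<^sub>R v)) (at (0::real))"
      by (auto intro!: derivative_eq_intros)
    have P0: "((\<lambda>z. \<psi> (inv_into U \<phi> z)) has_derivative P) (at (\<phi> x + 0 *\<^sub>R v))" using P by simp
    have D2: "((\<lambda>s. \<psi> (inv_into U \<phi> (\<phi> x + s *\<^sub>R v))) has_derivative (\<lambda>s. P (s *\<^sub>R v))) (at (0::real))"
      by (rule has_derivative_compose[OF D1 P0])
    have dd0: "((\<lambda>z. h (inv_into V \<psi> z)) has_derivative dd h) (at (\<psi> (inv_into U \<phi> (\<phi> x + 0 *\<^sub>R v))))"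
      using dd[OF h(1)] U(5)[OF d(2)] by simp
    have D3: "((\<lambda>s. h (inv_into V \<psi> (\<psi> (inv_into U \<phi> (\<phi> x + s *\<^sub>R v))))) has_derivative
        (\<lambda>s. dd h (P (s *\<^sub>R v)))) (at (0::real))"
      by (rule has_derivative_compose[OF D2 dd0])
    define R where "R = (\<lambda>s::real. \<phi> x + s *\<^sub>R v) -` (\<phi> ` (U \<inter> (V \<inter> W)))"
    have "open R" unfolding R_def by (rule open_vimage[OF oO]) (intro continuous_intros)
    have "0 \<in> R" using c(2) d(2) W(2) by (auto simp: R_def)
    have "((\<lambda>s. 0) has_derivative (\<lambda>s. dd h (P (s *\<^sub>R v)))) (at (0::real))"
    proof (rule has_derivative_transform_within_open[OF D3 \<open>open R\<close> \<open>0 \<in> R\<close>])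
      fix s assume "s \<in> R"
      then obtain y where y: "y \<in> U" "y \<in> V" "y \<in> W" "\<phi> x + s *\<^sub>R v = \<phi> y" by (auto simp: R_def)
      have "\<phi> x + s *\<^sub>R v \<in> L" using aL v d(3) by (simp add: subspace_add subspace_scale)
      then have "\<phi> y \<in> \<phi> ` (U \<inter> \<C>)" using d(5) y by auto
      then obtain y' where "y' \<in> U" "y' \<in> \<C>" "\<phi> y = \<phi> y'" by auto
      then have "y \<in> \<C>" using U(5) y(1) by metis
      then show "h (inv_into V \<psi> (\<psi> (inv_into U \<phi> (\<phi> x + s *\<^sub>R v)))) = 0"
        using y U(5) V(5) W(3) by simp
    qed
    then have "(\<lambda>s. dd h (P (s *\<^sub>R v))) = (\<lambda>s. 0)"
      by (rule has_derivative_unique) (rule has_derivative_const)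
    from fun_cong[OF this, of 1] show ?thesis by simp
  qed
  have vec: "\<exists>X. \<forall>h\<in>smooth_functions \<A>. pb w h x = dd h X" if w: "w \<in> smooth_functions \<A>" for w
  proof (rule derivation_tangent_vector[OF derivation_pb[OF w] c])
    fix X assume "\<And>h. h \<in> smooth_functions \<A> \<Longrightarrow>
      pb w h x = frechet_derivative (\<lambda>z. h (inv_into V \<psi> z)) (at (\<psi> x)) X"
    then show ?thesis unfolding dd_def by blast
  qed
  \<comment> \<open>The gradient of \<open>C k\<close> in the chart, so that annihilating a
    differential becomes orthogonality.\<close>
  define cc where "cc k = (\<Sum>b\<in>Basis. dd (C k) b *\<^sub>R b)" for k
  have cc: "cc k \<bullet> v = dd (C k) v" if "k < n" for k v
  proof -
    interpret bounded_linear "dd (C k)"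
      using dd[OF C_smooth[OF that]] by (rule has_derivative_bounded_linear)
    have "dd (C k) v = dd (C k) (\<Sum>b\<in>Basis. (v \<bullet> b) *\<^sub>R b)" by (simp only: euclidean_representation)
    also have "\<dots> = (\<Sum>b\<in>Basis. (v \<bullet> b) * dd (C k) b)" by (simp only: sum scaleR real_scaleR_def)
    also have "\<dots> = cc k \<bullet> v"
      by (simp add: cc_def inner_sum_left inner_commute[of v] mult.commute)
    finally show ?thesis by simp
  qed
  obtain X where X: "\<And>h. h \<in> smooth_functions \<A> \<Longrightarrow> pb (C i) h x = dd h X"
    using vec[OF C_smooth[OF i]] by blast
  have "X \<in> P ` L"
  proof (rule mem_if_orthogonal_to_complement[where c=cc and n=n])
    show "subspace (P ` L)" by (rule linear_subspace_image[OF linP d(3)])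
    have "dim (P ` L) = dim L" by (rule dim_image_eq[OF linP inj_on_subset[OF injP subset_UNIV]])
    then show "dim (P ` L) + n = DIM('b)" using d(4) dimension n_less_p by simp
    show "cc k \<bullet> v = 0" if k: "k < n" and v: "v \<in> P ` L" for k v
    proof -
      obtain w where "w \<in> L" "v = P w" using v by auto
      moreover have "\<forall>\<^sub>F y in nhds x. y \<in> \<C> \<longrightarrow> C k y = 0"
        using k by (simp add: constraint_surface_def)
      ultimately show ?thesis using tang[OF C_smooth[OF k]] cc[OF k] by simp
    qed
    show "cc k \<bullet> X = 0" if "k < n" for k
      using X[OF C_smooth[OF that]] cc[OF that] bracket_zero_on_surface[OF x i that] by simp
    \<comment> \<open>Pairing a linear relation among the gradients with the Hamiltonian vector Y of
      each \<open>T l\<close> gives a relation among the rows of A, which is trivial because A is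
      invertible.\<close>
    show "a k = 0" if a: "(\<Sum>k<n. a k *\<^sub>R cc k) = 0" and k: "k < n" for a k
    proof -
      have "(\<Sum>k<n. a k * pb (C k) (T l) x) = 0" if l: "l < n" for l
      proof -
        obtain Y where Y: "\<And>h. h \<in> smooth_functions \<A> \<Longrightarrow> pb (T l) h x = dd h Y"
          using vec[OF T_smooth[OF l]] by blast
        have "0 = (\<Sum>k<n. a k *\<^sub>R cc k) \<bullet> Y" using a by simp
        also have "\<dots> = (\<Sum>k<n. a k * dd (C k) Y)"
          using cc by (simp add: inner_sum_left)
        also have "\<dots> = (\<Sum>k<n. - (a k * pb (C k) (T l) x))"
          using Y C_smooth pb_antisym[OF C_smooth T_smooth[OF l]] by (intro sum.cong) auto
        finally show ?thesis by (simp add: sum_negf)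
      qed
      then have "0 = (\<Sum>l<n. (\<Sum>j<n. a j * pb (C j) (T l) x) * Ainv x l k)" by simp
      also have "\<dots> = (\<Sum>j<n. a j * (\<Sum>l<n. pb (C j) (T l) x * Ainv x l k))"
        by (simp add: sum_mult_swap)
      also have "\<dots> = a k"
        using k by (simp add: mat_inv_clock_matrix(1)[OF det_nonzero[OF x] _ k] sum_if_eq_less)
      finally show ?thesis by simp
    qed
  qed
  then obtain w where "w \<in> L" "X = P w" by auto
  then show ?thesis using X[OF u(1)] tang[OF u(1,2)] by simp
qed

text \<open>The difference of the two functions vanishes on \<open>\<C>\<close>, hence so do its
  brackets with the constraints at points of \<open>\<C>\<close>.\<close>

lemma ham_vf_cong_on_surface:
  assumes "x \<in> \<C>" "i < n" and h: "open W" "x \<in> W" "smooth_fun_on \<A> W h"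
    and k: "open V" "x \<in> V" "smooth_fun_on \<A> V k"
    and eq: "\<And>y. y \<in> \<C> \<Longrightarrow> h y = k y"
  shows "ham_vf \<A> pb (C i) h x = ham_vf \<A> pb (C i) k x"
proof -
  obtain h' where h': "h' \<in> smooth_functions \<A>" "\<forall>\<^sub>F y in nhds x. h' y = h y"
    by (rule smooth_germ_extension[OF h])
  obtain k' where k': "k' \<in> smooth_functions \<A>" "\<forall>\<^sub>F y in nhds x. k' y = k y"
    by (rule smooth_germ_extension[OF k])
  have d: "(\<lambda>y. h' y - k' y) \<in> smooth_functions \<A>"
    using h'(1) k'(1) by (simp add: smooth_functions_iff smooth_fun_on_diff)
  have "\<forall>\<^sub>F y in nhds x. y \<in> \<C> \<longrightarrow> h' y - k' y = 0"
    using h'(2) k'(2) by eventually_elim (auto simp: eq)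
  then have "pb (C i) (\<lambda>y. h' y - k' y) x = 0"
    by (rule bracket_vanishing_on_surface[OF assms(1) d _ assms(2)])
  then have "pb (C i) h' x = pb (C i) k' x"
    using derivation_diff[OF derivation_pb[OF C_smooth[OF assms(2)]] h'(1) k'(1)] by simp
  then show ?thesis
    using ham_vf_germ[OF C_smooth[OF assms(2)] h'] ham_vf_germ[OF C_smooth[OF assms(2)] k'] by simp
qed

text \<open>Given smoothness near \<open>\<C>\<close>, weak invariance depends on values on
  \<open>\<C>\<close> only. This carries invariance over from S_j(f) to g_j.\<close>

lemma weakly_invariant_cong_on_surface:
  assumes h: "weakly_invariant \<A> pb n C m h" and W: "open W" "\<C> \<subseteq> W" "smooth_fun_on \<A> W k"
    and eq: "\<And>y. y \<in> \<C> \<Longrightarrow> k y = h y"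
  shows "weakly_invariant \<A> pb n C m k"
proof -
  obtain V where V: "open V" "\<C> \<subseteq> V" "smooth_fun_on \<A> V h" by (rule weakly_invariantD[OF h])
  have "ham_vf \<A> pb (C l) k x = 0" if "l \<in> {m..<n}" "x \<in> \<C>" for l x
    using ham_vf_cong_on_surface[OF that(2) _ W(1) subsetD[OF W(2) that(2)] W(3)
        V(1) subsetD[OF V(2) that(2)] V(3) eq, of l] that h
    by (simp add: weakly_invariant_def)
  then show ?thesis using W by (auto simp: weakly_invariant_def)
qed

text \<open>Jacobi's identity: on \<open>\<C>\<close> the commutator of two constraint flows is again a combination of
  constraint flows.\<close>

lemma double_bracket:
  assumes x: "x \<in> \<C>" and q: "q \<in> smooth_functions \<A>" "\<forall>\<^sub>F y in nhds x. y \<in> \<C> \<longrightarrow> pb (C l) q y = 0"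
    and l: "l < n" and k: "k < n"
    and F: "\<And>i. i < n \<Longrightarrow> F i \<in> smooth_functions \<A>" "\<And>x. pb (C l) (C k) x = (\<Sum>i<n. F i x * C i x)"
  shows "pb (C l) (pb (C k) q) x = (\<Sum>i<n. F i x * pb (C i) q x)"
proof -
  note Cl = C_smooth[OF l] and Ck = C_smooth[OF k]
  have qC: "pb q (C l) = (\<lambda>y. - pb (C l) q y)" using pb_antisym[OF q(1) Cl] by auto
  \<comment> \<open>The function {q, C_l} vanishes on \<open>\<C>\<close> near x, so its bracket
    with C_k is 0 at x and one term of Jacobi's identity drops out.\<close>
  have "pb (C k) (pb q (C l)) x = 0"
    by (rule bracket_vanishing_on_surface[OF x pb_smooth[OF q(1) Cl] _ k])
      (use q(2) qC in \<open>auto elim: eventually_mono\<close>)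
  then have "pb (C l) (pb (C k) q) x = - pb q (pb (C l) (C k)) x"
    using pb_jacobi[OF Cl Ck q(1), of x] by simp
  also have "pb q (pb (C l) (C k)) x = (\<Sum>i<n. pb q (\<lambda>y. F i y * C i y) x)"
  proof -
    have "pb (C l) (C k) = (\<lambda>y. \<Sum>i<n. F i y * C i y)" using F(2) by auto
    then show ?thesis
      using derivation_sum[OF derivation_pb[OF q(1)], of "{..<n}" "\<lambda>i y. F i y * C i y" x]
        smooth_functions_mult[OF F(1) C_smooth] by simp
  qed
  also have "\<dots> = (\<Sum>i<n. - (F i x * pb (C i) q x))"
  proof (rule sum.cong[OF refl])
    fix i assume "i \<in> {..<n}"
    then have i: "i < n" by simp
    \<comment> \<open>This removes the Leibniz term containing {q, F_i}.\<close>
    have "C i x = 0" using x i by (simp add: constraint_surface_def)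
    then show "pb q (\<lambda>y. F i y * C i y) x = - (F i x * pb (C i) q x)"
      using derivation_mult[OF derivation_pb[OF q(1)] F(1)[OF i] C_smooth[OF i], of x]
        pb_antisym[OF q(1) C_smooth[OF i], of x] by simp
  qed
  finally show ?thesis by (simp add: sum_negf)
qed

section \<open>Smoothness of the inverse clock matrix near the constraint surface\<close>

definition regular_set :: "nat \<Rightarrow> 'a set" where
  "regular_set q = {x. det (clock_matrix pb C T q x) \<noteq> 0}"

lemma smooth_fun_on_clock_det:
  assumes "q \<le> n"
  shows "smooth_fun_on \<A> UNIV (\<lambda>x. det (clock_matrix pb C T q x))"
  unfolding clock_matrix_def
  by (rule smooth_fun_on_det) (use assms in \<open>auto intro!: smooth_functionsD pb_smooth C_smooth T_smooth\<close>)

lemma open_regular_set: "q \<le> n \<Longrightarrow> open (regular_set q)"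
  unfolding regular_set_def
  by (rule open_Collect_neq[OF smooth_fun_on_continuous_on[OF open_UNIV smooth_fun_on_clock_det]
        continuous_on_const])

text \<open>Each entry is a signed minor divided by the determinant, and both are polynomials in the
  brackets of constraints and clocks.\<close>

lemma smooth_fun_on_mat_inv:
  assumes q: "q \<le> n" "j < q" "k < q"
  shows "smooth_fun_on \<A> (regular_set q) (\<lambda>x. mat_inv (clock_matrix pb C T q x) $$ (j, k))"
proof (rule smooth_fun_on_cong[OF open_regular_set[OF q(1)]])
  \<comment> \<open>\<open>?s r\<close> skips the index r, so \<open>?G\<close> is the clock matrix
    with row k and column j deleted.\<close>
  let ?s = "\<lambda>r a. if a < r then a else Suc a"
  let ?G = "\<lambda>x. Matrix.mat (q - 1) (q - 1) (\<lambda>(a, b). pb (C (?s k a)) (T (?s j b)) x)"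
  have G: "mat_delete (clock_matrix pb C T q x) k j = ?G x" for x
    by (rule eq_matI) (use q in \<open>auto simp: mat_delete_def clock_matrix_def\<close>)
  have "smooth_fun_on \<A> (regular_set q) (\<lambda>x. det (?G x))"
    by (rule smooth_fun_on_det[OF open_regular_set[OF q(1)]])
      (use q in \<open>auto intro!: smooth_functionsD pb_smooth C_smooth T_smooth\<close>)
  then show "smooth_fun_on \<A> (regular_set q)
      (\<lambda>x. inverse (det (clock_matrix pb C T q x)) * ((-1) ^ (k + j) * det (?G x)))"
    by (intro smooth_fun_on_mult smooth_fun_on_inverse smooth_fun_on_const open_regular_set q(1)
        smooth_fun_on_subset[OF smooth_fun_on_clock_det[OF q(1)]] subset_UNIV)
      (simp add: regular_set_def)
  fix x assume "x \<in> regular_set q"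
  then show "mat_inv (clock_matrix pb C T q x) $$ (j, k) =
      inverse (det (clock_matrix pb C T q x)) * ((-1) ^ (k + j) * det (?G x))"
    using mat_inv_entry[OF clock_matrix_carrier _ q(2,3), of pb C T x]
    by (simp add: regular_set_def cofactor_def G)
qed

lemma smooth_fun_on_S_op:
  assumes "open W" "smooth_fun_on \<A> W h" "j < n"
  shows "smooth_fun_on \<A> (W \<inter> regular_set n) (S_op \<A> pb n C T j h)"
  unfolding S_op_def[abs_def]
  by (intro smooth_fun_on_sum smooth_fun_on_mult open_Int assms(1) open_regular_set
      smooth_fun_on_subset[OF smooth_fun_on_mat_inv] smooth_fun_on_subset[OF smooth_fun_on_ham_vf[OF _ assms(1,2)]]
      C_smooth assms(3)) auto

lemma surface_regular: "\<C> \<subseteq> regular_set n"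
  using det_nonzero by (auto simp: regular_set_def)

end

section \<open>Clocks adapted to a subalgebra of constraints\<close>

lemma sum_lessThan_truncate:
  fixes f :: "nat \<Rightarrow> real"
  assumes "m \<le> n" "\<And>k. k \<in> {m..<n} \<Longrightarrow> f k = 0"
  shows "(\<Sum>k<n. f k) = (\<Sum>k<m. f k)"
  by (rule sum.mono_neutral_right) (use assms in auto)

locale reduced_clocks = clocks +
  fixes m :: nat
  assumes m_less_n: "m < n"
    and T_inv: "\<And>i. i < m \<Longrightarrow> weakly_invariant \<A> pb n C m (T i)"
begin

abbreviation "winv \<equiv> weakly_invariant \<A> pb n C m"
abbreviation "S \<equiv> S_op \<A> pb n C T"

section \<open>Weakly invariant functions and the block structure of the clock matrix\<close>

lemma winv_zero:
  "winv h \<Longrightarrow> l \<in> {m..<n} \<Longrightarrow> x \<in> \<C> \<Longrightarrow> ham_vf \<A> pb (C l) h x = 0"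
  by (simp add: weakly_invariant_def)

lemma bracket_const: "i < n \<Longrightarrow> pb (C i) (\<lambda>y. c) x = 0"
  by (rule derivation_const[OF derivation_pb[OF C_smooth]])

lemma winv_const: "winv (\<lambda>x. c)"
proof -
  have "ham_vf \<A> pb (C l) (\<lambda>x. c) x = 0" if "l \<in> {m..<n}" for l x
    using ham_vf_smooth_function[OF C_smooth smooth_functions_const] bracket_const that by simp
  then show ?thesis
    by (auto simp: weakly_invariant_def intro: smooth_fun_on_const)
qed

lemma winv_mult:
  assumes "winv h" "winv k"
  shows "winv (\<lambda>x. h x * k x)"
proof -
  obtain W where W: "open W" "\<C> \<subseteq> W" "smooth_fun_on \<A> W h" by (rule weakly_invariantD[OF assms(1)])
  obtain V where V: "open V" "\<C> \<subseteq> V" "smooth_fun_on \<A> V k" by (rule weakly_invariantD[OF assms(2)])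
  have "smooth_fun_on \<A> (W \<inter> V) (\<lambda>x. h x * k x)"
    by (intro smooth_fun_on_mult open_Int W(1) V(1) smooth_fun_on_subset[OF W(3)] smooth_fun_on_subset[OF V(3)]) auto
  moreover have "ham_vf \<A> pb (C l) (\<lambda>x. h x * k x) x = 0" if l: "l \<in> {m..<n}" and x: "x \<in> \<C>" for l x
  proof -
    have Cl: "C l \<in> smooth_functions \<A>" using C_smooth l by simp
    obtain h' where h': "h' \<in> smooth_functions \<A>" "\<forall>\<^sub>F y in nhds x. h' y = h y"
      by (rule weakly_invariant_germ[OF assms(1) x])
    obtain k' where k': "k' \<in> smooth_functions \<A>" "\<forall>\<^sub>F y in nhds x. k' y = k y"
      by (rule weakly_invariant_germ[OF assms(2) x])
    have "\<forall>\<^sub>F y in nhds x. h' y * k' y = h y * k y"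
      using h'(2) k'(2) by eventually_elim simp
    then have "ham_vf \<A> pb (C l) (\<lambda>x. h x * k x) x = pb (C l) (\<lambda>y. h' y * k' y) x"
      by (rule ham_vf_germ[OF Cl smooth_functions_mult[OF h'(1) k'(1)]])
    also have "\<dots> = pb (C l) h' x * k' x + h' x * pb (C l) k' x"
      by (rule derivation_mult[OF derivation_pb[OF Cl] h'(1) k'(1)])
    also have "\<dots> = 0"
      using winv_zero[OF assms(1) l x] winv_zero[OF assms(2) l x]
        ham_vf_germ[OF Cl h'] ham_vf_germ[OF Cl k'] by simp
    finally show ?thesis .
  qed
  ultimately show ?thesis
    unfolding weakly_invariant_def using W(1,2) V(1,2) by (auto intro!: exI[of _ "W \<inter> V"])
qed

lemma winv_power: "winv h \<Longrightarrow> winv (\<lambda>x. h x ^ i)"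
  by (induction i) (simp_all add: winv_const winv_mult)

lemma winv_prod: "(\<And>i. i \<in> I \<Longrightarrow> winv (h i)) \<Longrightarrow> winv (\<lambda>x. \<Prod>i\<in>I. h i x)"
  by (induction I rule: infinite_finite_induct) (simp_all add: winv_const winv_mult)

text \<open>For the factors of the power series that belong to the invariant clocks.\<close>

lemma winv_const_minus_T:
  assumes "i < m"
  shows "winv (\<lambda>x. c - T i x)"
proof -
  have i: "i < n" using assms m_less_n by simp
  have sm: "(\<lambda>x. c - T i x) \<in> smooth_functions \<A>"
    using T_smooth[OF i] by (simp add: smooth_functions_iff smooth_fun_on_diff smooth_fun_on_const)
  have "ham_vf \<A> pb (C l) (\<lambda>x. c - T i x) x = 0" if l: "l \<in> {m..<n}" and x: "x \<in> \<C>" for l x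
  proof -
    have Cl: "C l \<in> smooth_functions \<A>" using C_smooth l by simp
    have "ham_vf \<A> pb (C l) (\<lambda>x. c - T i x) x = pb (C l) (\<lambda>x. c) x - pb (C l) (T i) x"
      using ham_vf_smooth_function[OF Cl sm]
        derivation_diff[OF derivation_pb[OF Cl] smooth_functions_const T_smooth[OF i]] by simp
    also have "\<dots> = 0"
      using bracket_const[of l] l winv_zero[OF T_inv[OF assms] l x]
        ham_vf_smooth_function[OF Cl T_smooth[OF i]] by simp
    finally show ?thesis .
  qed
  then show ?thesis
    using sm by (auto simp: weakly_invariant_def smooth_functions_iff)
qed

text \<open>On \<open>\<C>\<close> the matrix \<open>A\<close> is block triangular with diagonal block \<open>A'\<close>, and so is its inverse.\<close>

lemma bracket_T_zero: "x \<in> \<C> \<Longrightarrow> l \<in> {m..<n} \<Longrightarrow> i < m \<Longrightarrow> pb (C l) (T i) x = 0"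
  using winv_zero[OF T_inv] ham_vf_smooth_function[OF C_smooth T_smooth] m_less_n by simp

text \<open>In the product of the inverse of A with A, the terms with k \<ge> m vanish in the first
  m columns. Rows j \<ge> m are kept, since they show that the lower left block of the inverse is
  zero.\<close>

lemma Ainv_truncate:
  assumes "x \<in> \<C>" "j < n" "l < m"
  shows "(\<Sum>k<m. Ainv x j k * pb (C k) (T l) x) = (if j = l then 1 else 0)"
  using mat_inv_clock_matrix(2)[OF det_nonzero[OF assms(1)] assms(2), of l] assms m_less_n
    sum_lessThan_truncate[of m n "\<lambda>k. Ainv x j k * pb (C k) (T l) x"] bracket_T_zero[of x _ l]
  by simp

text \<open>The upper left m by m block of the inverse of A is a left inverse of A'.\<close>

lemma reduced_det_nonzero:
  assumes x: "x \<in> \<C>"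
  shows "det (clock_matrix pb C T m x) \<noteq> 0"
proof -
  define B where "B = Matrix.mat m m (\<lambda>(j, k). Ainv x j k)"
  have B: "B \<in> carrier_mat m m" by (simp add: B_def)
  have "B * clock_matrix pb C T m x = 1\<^sub>m m"
  proof (rule eq_matI)
    fix j l assume "j < dim_row (1\<^sub>m m :: real mat)" "l < dim_col (1\<^sub>m m :: real mat)"
    then have jl: "j < m" "l < m" by auto
    have "(B * clock_matrix pb C T m x) $$ (j, l) = (\<Sum>k<m. Ainv x j k * pb (C k) (T l) x)"
      unfolding mat_mult_entry[OF B clock_matrix_carrier jl]
      by (rule sum.cong) (use jl in \<open>auto simp: B_def clock_matrix_def\<close>)
    then show "(B * clock_matrix pb C T m x) $$ (j, l) = 1\<^sub>m m $$ (j, l)"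
      using Ainv_truncate[OF x] jl m_less_n by simp
  qed (auto simp: B_def clock_matrix_def)
  then have "det B * det (clock_matrix pb C T m x) = 1"
    using det_mult[OF B clock_matrix_carrier, of pb C T x] by simp
  then show ?thesis by auto
qed

text \<open>Multiply the first m columns of the inverse of A by A' and its inverse, and evaluate the
  first of the two products by \<open>Ainv_truncate\<close>.\<close>

lemma Ainv_reduced:
  assumes x: "x \<in> \<C>" and "j < n" "k < m"
  shows "Ainv x j k = (if j < m then mat_inv (clock_matrix pb C T m x) $$ (j, k) else 0)"
proof -
  let ?B = "\<lambda>i k. mat_inv (clock_matrix pb C T m x) $$ (i, k)"
  have "Ainv x j k = (\<Sum>l<m. Ainv x j l * (\<Sum>i<m. pb (C l) (T i) x * ?B i k))"
    using mat_inv_clock_matrix(1)[OF reduced_det_nonzero[OF x] _ assms(3)] assms(3)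
    by (simp add: sum_if_eq_less)
  also have "\<dots> = (\<Sum>i<m. (if j = i then 1 else 0) * ?B i k)"
    by (simp add: sum_mult_swap Ainv_truncate[OF x assms(2)])
  also have "\<dots> = (if j < m then ?B j k else 0)"
    by (cases "j < m") (auto simp: sum_if_eq_less(2) intro!: sum.neutral)
  finally show ?thesis .
qed

text \<open>The brackets {C_l, h} with l \<ge> m vanish, so only the first m columns of the inverse
  of A contribute; these consist of the inverse of A' above a zero block.\<close>

lemma S_on_surface:
  assumes h: "winv h" and x: "x \<in> \<C>" and j: "j < n"
  shows "S j h x = (if j < m then
    \<Sum>l<m. mat_inv (clock_matrix pb C T m x) $$ (j, l) * ham_vf \<A> pb (C l) h x else 0)"
proof -
  have "S j h x = (\<Sum>l<m. Ainv x j l * ham_vf \<A> pb (C l) h x)"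
    unfolding S_op_def
    by (rule sum_lessThan_truncate) (use m_less_n winv_zero[OF h _ x] in auto)
  also have "\<dots> = (\<Sum>l<m. (if j < m then mat_inv (clock_matrix pb C T m x) $$ (j, l) else 0) *
      ham_vf \<A> pb (C l) h x)"
    using Ainv_reduced[OF x j] by simp
  finally show ?thesis by simp
qed

lemma S_zero_on_surface: "winv h \<Longrightarrow> x \<in> \<C> \<Longrightarrow> j \<in> {m..<n} \<Longrightarrow> S j h x = 0"
  using S_on_surface by simp

text \<open>Apply \<open>{C\<^sub>l, \<cdot>}\<close> to \<open>\<Sum>\<^sub>j A\<^sub>k\<^sub>j S\<^sub>j h = {C\<^sub>k, h}\<close>: by \<open>double_bracket\<close> the terms in which it hits \<open>A\<close> or
  \<open>{C\<^sub>k, h}\<close> cancel, which leaves a homogeneous linear system for \<open>{C\<^sub>l, S\<^sub>j h}\<close>.\<close>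

lemma winv_S:
  assumes h: "winv h" and j: "j < n"
  shows "winv (S j h)"
proof -
  obtain W where W: "open W" "\<C> \<subseteq> W" "smooth_fun_on \<A> W h" by (rule weakly_invariantD[OF h])
  define V where "V = W \<inter> regular_set n"
  have V: "open V" "\<C> \<subseteq> V"
    using W(1,2) open_regular_set[of n] surface_regular by (auto simp: V_def)
  have SV: "smooth_fun_on \<A> V (S i h)" if "i < n" for i
    unfolding V_def by (rule smooth_fun_on_S_op[OF W(1,3) that])
  have "ham_vf \<A> pb (C l) (S j h) x = 0" if l: "l \<in> {m..<n}" and x: "x \<in> \<C>" for l x
  proof -
    have ln: "l < n" using l by simp
    note Cl = C_smooth[OF ln]
    obtain q where q: "q \<in> smooth_functions \<A>" "\<forall>\<^sub>F y in nhds x. q y = h y"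
      by (rule weakly_invariant_germ[OF h x])
    \<comment> \<open>The functions S_i(h) live only near \<open>\<C>\<close>. To take brackets of
      expressions containing them, they are replaced by global functions with the same germ at
      x.\<close>
    have "\<exists>s\<in>smooth_functions \<A>. \<forall>\<^sub>F y in nhds x. s y = S i h y" if i: "i < n" for i
    proof -
      obtain s where "s \<in> smooth_functions \<A>" "\<forall>\<^sub>F y in nhds x. s y = S i h y"
        by (rule smooth_germ_extension[OF V(1) subsetD[OF V(2) x] SV[OF i]])
      then show ?thesis by blast
    qed
    then obtain s where s: "\<And>i. i < n \<Longrightarrow> s i \<in> smooth_functions \<A>"
      "\<And>i. i < n \<Longrightarrow> \<forall>\<^sub>F y in nhds x. s i y = S i h y" by metis
    have sx: "s i x = S i h x" if "i < n" for i using eventually_nhds_x_imp_x[OF s(2)[OF that]] .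
    have AT: "pb (C k) (T i) \<in> smooth_functions \<A>" if "k < n" "i < n" for k i
      by (rule pb_smooth[OF C_smooth[OF that(1)] T_smooth[OF that(2)]])
    have ham: "\<forall>\<^sub>F y in nhds x. ham_vf \<A> pb (C k) h y = pb (C k) q y" if "k < n" for k
    proof -
      \<comment> \<open>Equality of germs at x passes to all nearby points, so {C_k, h} and {C_k, q}
        agree on a neighbourhood and can be bracketed once more.\<close>
      have "\<forall>\<^sub>F y in nhds x. \<forall>\<^sub>F z in nhds y. q z = h z"
        using q(2) by (simp add: eventually_eventually)
      then show ?thesis by eventually_elim (rule ham_vf_germ[OF C_smooth[OF that] q(1)])
    qed
    have inv_q: "\<forall>\<^sub>F y in nhds x. y \<in> \<C> \<longrightarrow> pb (C l) q y = 0"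
      using ham[OF ln] by eventually_elim (use winv_zero[OF h l] in auto)
    have "\<forall>\<^sub>F y in nhds x. \<forall>i\<in>{..<n}. s i y = S i h y"
      by (intro eventually_ball_finite ballI s(2)) auto
    then have ev: "\<forall>\<^sub>F y in nhds x. (\<Sum>i<n. pb (C k) (T i) y * s i y) = pb (C k) q y" if k: "k < n" for k
      using ham[OF k] eventually_nhds_in_open[OF V(1) subsetD[OF V(2) x]]
    proof eventually_elim
      case (elim y)
      then have d: "det (clock_matrix pb C T n y) \<noteq> 0" by (simp add: V_def regular_set_def)
      have "(\<Sum>i<n. pb (C k) (T i) y * s i y) =
          (\<Sum>i<n. pb (C k) (T i) y * (\<Sum>r<n. Ainv y i r * ham_vf \<A> pb (C r) h y))"
        using elim(1) by (simp add: S_op_def)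
      also have "\<dots> = ham_vf \<A> pb (C k) h y"
        using k by (simp add: sum_mult_swap mat_inv_clock_matrix(1)[OF d k] sum_if_eq_less(2))
      finally show ?case using elim(2) by simp
    qed
    have "(\<Sum>i<n. pb (C k) (T i) x * pb (C l) (s i) x) = 0" if k: "k < n" for k
    proof -
      obtain F :: "nat \<Rightarrow> 'a \<Rightarrow> real" where F: "\<And>i. i < n \<Longrightarrow> F i \<in> smooth_functions \<A>"
        "\<And>x. pb (C l) (C k) x = (\<Sum>i<n. F i x * C i x)"
        using bracket_expansion[OF ln k] by blast
      have prd: "(\<lambda>y. pb (C k) (T i) y * s i y) \<in> smooth_functions \<A>" if "i \<in> {..<n}" for i
        by (rule smooth_functions_mult[OF AT[OF k] s(1)]) (use that in auto)
      \<comment> \<open>For i < m weak invariance of \<open>T i\<close> lets the double bracket be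
        rewritten. For i \<ge> m both sides are zero because the factor S_i(h) vanishes at
        x.\<close>
      have hit: "pb (C l) (pb (C k) (T i)) x * s i x = (\<Sum>r<n. F r x * pb (C r) (T i) x) * s i x"
        if i: "i < n" for i
      proof (cases "i < m")
        case True
        have "\<forall>\<^sub>F y in nhds x. y \<in> \<C> \<longrightarrow> pb (C l) (T i) y = 0"
          using bracket_T_zero[OF _ l True] by simp
        from double_bracket[OF x T_smooth[OF i] this ln k F] show ?thesis by simp
      next
        case False
        then show ?thesis using S_zero_on_surface[OF h x, of i] sx[OF i] i by simp
      qed
      have hits: "(\<Sum>i<n. pb (C l) (pb (C k) (T i)) x * s i x) =
          (\<Sum>i<n. (\<Sum>r<n. F r x * pb (C r) (T i) x) * s i x)"
        by (rule sum.cong[OF refl], rule hit) simp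
      \<comment> \<open>{C_l, {C_k, h}} at x is evaluated twice: by \<open>double_bracket\<close>,
        and by differentiating the linear system for the S_i(h) term by term.\<close>
      have "(\<Sum>r<n. F r x * pb (C r) q x) = pb (C l) (pb (C k) q) x"
        by (rule double_bracket[OF x q(1) inv_q ln k F, symmetric])
      also have "\<dots> = pb (C l) (\<lambda>y. \<Sum>i<n. pb (C k) (T i) y * s i y) x"
        by (rule derivation_germ[OF derivation_pb[OF Cl] pb_smooth[OF C_smooth[OF k] q(1)]
              smooth_functions_sum[OF prd]]) (use ev[OF k] in \<open>auto elim: eventually_mono\<close>)
      also have "\<dots> = (\<Sum>i<n. pb (C l) (\<lambda>y. pb (C k) (T i) y * s i y) x)"
        by (rule derivation_sum[OF derivation_pb[OF Cl] prd])
      also have "\<dots> = (\<Sum>i<n. pb (C l) (pb (C k) (T i)) x * s i x + pb (C k) (T i) x * pb (C l) (s i) x)"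
        by (intro sum.cong refl derivation_mult[OF derivation_pb[OF Cl] AT[OF k] s(1)]) auto
      also have "\<dots> = (\<Sum>i<n. (\<Sum>r<n. F r x * pb (C r) (T i) x) * s i x)
          + (\<Sum>i<n. pb (C k) (T i) x * pb (C l) (s i) x)"
        by (simp only: sum.distrib hits)
      \<comment> \<open>By the linear system at x, now used for every row r, this sum is the first
        evaluation again. It cancels and leaves A v = 0 for v_i = {C_l, S_i(h)}.\<close>
      also have "(\<Sum>i<n. (\<Sum>r<n. F r x * pb (C r) (T i) x) * s i x) = (\<Sum>r<n. F r x * pb (C r) q x)"
        unfolding sum_mult_swap[symmetric]
        using eventually_nhds_x_imp_x[OF ev] by simp
      finally show ?thesis by simp
    qed
    from clock_solve[OF x this j] have "pb (C l) (s j) x = 0" .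
    then show ?thesis using ham_vf_germ[OF Cl s(1)[OF j] s(2)[OF j]] by simp
  qed
  then show ?thesis using V SV[OF j] by (auto simp: weakly_invariant_def)
qed

text \<open>At points of \<open>\<C>\<close> h has the same brackets with the constraints as the
  constant 0. This carries a zero produced by one operator through the operators applied after
  it.\<close>

lemma S_vanishing:
  assumes h: "winv h" "\<And>x. x \<in> \<C> \<Longrightarrow> h x = 0" and x: "x \<in> \<C>"
  shows "S j h x = 0"
proof -
  obtain W where W: "open W" "\<C> \<subseteq> W" "smooth_fun_on \<A> W h" by (rule weakly_invariantD[OF h(1)])
  have "ham_vf \<A> pb (C l) h x = 0" if "l < n" for l
    using ham_vf_cong_on_surface[OF x that W(1) subsetD[OF W(2) x] W(3) W(1) subsetD[OF W(2) x]
        smooth_fun_on_const, of 0] h(2) ham_vf_smooth_function[OF C_smooth[OF that] smooth_functions_const, of 0]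
      bracket_const[OF that] by simp
  then show ?thesis by (simp add: S_op_def)
qed

section \<open>Iterates of the operators S_j and their dependence on the clocks\<close>

lemma winv_S_funpow: "winv h \<Longrightarrow> j < n \<Longrightarrow> winv ((S j ^^ i) h)"
  by (induction i) (simp_all add: winv_S)

text \<open>For j \<ge> m each application of S_j to a weakly invariant function gives zero on
  \<open>\<C>\<close>; for j < m the zero of h is inherited.\<close>

lemma S_funpow_zero:
  assumes "winv h" "j < n" "(\<forall>x\<in>\<C>. h x = 0) \<or> (m \<le> j \<and> i > 0)" "x \<in> \<C>"
  shows "(S j ^^ i) h x = 0"
  using assms(3,4)
proof (induction i arbitrary: x)
  case (Suc i)
  show ?case
  proof (cases "m \<le> j")
    case True
    then show ?thesis
      using S_zero_on_surface[OF winv_S_funpow[OF assms(1,2), of i] Suc.prems(2), of j] assms(2) by simp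
  next
    case False
    then have "(S j ^^ i) h y = 0" if "y \<in> \<C>" for y using Suc that by blast
    then show ?thesis using S_vanishing[OF winv_S_funpow[OF assms(1,2)] _ Suc.prems(2)] by simp
  qed
qed auto

text \<open>Arbitrary lists of indices allow induction on the list. \<open>foldr\<close> applies the
  operators from the end of the list, and a zero on \<open>\<C>\<close>, once produced, survives
  those standing in front.\<close>

lemma S_word:
  assumes "winv f" "set js \<subseteq> {..<n}"
  shows "winv (foldr (\<lambda>j. S j ^^ k j) js f)"
    and "\<exists>j\<in>set js. m \<le> j \<and> k j > 0 \<Longrightarrow> x \<in> \<C> \<Longrightarrow> foldr (\<lambda>j. S j ^^ k j) js f x = 0"
proof -
  show "winv (foldr (\<lambda>j. S j ^^ k j) js f)"
    using assms by (induction js) (simp_all add: winv_S_funpow)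
  show "foldr (\<lambda>j. S j ^^ k j) js f x = 0" if "\<exists>j\<in>set js. m \<le> j \<and> k j > 0" "x \<in> \<C>"
    using assms(2) that
  proof (induction js arbitrary: x)
    case (Cons j js)
    have w: "winv (foldr (\<lambda>j. S j ^^ k j) js f)"
      using assms(1) Cons.prems(1) by (induction js) (simp_all add: winv_S_funpow)
    have "(\<forall>x\<in>\<C>. foldr (\<lambda>j. S j ^^ k j) js f x = 0) \<or> (m \<le> j \<and> k j > 0)"
      using Cons by auto
    then show ?case using S_funpow_zero[OF w _ _ Cons.prems(3), of j "k j"] Cons.prems(1) by auto
  qed simp
qed

lemma winv_S_iter: "winv f \<Longrightarrow> winv (S_iter \<A> pb n C T k f)"
  unfolding S_iter_def by (rule S_word) auto

lemma S_iter_zero: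
  "winv f \<Longrightarrow> j \<in> {m..<n} \<Longrightarrow> k j > 0 \<Longrightarrow> x \<in> \<C> \<Longrightarrow> S_iter \<A> pb n C T k f x = 0"
  unfolding S_iter_def by (rule S_word) auto

text \<open>g_j is smooth on \<open>regular_set m\<close>, where A' is invertible, and is compared
  with S_j(f) on \<open>\<C>\<close> alone; its invariance is transferred along that
  equality.\<close>

lemma winv_reduced_derivative:
  assumes f: "winv f" "f \<in> smooth_functions \<A>" and j: "j < m"
  shows "winv (reduced_derivative pb m C T f j)"
    and "x \<in> \<C> \<Longrightarrow> reduced_derivative pb m C T f j x = S j f x"
proof -
  have eq: "reduced_derivative pb m C T f j x = S j f x" if "x \<in> \<C>" for x
    using S_on_surface[OF f(1) that, of j] j m_less_n
      ham_vf_smooth_function[OF C_smooth f(2)] by (simp add: reduced_derivative_def)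
  then show "x \<in> \<C> \<Longrightarrow> reduced_derivative pb m C T f j x = S j f x" .
  have mn: "m \<le> n" using m_less_n by simp
  have "\<C> \<subseteq> regular_set m" using reduced_det_nonzero by (auto simp: regular_set_def)
  moreover have "smooth_fun_on \<A> (regular_set m) (reduced_derivative pb m C T f j)"
    unfolding reduced_derivative_def[abs_def]
    by (intro smooth_fun_on_sum smooth_fun_on_mult open_regular_set[OF mn]
        smooth_fun_on_mat_inv[OF mn j] smooth_functionsD[OF pb_smooth[OF C_smooth f(2)]])
      (use mn in auto)
  ultimately show "winv (reduced_derivative pb m C T f j)"
    using j m_less_n
    by (intro weakly_invariant_cong_on_surface[OF winv_S[OF f(1)] open_regular_set[OF mn] _ _ eq]) auto
qed

text \<open>In \<open>S_on_surface\<close> the clocks enter through A' only. Two arguments h and h'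
  are allowed since, after one application, the functions for the two clock systems may differ off
  \<open>\<C>\<close>.\<close>

lemma S_agree:
  assumes T': "reduced_clocks \<A> pb C n p T' m" "\<And>i. i < m \<Longrightarrow> T' i = T i"
    and h: "winv h" "winv h'" "\<And>x. x \<in> \<C> \<Longrightarrow> h' x = h x" and j: "j < n" and x: "x \<in> \<C>"
  shows "S_op \<A> pb n C T' j h' x = S j h x"
proof -
  interpret T': reduced_clocks \<A> pb C n p T' m by (rule T'(1))
  have "clock_matrix pb C T' m x = clock_matrix pb C T m x"
    unfolding clock_matrix_def by (rule eq_matI) (auto simp: T'(2))
  moreover have "ham_vf \<A> pb (C l) h' x = ham_vf \<A> pb (C l) h x" if "l < m" for l
  proof -
    obtain W where W: "open W" "\<C> \<subseteq> W" "smooth_fun_on \<A> W h" by (rule weakly_invariantD[OF h(1)])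
    obtain V where V: "open V" "\<C> \<subseteq> V" "smooth_fun_on \<A> V h'" by (rule weakly_invariantD[OF h(2)])
    show ?thesis
      by (rule ham_vf_cong_on_surface[OF x _ V(1) subsetD[OF V(2) x] V(3)
            W(1) subsetD[OF W(2) x] W(3) h(3)]) (use that m_less_n in auto)
  qed
  ultimately show ?thesis
    using S_on_surface[OF h(1) x j] T'.S_on_surface[OF h(2) x j] by (auto intro!: sum.cong)
qed

lemma S_iter_agree:
  assumes T': "reduced_clocks \<A> pb C n p T' m" "\<And>i. i < m \<Longrightarrow> T' i = T i" and f: "winv f" and x: "x \<in> \<C>"
  shows "S_iter \<A> pb n C T' k f x = S_iter \<A> pb n C T k f x"
proof -
  interpret T': reduced_clocks \<A> pb C n p T' m by (rule T'(1))
  have pow: "(S_op \<A> pb n C T' j ^^ i) h' x = (S j ^^ i) h x"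
    if "winv h" "winv h'" "\<And>x. x \<in> \<C> \<Longrightarrow> h' x = h x" "j < n" "x \<in> \<C>" for i j h h' x
    using that(5)
  proof (induction i arbitrary: x)
    case (Suc i)
    then show ?case
      using S_agree[OF T' winv_S_funpow[OF that(1,4)] T'.winv_S_funpow[OF that(2,4)] _ that(4)]
      by simp
  qed (use that in simp)
  have "foldr (\<lambda>j. S_op \<A> pb n C T' j ^^ k j) js f x = foldr (\<lambda>j. S j ^^ k j) js f x"
    if "set js \<subseteq> {..<n}" for js
    using that x
  proof (induction js arbitrary: x)
    case (Cons j js)
    have js: "set js \<subseteq> {..<n}" "j < n" using Cons.prems(1) by auto
    show ?case
      using pow[OF S_word(1)[OF f js(1)] T'.S_word(1)[OF f js(1)] Cons.IH[OF js(1)] js(2) Cons.prems(2)]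
      by simp
  qed simp
  from this[of "[0..<n]"] show ?thesis by (simp add: S_iter_def atLeast0LessThan)
qed

end

section \<open>Orbits through the constraint surface and the composed flow map\<close>

section \<open>Gauge orbits\<close>

context constrained_system
begin

text \<open>Along an integral curve of \<open>C i\<close> the functions \<open>C k\<close> satisfy a
  homogeneous linear system with the structure functions as coefficients, so their zero initial
  values persist.\<close>

lemma flow_related_surface:
  assumes i: "i < n" and uv: "flow_related \<A> pb (C i) u v" and u: "u \<in> \<C>"
  shows "v \<in> \<C>"
proof -
  obtain \<gamma> I t where \<gamma>: "integral_curve \<A> pb (C i) \<gamma> I" "0 \<in> I" "t \<in> I" "\<gamma> 0 = u" "\<gamma> t = v"
    using uv unfolding flow_related_def by blast
  have "\<exists>F. (\<forall>l<n. F l \<in> smooth_functions \<A>) \<and> (\<forall>x. pb (C i) (C k) x = (\<Sum>l<n. F l x * C l x))"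
    if k: "k < n" for k
  proof -
    obtain F :: "nat \<Rightarrow> 'a \<Rightarrow> real" where "\<And>l. l < n \<Longrightarrow> F l \<in> smooth_functions \<A>"
      "\<And>x. pb (C i) (C k) x = (\<Sum>l<n. F l x * C l x)"
      using bracket_expansion[OF i k] by blast
    then show ?thesis by blast
  qed
  then obtain F where F: "\<And>k l. k < n \<Longrightarrow> l < n \<Longrightarrow> F k l \<in> smooth_functions \<A>"
    "\<And>k x. k < n \<Longrightarrow> pb (C i) (C k) x = (\<Sum>l<n. F k l x * C l x)" by metis
  have "C k (\<gamma> t) = 0" if k: "k < n" for k
  proof (rule linear_ode_zero[where u="\<lambda>k s. C k (\<gamma> s)" and a="\<lambda>k l s. F k l (\<gamma> s)" and n=n and I=I])
    show "is_interval I" using \<gamma>(1) by (simp add: integral_curve_def)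
    fix k s assume "k < n" "s \<in> I"
    then have "((\<lambda>s. C k (\<gamma> s)) has_real_derivative pb (C i) (C k) (\<gamma> s)) (at s)"
      using \<gamma>(1) C_smooth by (simp add: integral_curve_def)
    then show "((\<lambda>s. C k (\<gamma> s)) has_real_derivative (\<Sum>l<n. F k l (\<gamma> s) * C l (\<gamma> s))) (at s)"
      using F(2)[OF \<open>k < n\<close>] by simp
  next
    fix k l assume "k < n" "l < n"
    have "continuous_on UNIV (F k l)"
      by (rule smooth_fun_on_continuous_on[OF open_UNIV smooth_functionsD[OF F(1)]]) fact+
    then show "continuous_on I (\<lambda>s. F k l (\<gamma> s))"
      using \<gamma>(1) by (auto intro: continuous_on_compose2 simp: integral_curve_def)
  next
    fix k assume "k < n"
    then show "C k (\<gamma> 0) = 0" using u \<gamma>(4) by (simp add: constraint_surface_def)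
  qed (fact \<gamma>(2,3) k)+
  then show ?thesis using \<gamma>(5) by (simp add: constraint_surface_def)
qed

lemma gauge_orbit_surface:
  assumes "x \<in> \<C>" "y \<in> gauge_orbit \<A> pb n C x"
  shows "y \<in> \<C>"
proof -
  have "(\<lambda>u v. \<exists>i<n. flow_related \<A> pb (C i) u v)\<^sup>*\<^sup>* x y"
    using assms(2) by (simp add: gauge_orbit_def)
  then show ?thesis
    by (induction rule: rtranclp_induct) (use assms(1) flow_related_surface in auto)
qed

text \<open>The flows of all constraints are built in one chart with common constants. The
  components of the vector field of \<open>C i\<close> are its brackets with global extensions of
  the chart coordinates.\<close>

lemma chart_flows:
  assumes c: "(U, \<phi>) \<in> \<A>" "y \<in> U"
  obtains r \<delta> B :: real and fl :: "nat \<Rightarrow> real \<Rightarrow> 'b \<Rightarrow> 'b"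
  where "r > 0" "\<delta> > 0" "B > 0" "cball (\<phi> y) r \<subseteq> \<phi> ` U"
    and "\<And>i. i < n \<Longrightarrow> continuous_on UNIV (\<lambda>(t, z). fl i t z)"
    and "\<And>i z. i < n \<Longrightarrow> fl i 0 z = z"
    and "\<And>i t z. i < n \<Longrightarrow> \<bar>t\<bar> < \<delta> \<Longrightarrow> norm (fl i t z - z) \<le> B * \<bar>t\<bar>"
    and "\<And>i t z h. i < n \<Longrightarrow> \<bar>t\<bar> < \<delta> \<Longrightarrow> fl i t z \<in> cball (\<phi> y) r \<Longrightarrow> h \<in> smooth_functions \<A> \<Longrightarrow>
      ((\<lambda>s. h (inv_into U \<phi> (fl i s z))) has_real_derivative
        pb (C i) h (inv_into U \<phi> (fl i t z))) (at t)"
proof -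
  note ch = is_chartD[OF chart[OF c(1)]]
  obtain \<xi> :: "'b \<Rightarrow> 'a \<Rightarrow> real" where \<xi>: "\<And>b. \<xi> b \<in> smooth_functions \<A>"
    "\<And>b. \<forall>\<^sub>F u in nhds y. \<xi> b u = \<phi> u \<bullet> b"
    using coordinate_functions[OF c] by blast
  have "\<forall>\<^sub>F u in nhds y. \<forall>b\<in>Basis. \<xi> b u = \<phi> u \<bullet> b"
    by (intro eventually_ball_finite ballI \<xi>(2)) auto
  then obtain V where V: "open V" "y \<in> V" "\<And>u b. u \<in> V \<Longrightarrow> b \<in> Basis \<Longrightarrow> \<xi> b u = \<phi> u \<bullet> b"
    by (auto simp: eventually_nhds)
  \<comment> \<open>On this part of the chart the extensions agree with the coordinates, so the
    brackets give the components of the field at every point and not only at y.\<close>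
  define S where "S = \<phi> ` (U \<inter> V)"
  have "open S" unfolding S_def by (rule chart_open_image[OF chart[OF c(1)] V(1)])
  moreover have "\<phi> y \<in> S" using c(2) V(2) by (auto simp: S_def)
  ultimately obtain r where r: "r > 0" "cball (\<phi> y) r \<subseteq> S" by (meson open_contains_cball)
  define X where "X i z = (\<Sum>b\<in>Basis. pb (C i) (\<xi> b) (inv_into U \<phi> z) *\<^sub>R b)" for i z
  have X: "smooth_on S (X i)" if i: "i < n" for i
  proof -
    have "smooth_on S (\<lambda>z. pb (C i) (\<xi> b) (inv_into U \<phi> z))" for b
      unfolding S_def by (rule smooth_fun_onD[OF smooth_functionsD[OF pb_smooth[OF C_smooth[OF i] \<xi>(1)]] c(1)])
    then have "smooth_on S (\<lambda>z. pb (C i) (\<xi> b) (inv_into U \<phi> z) *\<^sub>R b)" for b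
      by (rule smooth_on_bilinear[OF \<open>open S\<close> bounded_bilinear_scaleR _ smooth_on_const])
    then show ?thesis
      unfolding X_def[abs_def] smooth_on_def by (auto intro!: times_differentiable_on_sum[OF \<open>open S\<close>])
  qed
  \<comment> \<open>The data are bundled into one tuple per index so that a single choice supplies
    them for all i.\<close>
  define Q where "Q i w \<longleftrightarrow> (case w of (\<delta>, B, fl) \<Rightarrow> \<delta> > 0 \<and> B > 0 \<and>
    continuous_on UNIV (\<lambda>(t, z). fl t z) \<and> (\<forall>z. fl 0 z = z) \<and>
    (\<forall>t z. \<bar>t\<bar> < \<delta> \<longrightarrow> norm (fl t z - z) \<le> B * \<bar>t\<bar>) \<and>
    (\<forall>t z. \<bar>t\<bar> < \<delta> \<longrightarrow> fl t z \<in> cball (\<phi> y) r \<longrightarrow>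
      ((\<lambda>s. fl s z) has_vector_derivative X i (fl t z)) (at t)))"
    for i and w :: "real \<times> real \<times> (real \<Rightarrow> 'b \<Rightarrow> 'b)"
  have "\<forall>i. \<exists>w. i < n \<longrightarrow> Q i w"
  proof
    fix i
    show "\<exists>w. i < n \<longrightarrow> Q i w"
    proof (cases "i < n")
      case True
      show ?thesis
      proof (rule local_flow[OF r X[OF True]])
        fix \<delta> B :: real and fl :: "real \<Rightarrow> 'b \<Rightarrow> 'b"
        assume "\<delta> > 0" "B > 0" "continuous_on UNIV (\<lambda>(t, z). fl t z)" "\<And>z. fl 0 z = z"
          "\<And>t z. \<bar>t\<bar> < \<delta> \<Longrightarrow> norm (fl t z - z) \<le> B * \<bar>t\<bar>"
          "\<And>t z. \<bar>t\<bar> < \<delta> \<Longrightarrow> fl t z \<in> cball (\<phi> y) r \<Longrightarrow>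
            ((\<lambda>s. fl s z) has_vector_derivative X i (fl t z)) (at t)"
        then have "Q i (\<delta>, B, fl)" by (simp add: Q_def)
        then show ?thesis by blast
      qed
    qed simp
  qed
  then have "\<exists>w. \<forall>i. i < n \<longrightarrow> Q i (w i)" by (rule choice)
  then obtain w where w: "\<And>i. i < n \<Longrightarrow> Q i (w i)" by blast
  define \<delta>' where "\<delta>' i = fst (w i)" for i
  define B' where "B' i = fst (snd (w i))" for i
  define fl where "fl i = snd (snd (w i))" for i
  have Qi: "Q i (\<delta>' i, B' i, fl i)" if "i < n" for i
    using w[OF that] by (simp add: \<delta>'_def B'_def fl_def)
  have fl: "\<And>i. i < n \<Longrightarrow> \<delta>' i > 0" "\<And>i. i < n \<Longrightarrow> B' i > 0"
    "\<And>i. i < n \<Longrightarrow> continuous_on UNIV (\<lambda>(t, z). fl i t z)" "\<And>i z. i < n \<Longrightarrow> fl i 0 z = z"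
    "\<And>i t z. i < n \<Longrightarrow> \<bar>t\<bar> < \<delta>' i \<Longrightarrow> norm (fl i t z - z) \<le> B' i * \<bar>t\<bar>"
    "\<And>i t z. i < n \<Longrightarrow> \<bar>t\<bar> < \<delta>' i \<Longrightarrow> fl i t z \<in> cball (\<phi> y) r \<Longrightarrow>
      ((\<lambda>s. fl i s z) has_vector_derivative X i (fl i t z)) (at t)"
    using Qi[unfolded Q_def] by simp_all
  \<comment> \<open>The element 1 keeps the set nonempty when n = 0.\<close>
  define \<delta> where "\<delta> = Min (insert 1 (\<delta>' ` {..<n}))"
  define B where "B = 1 + (\<Sum>i<n. B' i)"
  have \<delta>: "\<delta> > 0" "\<And>i. i < n \<Longrightarrow> \<delta> \<le> \<delta>' i" using fl(1) by (auto simp: \<delta>_def)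
  have "(\<Sum>i<n. B' i) \<ge> 0" by (rule sum_nonneg) (use fl(2) in fastforce)
  then have "B > 0" by (simp add: B_def)
  have B: "B' i \<le> B" if i: "i < n" for i
  proof -
    have "B' i \<le> (\<Sum>i<n. B' i)"
      by (rule member_le_sum) (use i less_imp_le[OF fl(2)] in auto)
    then show ?thesis by (simp add: B_def)
  qed
  show ?thesis
  proof (rule that[OF r(1) \<delta>(1) \<open>B > 0\<close> _ fl(3,4)])
    show "cball (\<phi> y) r \<subseteq> \<phi> ` U" using r(2) by (auto simp: S_def)
    show "norm (fl i t z - z) \<le> B * \<bar>t\<bar>" if i: "i < n" and t: "\<bar>t\<bar> < \<delta>" for i t z
    proof -
      have "norm (fl i t z - z) \<le> B' i * \<bar>t\<bar>" by (rule fl(5)) (use i t \<delta>(2)[OF i] in auto)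
      also have "\<dots> \<le> B * \<bar>t\<bar>" using B[OF i] by (intro mult_right_mono) auto
      finally show ?thesis .
    qed
    fix i t z h assume i: "i < n" and t: "\<bar>t\<bar> < \<delta>" and z: "fl i t z \<in> cball (\<phi> y) r"
      and h: "h \<in> smooth_functions \<A>"
    let ?h = "\<lambda>z. h (inv_into U \<phi> z)" and ?z = "fl i t z"
    let ?D = "frechet_derivative ?h (at ?z)"
    have "?z \<in> S" using z r(2) by auto
    then obtain u where u: "u \<in> U" "u \<in> V" "?z = \<phi> u" by (auto simp: S_def)
    have invz: "inv_into U \<phi> ?z = u" using u ch(5) by simp
    have d: "(?h has_derivative ?D) (at ?z)"
      by (rule smooth_functions_has_derivative[OF h c(1)]) (use u in auto)
    have "((\<lambda>s. fl i s z) has_vector_derivative X i ?z) (at t)"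
      by (rule fl(6)[OF i _ z]) (use t \<delta>(2)[OF i] in auto)
    then have "((\<lambda>s. ?h (fl i s z)) has_derivative (\<lambda>s. ?D (s *\<^sub>R X i ?z))) (at t)"
      unfolding has_vector_derivative_def by (rule has_derivative_compose[where f="\<lambda>s. fl i s z" and g="?h", OF _ d])
    moreover have "?D (s *\<^sub>R X i ?z) = pb (C i) h u * s" for s
    proof -
      interpret bounded_linear ?D using d by (rule has_derivative_bounded_linear)
      have "pb (C i) h u = frechet_derivative ?h (at (\<phi> u)) (\<Sum>b\<in>Basis. pb (C i) (\<xi> b) u *\<^sub>R b)"
        by (rule derivation_eq_differential[OF derivation_pb[OF C_smooth[OF i]] c(1) u(1) h \<xi>(1)])
          (use eventually_nhds_in_open[OF V(1) u(2)] V(3) in \<open>auto elim: eventually_mono\<close>)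
      then have "pb (C i) h u = ?D (X i ?z)" using u(3) invz by (simp add: X_def)
      then show ?thesis by (simp add: scaleR)
    qed
    ultimately show "((\<lambda>s. ?h (fl i s z)) has_real_derivative pb (C i) h (inv_into U \<phi> ?z)) (at t)"
      by (simp add: has_field_derivative_def invz)
  qed
qed

text \<open>The flows are only known to depend continuously on initial values, so \<open>\<Gamma>\<close> is differentiable
  at \<open>0\<close> but perhaps nowhere else.\<close>

lemma composed_flows:
  fixes e :: "nat \<Rightarrow> 'b"
  assumes e: "\<And>i. i < n \<Longrightarrow> e i \<in> Basis"
  obtains \<epsilon> :: real and \<Gamma> :: "'b \<Rightarrow> 'a" where "\<epsilon> > 0" "\<Gamma> 0 = y"
    and "\<And>t. t \<in> ball 0 \<epsilon> \<Longrightarrow> (\<lambda>u v. \<exists>i<n. flow_related \<A> pb (C i) u v)\<^sup>*\<^sup>* y (\<Gamma> t)"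
    and "continuous_on (ball 0 \<epsilon>) \<Gamma>"
    and "\<And>h. h \<in> smooth_functions \<A> \<Longrightarrow>
      ((\<lambda>t. h (\<Gamma> t)) has_derivative (\<lambda>t. \<Sum>i<n. (t \<bullet> e i) * pb (C i) h y)) (at 0)"
proof -
  obtain U \<phi> where c: "(U, \<phi>) \<in> \<A>" "y \<in> U" by (rule chart_at)
  note ch = is_chartD[OF chart[OF c(1)]]
  obtain r \<delta> B :: real and fl :: "nat \<Rightarrow> real \<Rightarrow> 'b \<Rightarrow> 'b"
    where r: "r > 0" and \<delta>: "\<delta> > 0" and B: "B > 0" and cb: "cball (\<phi> y) r \<subseteq> \<phi> ` U"
      and fl_cont: "\<And>i. i < n \<Longrightarrow> continuous_on UNIV (\<lambda>(t, z). fl i t z)"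
      and fl0: "\<And>i z. i < n \<Longrightarrow> fl i 0 z = z"
      and fl_bd: "\<And>i t z. i < n \<Longrightarrow> \<bar>t\<bar> < \<delta> \<Longrightarrow> norm (fl i t z - z) \<le> B * \<bar>t\<bar>"
      and fl_der: "\<And>i t z h. i < n \<Longrightarrow> \<bar>t\<bar> < \<delta> \<Longrightarrow> fl i t z \<in> cball (\<phi> y) r \<Longrightarrow> h \<in> smooth_functions \<A> \<Longrightarrow>
      ((\<lambda>s. h (inv_into U \<phi> (fl i s z))) has_real_derivative
        pb (C i) h (inv_into U \<phi> (fl i t z))) (at t)"
    using chart_flows[OF c] by blast
  let ?inv = "inv_into U \<phi>"
  \<comment> \<open>Flow k runs for the time given by coordinate k of t, starting where the earlier
    flows end.\<close>
  define \<Phi> where "\<Phi> = rec_nat (\<lambda>t. \<phi> y) (\<lambda>k G t. fl k (t \<bullet> e k) (G t))"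
  have \<Phi>0: "\<Phi> 0 t = \<phi> y" and \<Phi>S: "\<Phi> (Suc k) t = fl k (t \<bullet> e k) (\<Phi> k t)" for k t
    by (simp_all add: \<Phi>_def)
  \<comment> \<open>Each flow moves a point by at most B times the elapsed time, so up to n + 1
    pieces of duration below \<epsilon> stay within distance r of \<phi>(y).\<close>
  define \<epsilon> where "\<epsilon> = min \<delta> (r / (B * (real n + 1)))"
  have \<epsilon>: "\<epsilon> > 0" "\<epsilon> \<le> \<delta>" using \<delta> r B by (auto simp: \<epsilon>_def)
  have nz: "B * (real n + 1) \<noteq> 0" using B by (simp add: add_nonneg_eq_0_iff)
  have \<epsilon>r: "B * (real n + 1) * \<epsilon> \<le> r"
  proof -
    have "B * (real n + 1) * \<epsilon> \<le> B * (real n + 1) * (r / (B * (real n + 1)))"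
      using B by (intro mult_left_mono) (auto simp: \<epsilon>_def)
    also have "\<dots> = r" by (simp only: times_divide_eq_right nonzero_mult_div_cancel_left[OF nz])
    finally show ?thesis .
  qed
  have te: "\<bar>t \<bullet> e k\<bar> \<le> norm t" if "k < n" for t k by (rule Basis_le_norm[OF e[OF that]])
  have bd: "norm (\<Phi> k t - \<phi> y) \<le> B * real k * norm t" if "k \<le> n" "norm t < \<epsilon>" for k t
    using that(1)
  proof (induction k)
    case (Suc k)
    then have k: "k < n" by simp
    have "norm (\<Phi> (Suc k) t - \<Phi> k t) \<le> B * \<bar>t \<bullet> e k\<bar>"
      unfolding \<Phi>S by (rule fl_bd[OF k]) (use te[OF k, of t] that(2) \<epsilon>(2) in linarith)
    also have "\<dots> \<le> B * norm t" using te[OF k] B by (intro mult_left_mono) auto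
    finally have "norm (\<Phi> (Suc k) t - \<phi> y) \<le> B * norm t + B * real k * norm t"
      using Suc norm_triangle_ineq[of "\<Phi> (Suc k) t - \<Phi> k t" "\<Phi> k t - \<phi> y"] by simp
    then show ?case by (simp add: algebra_simps)
  qed (simp add: \<Phi>0)
  \<comment> \<open>The bound \<eta> is left free: \<eta> = \<epsilon> gives confinement to the
    ball, \<eta> = |t| the smallness in the derivative estimate.\<close>
  have step: "norm (fl k s (\<Phi> k t) - \<phi> y) \<le> B * (real n + 1) * \<eta>"
    if k: "k < n" and s: "\<bar>s\<bar> \<le> \<eta>" "\<bar>s\<bar> < \<epsilon>" and t: "norm t \<le> \<eta>" "norm t < \<epsilon>" for k s t \<eta>
  proof -
    have \<eta>: "\<eta> \<ge> 0" using s(1) by linarith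
    have "norm (fl k s (\<Phi> k t) - \<Phi> k t) \<le> B * \<bar>s\<bar>" by (rule fl_bd[OF k]) (use s(2) \<epsilon>(2) in linarith)
    also have "\<dots> \<le> B * \<eta>" using s(1) B by (intro mult_left_mono) auto
    finally have 1: "norm (fl k s (\<Phi> k t) - \<Phi> k t) \<le> B * \<eta>" .
    have "norm (\<Phi> k t - \<phi> y) \<le> B * real k * norm t" by (rule bd) (use k t(2) in auto)
    also have "\<dots> \<le> B * real n * \<eta>" using k t(1) B \<eta> by (intro mult_mono) auto
    finally have 2: "norm (\<Phi> k t - \<phi> y) \<le> B * real n * \<eta>" .
    have "norm (fl k s (\<Phi> k t) - \<phi> y) \<le> B * \<eta> + B * real n * \<eta>"
      using 1 2 norm_triangle_ineq[of "fl k s (\<Phi> k t) - \<Phi> k t" "\<Phi> k t - \<phi> y"] by simp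
    then show ?thesis by (simp add: algebra_simps)
  qed
  have flball: "fl k s (\<Phi> k t) \<in> cball (\<phi> y) r" if "k < n" "\<bar>s\<bar> < \<epsilon>" "norm t < \<epsilon>" for k s t
    using step[of k s \<epsilon> t] that \<epsilon>r by (simp add: dist_norm norm_minus_commute)
  have cont\<Phi>: "continuous_on UNIV (\<Phi> k)" if "k \<le> n" for k
    using that
  proof (induction k)
    case 0
    then show ?case using \<Phi>0 by (simp add: continuous_on_const[of UNIV "\<phi> y"] fun_eq_iff cong: continuous_on_cong)
  next
    case (Suc k)
    then have "continuous_on UNIV (\<lambda>t. (\<lambda>(t, z). fl k t z) (t \<bullet> e k, \<Phi> k t))"
      by (intro continuous_on_compose2[OF fl_cont] continuous_intros) auto
    then show ?case by (simp add: \<Phi>S cong: continuous_on_cong)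
  qed
  have inb: "\<Phi> k t \<in> cball (\<phi> y) r" if "k \<le> n" "norm t < \<epsilon>" for k t
  proof (cases k)
    case 0
    then show ?thesis using r by (simp add: \<Phi>0)
  next
    case (Suc j)
    then show ?thesis using flball[of j "t \<bullet> e j" t] te[of j t] that by (simp add: \<Phi>S)
  qed
  have orbit: "(\<lambda>u v. \<exists>i<n. flow_related \<A> pb (C i) u v)\<^sup>*\<^sup>* y (?inv (\<Phi> k t))"
    if "k \<le> n" "norm t < \<epsilon>" for k t
    using that(1)
  proof (induction k)
    case 0
    then show ?case using ch(5)[OF c(2)] by (simp add: \<Phi>0)
  next
    case (Suc k)
    then have k: "k < n" by simp
    have "integral_curve \<A> pb (C k) (\<lambda>s. ?inv (fl k s (\<Phi> k t))) {-\<epsilon><..<\<epsilon>}"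
      unfolding integral_curve_def
    proof (intro conjI ballI)
      have "continuous_on {-\<epsilon><..<\<epsilon>} (\<lambda>s. (\<lambda>(t, z). fl k t z) (s, \<Phi> k t))"
        by (intro continuous_on_compose2[OF fl_cont[OF k]] continuous_intros) auto
      then have "continuous_on {-\<epsilon><..<\<epsilon>} (\<lambda>s. fl k s (\<Phi> k t))" by simp
      then show "continuous_on {-\<epsilon><..<\<epsilon>} (\<lambda>s. ?inv (fl k s (\<Phi> k t)))"
        by (rule continuous_on_compose2[OF ch(4)]) (use flball[OF k] that(2) cb in fastforce)
      fix h s assume "h \<in> smooth_functions \<A>" "s \<in> {-\<epsilon><..<\<epsilon>}"
      then show "((\<lambda>s. h (?inv (fl k s (\<Phi> k t)))) has_real_derivative
          pb (C k) h (?inv (fl k s (\<Phi> k t)))) (at s)"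
        using \<epsilon>(2) by (intro fl_der[OF k] flball[OF k] that(2)) auto
    qed (auto simp: is_interval_oo)
    moreover have "t \<bullet> e k \<in> {-\<epsilon><..<\<epsilon>}" using te[OF k, of t] that(2) by auto
    ultimately have "flow_related \<A> pb (C k) (?inv (\<Phi> k t)) (?inv (\<Phi> (Suc k) t))"
      unfolding flow_related_def using \<epsilon>(1)
      by (intro exI[of _ "\<lambda>s. ?inv (fl k s (\<Phi> k t))"] exI[of _ "{-\<epsilon><..<\<epsilon>}"] exI[of _ "t \<bullet> e k"])
        (auto simp: fl0[OF k] \<Phi>S)
    then have "\<exists>i<n. flow_related \<A> pb (C i) (?inv (\<Phi> k t)) (?inv (\<Phi> (Suc k) t))" using k by blast
    then show ?case by (rule rtranclp.rtrancl_into_rtrancl[OF Suc.IH[OF Suc_leD[OF Suc.prems]]])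
  qed
  have der: "((\<lambda>t. h (?inv (\<Phi> k t))) has_derivative (\<lambda>t. \<Sum>i<k. (t \<bullet> e i) * pb (C i) h y)) (at 0)"
    if h: "h \<in> smooth_functions \<A>" and "k \<le> n" for h k
    using that(2)
  proof (induction k)
    case 0
    then show ?case by (simp add: \<Phi>0)
  next
    case (Suc k)
    then have k: "k < n" by simp
    define q where "q = pb (C k) h"
    \<comment> \<open>The increment contributed by flow k. Its starting point varies with t in a
      merely continuous way, so the estimate has to be uniform in the starting point.\<close>
    define R where "R t = h (?inv (\<Phi> (Suc k) t)) - h (?inv (\<Phi> k t))" for t
    have qc: "isCont (\<lambda>z. q (?inv z)) (\<phi> y)"
      using smooth_functions_has_derivative[OF pb_smooth[OF C_smooth[OF k] h] c(1) imageI[OF c(2)]]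
      unfolding q_def by (rule has_derivative_continuous)
    have R0: "R 0 = 0" by (simp add: R_def \<Phi>S fl0[OF k])
    have "(R has_derivative (\<lambda>t. (t \<bullet> e k) * q y)) (at 0)"
      unfolding has_derivative_at_alt
    proof (intro conjI allI impI)
      show "bounded_linear (\<lambda>t. (t \<bullet> e k) * q y)"
        by (intro bounded_linear_mult_const bounded_linear_inner_left)
      fix \<eta> :: real assume \<eta>: "\<eta> > 0"
      obtain d where d: "d > 0" "\<And>z. dist z (\<phi> y) < d \<Longrightarrow> dist (q (?inv z)) (q (?inv (\<phi> y))) < \<eta>"
        using qc \<eta> unfolding continuous_at_eps_delta by blast
      define d' where "d' = min \<epsilon> (d / (B * (real n + 1)))"
      have d': "d' > 0" "d' \<le> \<epsilon>" "B * (real n + 1) * d' \<le> d"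
      proof -
        show "d' > 0" "d' \<le> \<epsilon>" using d(1) \<epsilon>(1) B by (auto simp: d'_def)
        have "B * (real n + 1) * d' \<le> B * (real n + 1) * (d / (B * (real n + 1)))"
          using B by (intro mult_left_mono) (auto simp: d'_def)
        also have "\<dots> = d" by (simp only: times_divide_eq_right nonzero_mult_div_cancel_left[OF nz])
        finally show "B * (real n + 1) * d' \<le> d" .
      qed
      show "\<exists>d>0. \<forall>t. norm (t - 0) < d \<longrightarrow> norm (R t - R 0 - ((t - 0) \<bullet> e k) * q y) \<le> \<eta> * norm (t - 0)"
      proof (intro exI[of _ d'] conjI allI impI d'(1))
        fix t :: 'b assume "norm (t - 0) < d'"
        then have t: "norm t < d'" "norm t < \<epsilon>" using d'(2) by auto
        \<comment> \<open>Mean value inequality in the flow time s with t fixed: the derivative of G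
          compares q at a point close to y with q(y), and is small by continuity of q.\<close>
        define G where "G s = h (?inv (fl k s (\<Phi> k t))) - s * q y" for s
        have "norm (G (t \<bullet> e k) - G 0) \<le> \<eta> * norm (t \<bullet> e k - 0)"
        proof (rule differentiable_bound[where S="cball 0 (norm t)"
              and f'="\<lambda>s w. (q (?inv (fl k s (\<Phi> k t))) - q y) * w"])
          show "convex (cball 0 (norm t) :: real set)" by (rule convex_cball)
          show "t \<bullet> e k \<in> cball 0 (norm t)" using te[OF k] by simp
          show "0 \<in> cball 0 (norm t)" by simp
          fix s :: real assume "s \<in> cball 0 (norm t)"
          then have s: "\<bar>s\<bar> \<le> norm t" by simp
          have "((\<lambda>s. h (?inv (fl k s (\<Phi> k t)))) has_real_derivative q (?inv (fl k s (\<Phi> k t)))) (at s)"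
            unfolding q_def by (intro fl_der[OF k] flball[OF k] t(2) h) (use s t(2) \<epsilon>(2) in linarith)+
          then have "(G has_real_derivative q (?inv (fl k s (\<Phi> k t))) - q y) (at s)"
            unfolding G_def by (auto intro!: derivative_eq_intros)
          then show "(G has_derivative (\<lambda>w. (q (?inv (fl k s (\<Phi> k t))) - q y) * w))
              (at s within cball 0 (norm t))"
            unfolding has_field_derivative_def by (rule has_derivative_at_withinI)
          have "norm (fl k s (\<Phi> k t) - \<phi> y) \<le> B * (real n + 1) * norm t"
            by (rule step[OF k s _ order_refl t(2)]) (use s t(2) in linarith)
          also have "\<dots> < B * (real n + 1) * d'" using B t(1) by (intro mult_strict_left_mono) auto
          finally have "dist (fl k s (\<Phi> k t)) (\<phi> y) < d" using d'(3) by (simp add: dist_norm)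
          from d(2)[OF this] have "\<bar>q (?inv (fl k s (\<Phi> k t))) - q y\<bar> \<le> \<eta>"
            using ch(5)[OF c(2)] by (simp add: dist_real_def)
          then show "onorm (\<lambda>w. (q (?inv (fl k s (\<Phi> k t))) - q y) * w) \<le> \<eta>"
            by (intro onorm_le) (auto simp: abs_mult intro: mult_right_mono)
        qed
        also have "\<dots> \<le> \<eta> * norm t" using te[OF k, of t] \<eta> by simp
        also have "G (t \<bullet> e k) - G 0 = R t - (t \<bullet> e k) * q y"
          by (simp add: G_def R_def \<Phi>S fl0[OF k])
        finally show "norm (R t - R 0 - ((t - 0) \<bullet> e k) * q y) \<le> \<eta> * norm (t - 0)"
          by (simp add: R0)
      qed
    qed
    from has_derivative_add[OF Suc.IH[OF Suc_leD[OF Suc.prems]] this]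
    show ?case by (simp add: R_def q_def)
  qed
  show ?thesis
  proof (rule that[of \<epsilon> "\<lambda>t. ?inv (\<Phi> n t)"])
    have "\<Phi> k 0 = \<phi> y" if "k \<le> n" for k
      using that by (induction k) (simp_all add: \<Phi>0 \<Phi>S fl0)
    then show "?inv (\<Phi> n 0) = y" using ch(5)[OF c(2)] by simp
    show "continuous_on (ball 0 \<epsilon>) (\<lambda>t. ?inv (\<Phi> n t))"
      by (rule continuous_on_compose2[OF ch(4) continuous_on_subset[OF cont\<Phi>[OF order_refl]]])
        (use inb[OF order_refl] cb in \<open>auto simp: dist_norm\<close>)
  qed (use \<epsilon>(1) orbit[OF order_refl] der[OF _ order_refl] in \<open>auto simp: dist_norm\<close>)
qed

end

section \<open>Padding to the model space and differentiation in the clock values\<close>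

section \<open>Partial derivatives of complete observables\<close>

locale basis_enumeration =
  fixes e :: "nat \<Rightarrow> 'b::euclidean_space" and N :: nat
  assumes e: "bij_betw e {..<N} Basis"
begin

lemma e_Basis: "i < N \<Longrightarrow> e i \<in> Basis"
  using e by (auto simp: bij_betw_def)

lemma inner_e: "i < N \<Longrightarrow> j < N \<Longrightarrow> e i \<bullet> e j = (if i = j then 1 else 0)"
  using e inner_Basis[OF e_Basis e_Basis, of i j] by (auto simp: bij_betw_def inj_on_def)

lemma e_eqI:
  assumes "\<And>i. i < N \<Longrightarrow> u \<bullet> e i = v \<bullet> e i"
  shows "u = v"
proof (rule euclidean_eqI)
  fix b :: 'b assume "b \<in> Basis"
  then obtain i where "i < N" "b = e i" using e by (auto simp: bij_betw_def)
  then show "u \<bullet> b = v \<bullet> b" using assms by simp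
qed

definition from_coords :: "(nat \<Rightarrow> real) \<Rightarrow> 'b" where
  "from_coords a = (\<Sum>i<N. a i *\<^sub>R e i)"

lemma from_coords_inner: "i < N \<Longrightarrow> from_coords a \<bullet> e i = a i"
  by (simp add: from_coords_def inner_sum_left inner_e sum_if_eq_less)

text \<open>The matrix \<open>R\<close> acts on the first \<open>n\<close> coordinates; padding by the identity turns a statement on
  \<open>\<real>\<^sup>n\<close> with variable \<open>n\<close> into one on the fixed space \<open>'b\<close>.\<close>

definition padded_map :: "nat \<Rightarrow> (nat \<Rightarrow> nat \<Rightarrow> real) \<Rightarrow> 'b \<Rightarrow> 'b" where
  "padded_map n R t = from_coords (\<lambda>i. if i < n then \<Sum>j<n. (t \<bullet> e j) * R j i else t \<bullet> e i)"

lemma bounded_linear_padded_map: "bounded_linear (padded_map n R)"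
proof -
  have "bounded_linear (\<lambda>t. (if i < n then \<Sum>j<n. (t \<bullet> e j) * R j i else t \<bullet> e i) *\<^sub>R e i)" for i
  proof (cases "i < n")
    case True
    have "bounded_linear (\<lambda>t. \<Sum>j<n. (t \<bullet> e j) * R j i)"
      by (intro bounded_linear_sum bounded_linear_mult_const bounded_linear_inner_left)
    then show ?thesis using True by (simp add: bounded_linear_scaleR_const)
  qed (simp add: bounded_linear_scaleR_const bounded_linear_inner_left)
  then show ?thesis
    unfolding padded_map_def[abs_def] from_coords_def by (intro bounded_linear_sum)
qed

text \<open>Coordinates act as row vectors, so this composite belongs to the product R R'; beyond
  index n both maps are the identity.\<close>

lemma padded_map_inverse:
  assumes "n \<le> N" "\<And>j l. j < n \<Longrightarrow> l < n \<Longrightarrow> (\<Sum>i<n. R j i * R' i l) = (if j = l then 1 else 0)"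
  shows "padded_map n R' \<circ> padded_map n R = id"
proof (rule ext, rule e_eqI)
  fix t l assume l: "l < N"
  have "(\<Sum>i<n. (\<Sum>j<n. (t \<bullet> e j) * R j i) * R' i l) = t \<bullet> e l" if "l < n"
    using that by (simp add: sum_mult_swap[symmetric] assms(2) sum_if_eq_less(3))
  then show "(padded_map n R' \<circ> padded_map n R) t \<bullet> e l = id t \<bullet> e l"
    using l assms(1) by (simp add: padded_map_def from_coords_inner)
qed

end

context clocks
begin

text \<open>The composed flows give clocks and f to first order at the base point, and injectivity
  on the orbit makes f(\<Gamma>(t)) a function of the clock values. Its derivative is the one of f
  along \<Gamma> after the inverse of the one of the clocks.\<close>

lemma complete_observable_partial_derivative:
  assumes x: "x \<in> \<C>" and inj: "inj_on (clock_map n T) (gauge_orbit \<A> pb n C x)"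
    and \<tau>: "\<tau> \<in> clock_map n T ` gauge_orbit \<A> pb n C x"
    and f: "f \<in> smooth_functions \<A>" and j: "j < n"
  shows "clock_inverse \<A> pb n C T x \<tau> \<in> \<C>"
    and "has_partial_derivative n (clock_map n T ` gauge_orbit \<A> pb n C x)
      (\<lambda>\<sigma>. complete_observable \<A> pb n C T f \<sigma> x) j \<tau> (S_op \<A> pb n C T j f (clock_inverse \<A> pb n C T x \<tau>))"
proof -
  let ?G = "gauge_orbit \<A> pb n C x"
  obtain y where y: "y \<in> ?G" "\<tau> = clock_map n T y" using \<tau> by auto
  have inv: "clock_inverse \<A> pb n C T x (clock_map n T q) = q" if "q \<in> ?G" for q
    unfolding clock_inverse_def by (rule the_inv_into_f_f[OF inj that])
  have yC: "y \<in> \<C>" by (rule gauge_orbit_surface[OF x y(1)])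
  then show "clock_inverse \<A> pb n C T x \<tau> \<in> \<C>" using inv[OF y(1)] y(2) by simp
  define N where "N = 2 * p"
  have nN: "n \<le> N" using n_less_p by (simp add: N_def)
  obtain e :: "nat \<Rightarrow> 'b" where "bij_betw e {0..<card (Basis :: 'b set)} Basis"
    using ex_bij_betw_nat_finite[OF finite_Basis] by blast
  then have e: "bij_betw e {..<N} Basis" using dimension by (simp add: N_def atLeast0LessThan)
  interpret basis_enumeration e N by unfold_locales (rule e)
  have eB: "e i \<in> Basis" if "i < n" for i using e_Basis[of i] that nN by simp
  obtain \<epsilon> :: real and \<Gamma> :: "'b \<Rightarrow> 'a" where \<epsilon>: "\<epsilon> > 0" and \<Gamma>0: "\<Gamma> 0 = y"
    and orb: "\<And>t. t \<in> ball 0 \<epsilon> \<Longrightarrow> (\<lambda>u v. \<exists>i<n. flow_related \<A> pb (C i) u v)\<^sup>*\<^sup>* y (\<Gamma> t)"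
    and cont\<Gamma>: "continuous_on (ball 0 \<epsilon>) \<Gamma>"
    and der: "\<And>h. h \<in> smooth_functions \<A> \<Longrightarrow>
      ((\<lambda>t. h (\<Gamma> t)) has_derivative (\<lambda>t. \<Sum>i<n. (t \<bullet> e i) * pb (C i) h y)) (at 0)"
    using composed_flows[where e=e and y=y, OF eB] by blast
  have orbit: "\<Gamma> t \<in> ?G" if "t \<in> ball 0 \<epsilon>" for t
    using rtranclp_trans[OF _ orb[OF that], of x] y(1) by (simp add: gauge_orbit_def)
  \<comment> \<open>The first n coordinates are the clock readings along \<Gamma>; the others copy
    t, so that source and target have equal dimension.\<close>
  define \<Psi> where "\<Psi> t = from_coords (\<lambda>i. if i < n then T i (\<Gamma> t) else t \<bullet> e i)" for t
  define R where "R k i = pb (C k) (T i) y" for k i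
  define R' where "R' k i = Ainv y k i" for k i
  have \<Psi>e: "\<Psi> t \<bullet> e i = T i (\<Gamma> t)" if "i < n" for t i
    using that nN by (simp add: \<Psi>_def from_coords_inner)
  have "continuous_on (ball 0 \<epsilon>) (\<lambda>t. if i < n then T i (\<Gamma> t) else t \<bullet> e i)" for i
  proof (cases "i < n")
    case True
    have "continuous_on UNIV (T i)"
      by (rule smooth_fun_on_continuous_on[OF open_UNIV smooth_functionsD[OF T_smooth[OF True]]])
    then have "continuous_on (ball 0 \<epsilon>) (\<lambda>t. T i (\<Gamma> t))"
      by (rule continuous_on_compose2[OF _ cont\<Gamma>]) auto
    then show ?thesis using True by simp
  qed (auto intro!: continuous_intros)
  then have cont: "continuous_on (ball 0 \<epsilon>) \<Psi>"
    unfolding \<Psi>_def[abs_def] from_coords_def by (intro continuous_on_sum continuous_on_scaleR continuous_on_const)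
  have "((\<lambda>t. if i < n then T i (\<Gamma> t) else t \<bullet> e i) has_derivative
      (\<lambda>t. if i < n then \<Sum>j<n. (t \<bullet> e j) * R j i else t \<bullet> e i)) (at 0)" for i
    using der[OF T_smooth] by (cases "i < n") (auto simp: R_def intro!: derivative_eq_intros)
  then have \<Psi>': "(\<Psi> has_derivative padded_map n R) (at 0)"
    unfolding \<Psi>_def[abs_def] padded_map_def[abs_def] from_coords_def
    by (intro has_derivative_sum has_derivative_scaleR_left)
  have RR': "padded_map n R \<circ> padded_map n R' = id" "padded_map n R' \<circ> padded_map n R = id"
    using mat_inv_clock_matrix[OF det_nonzero[OF yC]]
    by (auto intro!: padded_map_inverse[OF nN] simp: R_def R'_def)
  \<comment> \<open>The complete observable as a function on the model space, blind to the
    coordinates beyond n. Injectivity alone gives P(\<Psi>(t)) = f(\<Gamma>(t)); no regularity of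
    the inverse clock map enters.\<close>
  define P where "P w = f (clock_inverse \<A> pb n C T x (Matrix.vec n (\<lambda>i. w \<bullet> e i)))" for w
  have vec\<Psi>: "Matrix.vec n (\<lambda>i. \<Psi> t \<bullet> e i) = clock_map n T (\<Gamma> t)" for t
    by (rule eq_vecI) (simp_all add: clock_map_def \<Psi>e)
  have P\<Psi>: "P (\<Psi> t) = f (\<Gamma> t)" if "t \<in> ball 0 \<epsilon>" for t
    using inv[OF orbit[OF that]] by (simp add: P_def vec\<Psi>)
  note quot = differentiable_quotient[OF \<epsilon> cont \<Psi>' bounded_linear_padded_map RR' der[OF f] P\<Psi>]
  have vecs: "Matrix.vec n (\<lambda>i. (\<Psi> 0 + s *\<^sub>R e j) \<bullet> e i) = \<tau> + s \<cdot>\<^sub>v unit_vec n j" for s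
  proof (rule eq_vecI)
    fix i assume "i < dim_vec (\<tau> + s \<cdot>\<^sub>v unit_vec n j)"
    then have i: "i < n" by simp
    have "(\<Psi> 0 + s *\<^sub>R e j) \<bullet> e i = T i y + s * (if i = j then 1 else 0)"
      using i j nN by (simp add: inner_add_left \<Psi>e \<Gamma>0 inner_e)
    then show "Matrix.vec n (\<lambda>i. (\<Psi> 0 + s *\<^sub>R e j) \<bullet> e i) $ i = (\<tau> + s \<cdot>\<^sub>v unit_vec n j) $ i"
      using i j by (simp add: y(2) clock_map_def)
  qed simp
  have lim: "((\<lambda>s. \<Psi> 0 + s *\<^sub>R e j) \<longlongrightarrow> \<Psi> 0) (nhds (0::real))"
  proof -
    have "isCont (\<lambda>s. \<Psi> 0 + s *\<^sub>R e j) (0::real)" by (intro continuous_intros)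
    then show ?thesis
      using tendsto_at_iff_tendsto_nhds[of "\<lambda>s. \<Psi> 0 + s *\<^sub>R e j" "0::real"] by (simp add: isCont_def)
  qed
  show "has_partial_derivative n (clock_map n T ` ?G)
      (\<lambda>\<sigma>. complete_observable \<A> pb n C T f \<sigma> x) j \<tau> (S_op \<A> pb n C T j f (clock_inverse \<A> pb n C T x \<tau>))"
    unfolding has_partial_derivative_def
  proof
    \<comment> \<open>The image of \<Psi> is a neighbourhood of \<Psi>(0), and the first n
      coordinates of its points are clock values on the orbit, so the line stays in the
      domain.\<close>
    have "\<forall>\<^sub>F s in nhds 0. \<Psi> 0 + s *\<^sub>R e j \<in> \<Psi> ` ball 0 \<epsilon>"
      using eventually_compose_filterlim[OF quot(1) lim] .
    then show "\<forall>\<^sub>F s in nhds 0. \<tau> + s \<cdot>\<^sub>v unit_vec n j \<in> clock_map n T ` ?G"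
    proof eventually_elim
      case (elim s)
      then obtain t where t: "t \<in> ball 0 \<epsilon>" "\<Psi> 0 + s *\<^sub>R e j = \<Psi> t" by auto
      have "\<tau> + s \<cdot>\<^sub>v unit_vec n j = clock_map n T (\<Gamma> t)"
        using vecs[of s] vec\<Psi>[of t] t(2) by simp
      then show ?case using orbit[OF t(1)] by simp
    qed
    have 1: "((\<lambda>s. \<Psi> 0 + s *\<^sub>R e j) has_derivative (\<lambda>s. s *\<^sub>R e j)) (at (0::real))"
      by (auto intro!: derivative_eq_intros)
    have 2: "(P has_derivative (\<lambda>w. \<Sum>i<n. (padded_map n R' w \<bullet> e i) * pb (C i) f y)) (at (\<Psi> 0 + 0 *\<^sub>R e j))"
      using quot(2) by simp
    have "((\<lambda>s. P (\<Psi> 0 + s *\<^sub>R e j)) has_derivative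
        (\<lambda>s. \<Sum>i<n. (padded_map n R' (s *\<^sub>R e j) \<bullet> e i) * pb (C i) f y)) (at (0::real))"
      by (rule has_derivative_compose[OF 1 2])
    \<comment> \<open>In row vector convention the inverse derivative sends e_j to row j of the
      inverse of A, which is the row that defines S_j.\<close>
    moreover have "(\<Sum>i<n. (padded_map n R' (s *\<^sub>R e j) \<bullet> e i) * pb (C i) f y)
        = S_op \<A> pb n C T j f y * s" for s
    proof -
      have "padded_map n R' (s *\<^sub>R e j) \<bullet> e i = s * R' j i" if i: "i < n" for i
      proof -
        have "padded_map n R' (s *\<^sub>R e j) \<bullet> e i = (\<Sum>k<n. (s * (e j \<bullet> e k)) * R' k i)"
          using i nN by (simp add: padded_map_def from_coords_inner)
        also have "\<dots> = (\<Sum>k<n. (if j = k then 1 else 0) * (s * R' k i))"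
          using j nN by (intro sum.cong) (auto simp: inner_e)
        also have "\<dots> = s * R' j i" by (rule sum_if_eq_less(2)[OF j])
        finally show ?thesis .
      qed
      then show ?thesis
        by (simp add: S_op_def R'_def ham_vf_smooth_function[OF C_smooth f] sum_distrib_left mult_ac)
    qed
    ultimately show "((\<lambda>s. complete_observable \<A> pb n C T f (\<tau> + s \<cdot>\<^sub>v unit_vec n j) x)
        has_real_derivative S_op \<A> pb n C T j f (clock_inverse \<A> pb n C T x \<tau>)) (at 0)"
      by (simp add: has_field_derivative_def complete_observable_def P_def vecs inv[OF y(1), folded y(2)])
  qed
qed

end

section \<open>The terms of the formal power series\<close>

context reduced_clocks
begin

lemma series_term_zero:
  "winv f \<Longrightarrow> j \<in> {m..<n} \<Longrightarrow> k j > 0 \<Longrightarrow> x \<in> \<C> \<Longrightarrow> series_term \<A> pb n C T f \<tau> k x = 0"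
  by (simp add: series_term_def S_iter_zero)

lemma series_factors_truncate:
  assumes "\<And>j. j \<in> {m..<n} \<Longrightarrow> k j = 0"
  shows "(\<Prod>i<n. (\<tau> $ i - T i x) ^ k i) = (\<Prod>i<m. (\<tau> $ i - T i x) ^ k i)"
  by (rule prod.mono_neutral_right) (use m_less_n assms in auto)

text \<open>No invariance is assumed of \<open>T i\<close> for i \<ge> m; with exponent 0 its factor
  disappears, and a product of weakly invariant functions is left.\<close>

lemma winv_series_term:
  assumes "winv f" "\<And>j. j \<in> {m..<n} \<Longrightarrow> k j = 0"
  shows "winv (series_term \<A> pb n C T f \<tau> k)"
proof -
  have "series_term \<A> pb n C T f \<tau> k =
      (\<lambda>x. 1 / (\<Prod>i<n. fact (k i)) * S_iter \<A> pb n C T k f x * (\<Prod>i<m. (\<tau> $ i - T i x) ^ k i))"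
    by (rule ext) (simp only: series_term_def series_factors_truncate[OF assms(2)])
  then show ?thesis
    by (simp only:)
      (intro winv_mult winv_const winv_S_iter assms(1) winv_prod winv_power winv_const_minus_T, simp)
qed

text \<open>T' = T gives independence of the components of \<tau> from index m on, and \<tau>' =
  \<tau> independence of the remaining clocks. A term with a positive exponent at an index \<ge> m
  is zero on \<open>\<C>\<close> for both systems; in all others the remaining clocks occur in the
  iterates alone.\<close>

lemma series_term_agree:
  assumes T': "reduced_clocks \<A> pb C n p T' m" "\<And>i. i < m \<Longrightarrow> T' i = T i"
    and f: "winv f" and \<tau>: "\<And>i. i < m \<Longrightarrow> \<tau>' $ i = \<tau> $ i" and x: "x \<in> \<C>"
  shows "series_term \<A> pb n C T' f \<tau>' k x = series_term \<A> pb n C T f \<tau> k x"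
proof -
  interpret T': reduced_clocks \<A> pb C n p T' m by (rule T'(1))
  show ?thesis
  proof (cases "\<exists>j\<in>{m..<n}. k j > 0")
    case True
    then show ?thesis using series_term_zero[OF f _ _ x] T'.series_term_zero[OF f _ _ x] by force
  next
    case False
    then have z: "k j = 0" if "j \<in> {m..<n}" for j using that by auto
    have eq: "(\<Prod>i<m. (\<tau>' $ i - T' i x) ^ k i) = (\<Prod>i<m. (\<tau> $ i - T i x) ^ k i)"
      by (rule prod.cong) (use T'(2) \<tau> in auto)
    show ?thesis
      by (simp only: series_term_def S_iter_agree[OF T' f x] series_factors_truncate[OF z]
          T'.series_factors_truncate[OF z] eq)
  qed
qed

end

theorem mainTheorem11:
  fixes \<A> :: "('a::{t2_space, second_countable_topology}, 'b::euclidean_space) chart set"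
    and pb :: "('a \<Rightarrow> real) \<Rightarrow> ('a \<Rightarrow> real) \<Rightarrow> 'a \<Rightarrow> real"
    and C T :: "nat \<Rightarrow> 'a \<Rightarrow> real" and f :: "'a \<Rightarrow> real" and m n p :: nat
  defines "\<C> \<equiv> constraint_surface n C"
    and "\<G> \<equiv> gauge_orbit \<A> pb n C"
    and "g \<equiv> reduced_derivative pb m C T f"
  assumes atlas: "smooth_atlas \<A>" and dimension: "DIM('b) = 2 * p"
    and poisson: "poisson_bracket \<A> pb" and nondeg: "nondegenerate \<A> pb"
    and n: "n < p" and m: "1 \<le> m" "m < n"
    and C_smooth: "\<forall>i<n. C i \<in> smooth_functions \<A>"
    and independent: "submanifold \<A> (2 * p - n) \<C>"
    and first_class: "bracket_closed \<A> pb C {..<n}"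
    and subalgebra: "bracket_closed \<A> pb C {m..<n}"
    and T_smooth: "\<forall>i<n. T i \<in> smooth_functions \<A>"
    and f_smooth: "f \<in> smooth_functions \<A>"
    and f_inv: "weakly_invariant \<A> pb n C m f"
    and T_inv: "\<forall>i<m. weakly_invariant \<A> pb n C m (T i)"
    and A_invertible: "\<forall>x\<in>\<C>. invertible_mat (clock_matrix pb C T n x)"
  shows
    "(\<forall>x\<in>\<C>. invertible_mat (clock_matrix pb C T m x)) \<and>
     (\<forall>j<m. weakly_invariant \<A> pb n C m (g j)) \<and>
     (\<forall>x\<in>\<C>. inj_on (clock_map n T) (\<G> x) \<longrightarrow>
        (\<forall>\<tau>\<in>clock_map n T ` \<G> x.
           (\<forall>j\<in>{m..<n}. has_partial_derivative n (clock_map n T ` \<G> x)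
              (\<lambda>\<sigma>. complete_observable \<A> pb n C T f \<sigma> x) j \<tau> 0) \<and>
           (\<forall>j<m. has_partial_derivative n (clock_map n T ` \<G> x)
              (\<lambda>\<sigma>. complete_observable \<A> pb n C T f \<sigma> x) j \<tau>
              (g j (clock_inverse \<A> pb n C T x \<tau>))))) \<and>
     (\<forall>k. weakly_invariant \<A> pb n C m (S_iter \<A> pb n C T k f) \<and>
        ((\<exists>j\<in>{m..<n}. k j > 0) \<longrightarrow> (\<forall>x\<in>\<C>. S_iter \<A> pb n C T k f x = 0))) \<and>
     (\<forall>\<tau>\<in>carrier_vec n. \<forall>\<tau>'\<in>carrier_vec n. (\<forall>i<m. \<tau> $ i = \<tau>' $ i) \<longrightarrow>
        (\<forall>k. \<forall>x\<in>\<C>. series_term \<A> pb n C T f \<tau> k x = series_term \<A> pb n C T f \<tau>' k x)) \<and>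
     (\<forall>\<tau>\<in>carrier_vec n. \<forall>k.
        (\<forall>x\<in>\<C>. series_term \<A> pb n C T f \<tau> k x = 0) \<or>
        weakly_invariant \<A> pb n C m (series_term \<A> pb n C T f \<tau> k)) \<and>
     (\<forall>T'. (\<forall>i<n. T' i \<in> smooth_functions \<A>) \<and> (\<forall>i<m. T' i = T i) \<and>
        (\<forall>x\<in>\<C>. invertible_mat (clock_matrix pb C T' n x)) \<longrightarrow>
        (\<forall>\<tau>\<in>carrier_vec n. \<forall>k. \<forall>x\<in>\<C>.
           series_term \<A> pb n C T' f \<tau> k x = series_term \<A> pb n C T f \<tau> k x))"
proof -
  interpret constrained_system \<A> pb C n p
    by unfold_locales
      (use atlas poisson dimension n C_smooth independent first_class in \<open>simp_all add: \<C>_def\<close>)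
  \<comment> \<open>Stated for every T', since the alternative clocks of the last claim must carry
    the same structure as T.\<close>
  have rc: "reduced_clocks \<A> pb C n p T' m"
    if "\<forall>i<n. T' i \<in> smooth_functions \<A>" "\<forall>i<m. T' i = T i"
      "\<forall>x\<in>\<C>. invertible_mat (clock_matrix pb C T' n x)" for T'
    by unfold_locales (use that m(2) T_inv in \<open>simp_all add: \<C>_def\<close>)
  interpret reduced_clocks \<A> pb C n p T m
    by (rule rc) (use T_smooth A_invertible in auto)
  have a: "\<forall>x\<in>\<C>. invertible_mat (clock_matrix pb C T m x)"
    using invertible_mat_if_det_nonzero[OF clock_matrix_carrier reduced_det_nonzero]
    by (simp add: \<C>_def)
  have b: "\<forall>j<m. winv (g j)"
    unfolding g_def using winv_reduced_derivative(1)[OF f_inv f_smooth] by blast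
  have c: "has_partial_derivative n (clock_map n T ` \<G> x)
      (\<lambda>\<sigma>. complete_observable \<A> pb n C T f \<sigma> x) j \<tau>
      (if j < m then g j (clock_inverse \<A> pb n C T x \<tau>) else 0)"
    if "x \<in> \<C>" "inj_on (clock_map n T) (\<G> x)" "\<tau> \<in> clock_map n T ` \<G> x" "j < n" for x \<tau> j
  proof -
    note pd = complete_observable_partial_derivative[OF that(1-3)[unfolded \<C>_def \<G>_def] f_smooth that(4)]
    have eq: "S j f (clock_inverse \<A> pb n C T x \<tau>) = (if j < m then g j (clock_inverse \<A> pb n C T x \<tau>) else 0)"
      using winv_reduced_derivative(2)[OF f_inv f_smooth _ pd(1), of j]
        S_zero_on_surface[OF f_inv pd(1), of j] that(4) by (simp add: g_def)
    show ?thesis using pd(2) unfolding eq \<G>_def .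
  qed
  have d: "winv (S_iter \<A> pb n C T k f) \<and>
      ((\<exists>j\<in>{m..<n}. k j > 0) \<longrightarrow> (\<forall>x\<in>\<C>. S_iter \<A> pb n C T k f x = 0))" for k
    using winv_S_iter[OF f_inv] S_iter_zero[OF f_inv] by (auto simp: \<C>_def)
  have e: "(\<forall>x\<in>\<C>. series_term \<A> pb n C T f \<tau> k x = 0) \<or> winv (series_term \<A> pb n C T f \<tau> k)" for \<tau> k
  proof (cases "\<exists>j\<in>{m..<n}. k j > 0")
    case True
    then show ?thesis using series_term_zero[OF f_inv] by (auto simp: \<C>_def)
  next
    case False
    have "winv (series_term \<A> pb n C T f \<tau> k)"
      by (rule winv_series_term[OF f_inv]) (use False in simp)
    then show ?thesis by (rule disjI2)
  qed
  have h: "series_term \<A> pb n C T' f \<tau>' k x = series_term \<A> pb n C T f \<tau> k x"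
    if "reduced_clocks \<A> pb C n p T' m" "\<forall>i<m. T' i = T i" "\<forall>i<m. \<tau>' $ i = \<tau> $ i" "x \<in> \<C>" for T' \<tau> \<tau>' k x
    using series_term_agree[OF that(1) _ f_inv] that(2-4) by (simp add: \<C>_def)
  show ?thesis
  proof (intro conjI)
    show "\<forall>x\<in>\<C>. inj_on (clock_map n T) (\<G> x) \<longrightarrow>
        (\<forall>\<tau>\<in>clock_map n T ` \<G> x.
           (\<forall>j\<in>{m..<n}. has_partial_derivative n (clock_map n T ` \<G> x)
              (\<lambda>\<sigma>. complete_observable \<A> pb n C T f \<sigma> x) j \<tau> 0) \<and>
           (\<forall>j<m. has_partial_derivative n (clock_map n T ` \<G> x)
              (\<lambda>\<sigma>. complete_observable \<A> pb n C T f \<sigma> x) j \<tau>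
              (g j (clock_inverse \<A> pb n C T x \<tau>))))"
    proof (intro ballI impI conjI allI)
      fix x \<tau> j
      assume *: "x \<in> \<C>" "inj_on (clock_map n T) (\<G> x)" "\<tau> \<in> clock_map n T ` \<G> x"
      show "has_partial_derivative n (clock_map n T ` \<G> x)
          (\<lambda>\<sigma>. complete_observable \<A> pb n C T f \<sigma> x) j \<tau> 0" if "j \<in> {m..<n}"
        using c[OF *, of j] that by simp
      show "has_partial_derivative n (clock_map n T ` \<G> x)
          (\<lambda>\<sigma>. complete_observable \<A> pb n C T f \<sigma> x) j \<tau> (g j (clock_inverse \<A> pb n C T x \<tau>))" if "j < m"
        using c[OF *, of j] that m(2) by simp
    qed
    show "\<forall>\<tau>\<in>carrier_vec n. \<forall>\<tau>'\<in>carrier_vec n. (\<forall>i<m. \<tau> $ i = \<tau>' $ i) \<longrightarrow>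
        (\<forall>k. \<forall>x\<in>\<C>. series_term \<A> pb n C T f \<tau> k x = series_term \<A> pb n C T f \<tau>' k x)"
      using h[OF reduced_clocks_axioms] by blast
    show "\<forall>T'. (\<forall>i<n. T' i \<in> smooth_functions \<A>) \<and> (\<forall>i<m. T' i = T i) \<and>
        (\<forall>x\<in>\<C>. invertible_mat (clock_matrix pb C T' n x)) \<longrightarrow>
        (\<forall>\<tau>\<in>carrier_vec n. \<forall>k. \<forall>x\<in>\<C>.
           series_term \<A> pb n C T' f \<tau> k x = series_term \<A> pb n C T f \<tau> k x)"
      using h[OF rc] by blast
  qed (use a b d e in blast)+
qed

end
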